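(* Let $N\ge2$, let $\eta\in\mathbb{R}$, and let $K\in\mathbb{R}^{N\times N}$ be a symmetric matrix with $K\mathds{1}_N=0$, whose eigenvalues are $\lambda_1=0$ (with eigenvector $\mathds{1}_N$) and $\lambda_2,\dots,\lambda_N\in\mathbb{R}$. Let $x(t)\in\mathbb{R}^N$ be the network error, satisfying $\mathds{1}_N^\top x(t)=0$ and $$\frac{d^2x(t)}{dt^2}=-\eta\frac{dx(t)}{dt}-\eta K x(t-1)+\Omega\frac{d\bar w(t)}{dt},$$ (understood as an Itô stochastic delay differential equation for the pair $(x,dx/dt)$), where $\Omega=I_N-\frac1N\mathds{1}_N\mathds{1}_N^\top$ and $\bar w$ is a standard $N$-dimensional Brownian motion. Then the following hold. (1) The network error is mean-square stable if $$\lambda_j\in\left(0,\frac{\beta}{\sin\beta}\right),\quad \eta=\beta\tan\beta,\quad \beta\in\left(0,\frac{\pi}{2}\right),\qquad j=2,\dots,N \qquad ( * )$$ (that is, there is $\beta\in(0,\pi/2)$ with $\eta=\beta\tan\beta$ and $0<\lambda_j<\beta/\sin\beta$ for all $j=2,\dots,N$). (2) Condition $( * )$ can be equivalently written as $$(\eta,\lambda_j)\in\mathcal{S}:=\left\{(\eta,\lambda)\in\mathbb{R}^2:\ \eta>0,\ \lambda>0,\ \lambda<\phi(\eta)\right\},\qquad j=2,\dots,N,$$ where $\phi$ is the function defined implicitly by $\phi(\eta)=\beta/\sin\beta$ with $\beta\in(0,\pi/2)$ the unique solution of $\beta\tan\beta=\eta$ for $\eta>0$; $\phi$ is concave and increasing,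 and (with the value at $0$ defined by continuity) $$\phi(0)=1,\qquad \lim_{\eta\to+\infty}\phi(\eta)=\frac{\pi}{2}.$$ (3) If there exists $j\neq1$ such that $(\eta,\lambda_j)\notin\overline{\mathcal{S}}$, where $\overline{\mathcal{S}}$ is the closure of $\mathcal{S}$, then the system is mean-square unstable.
   Context: $\mathds{1}_N\in\mathbb{R}^N$ is the vector of all ones. The setting: $N$ agents with scalar states $\bar x_i(t)$ obey $\frac{d^2\bar x_i(t)}{dt^2}=u_i(t)+\frac{d\bar w_i(t)}{dt}$, with independent standard Brownian motions $\bar w_i$, under the proportional-derivative control $u_i(t)=\eta\,u_{P,i}(t)-\eta\frac{d\bar x_i(t)}{dt}$, where $u_P(t)=-K\bar x(t-1)$; time and gains have been rescaled so that the feedback delay equals $1$. The network error is $x(t)=\Omega\bar x(t)$, the mismatch between agent states and the average network state. Initial data (a history for $x$ on $[-1,0]$ and a velocity at time $0$) are deterministic, continuous, and orthogonal to $\mathds{1}_N$. Mean-square stable means that, for all such initial data, $\mathbb{E}[\|x(t)\|^2+\|dx(t)/dt\|^2]$ converges to a finite limit as $t\to+\infty$; mean-square unstable means not mean-square stable. *)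

theory Defs
  imports "HOL-Probability.Probability"
begin

definition ones :: "real ^ 'n" where
  "ones = (\<chi> i. 1)"

definition Omega :: "real ^ 'n ^ 'n" where
  "Omega = mat 1 - (1 / real CARD('n)) *\<^sub>R (\<chi> i j. ones $ i * ones $ j)"

text \<open>The eigenvalues of a matrix, counted with algebraic multiplicity, listed as
  \<open>lam 1, \<dots>, lam N\<close>.\<close>

definition eigenvalue_list :: "real ^ 'n ^ 'n \<Rightarrow> (nat \<Rightarrow> real) \<Rightarrow> bool" where
  "eigenvalue_list K lam \<longleftrightarrow>
     (\<forall>z::real. det (mat z - K) = (\<Prod>j = 1..CARD('n). z - lam j))"

context prob_space
begin

definition standard_brownian_motion :: "(real \<Rightarrow> 'a \<Rightarrow> real) \<Rightarrow> bool" where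
  "standard_brownian_motion b \<longleftrightarrow>
     (\<forall>t\<ge>0. random_variable borel (b t)) \<and>
     (AE \<omega> in M. b 0 \<omega> = 0) \<and>
     (AE \<omega> in M. continuous_on {0..} (\<lambda>t. b t \<omega>)) \<and>
     (\<forall>s t. 0 \<le> s \<and> s < t \<longrightarrow>
        distributed M lborel (\<lambda>\<omega>. b t \<omega> - b s \<omega>) (normal_density 0 (sqrt (t - s)))) \<and>
     (\<forall>n (t :: nat \<Rightarrow> real). 0 \<le> t 0 \<and> (\<forall>i<n. t i \<le> t (Suc i)) \<longrightarrow>
        indep_vars (\<lambda>_. borel) (\<lambda>i \<omega>. b (t (Suc i)) \<omega> - b (t i) \<omega>) {..<n})"

text \<open>The components are independent as processes, that is, as random elements of
  the space of real functions on \<open>[0, \<infinity>)\<close> with its product sigma-algebra.\<close>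

definition vector_brownian_motion :: "(real \<Rightarrow> 'a \<Rightarrow> real ^ 'n) \<Rightarrow> bool" where
  "vector_brownian_motion w \<longleftrightarrow>
     (\<forall>i. standard_brownian_motion (\<lambda>t \<omega>. w t \<omega> $ i)) \<and>
     indep_vars (\<lambda>_. PiM {0..} (\<lambda>_. borel)) (\<lambda>i \<omega>. \<lambda>t\<in>{0..}. w t \<omega> $ i) (UNIV :: 'n set)"

text \<open>The filtration generated by \<open>w\<close>, augmented by the null sets.\<close>

definition augmented_filtration :: "(real \<Rightarrow> 'a \<Rightarrow> real ^ 'n) \<Rightarrow> real \<Rightarrow> 'a measure" where
  "augmented_filtration w t =
     sigma (space M) ({w s -` A \<inter> space M | s A. 0 \<le> s \<and> s \<le> t \<and> A \<in> sets borel} \<union> null_sets M)"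

text \<open>The pair \<open>(x, v)\<close>, with \<open>v\<close> the time derivative of \<open>x\<close>, is a strong solution of
  \<open>dx(t) = v(t) dt\<close>, \<open>dv(t) = (- \<eta> v(t) - \<eta> K x(t - 1)) dt + \<Omega> dw(t)\<close>
  on \<open>t \<ge> 0\<close>. The diffusion coefficient is constant, so that its Ito integral over
  \<open>[0, t]\<close> is \<open>\<Omega> (w(t) - w(0))\<close>.\<close>

definition network_error_solution ::
  "(real \<Rightarrow> 'a \<Rightarrow> real ^ 'n) \<Rightarrow> real \<Rightarrow> real ^ 'n ^ 'n \<Rightarrow> (real \<Rightarrow> real ^ 'n) \<Rightarrow> real ^ 'n
     \<Rightarrow> (real \<Rightarrow> 'a \<Rightarrow> real ^ 'n) \<Rightarrow> (real \<Rightarrow> 'a \<Rightarrow> real ^ 'n) \<Rightarrow> bool" where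
  "network_error_solution w \<eta> K hist v0 x v \<longleftrightarrow>
     (\<forall>t\<ge>0. x t \<in> borel_measurable (augmented_filtration w t) \<and>
            v t \<in> borel_measurable (augmented_filtration w t)) \<and>
     (AE \<omega> in M.
        continuous_on {-1..} (\<lambda>t. x t \<omega>) \<and> continuous_on {0..} (\<lambda>t. v t \<omega>) \<and>
        (\<forall>s\<in>{-1..0}. x s \<omega> = hist s) \<and> v 0 \<omega> = v0 \<and>
        (\<forall>t\<ge>-1. ones \<bullet> x t \<omega> = 0) \<and>
        (\<forall>t\<ge>0. x t \<omega> = x 0 \<omega> + integral {0..t} (\<lambda>s. v s \<omega>)) \<and>
        (\<forall>t\<ge>0. v t \<omega> = v 0 \<omega>
           + integral {0..t} (\<lambda>s. - (\<eta> *\<^sub>R v s \<omega>) - \<eta> *\<^sub>R (K *v x (s - 1) \<omega>))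
           + Omega *v (w t \<omega> - w 0 \<omega>)))"

definition admissible_initial_data :: "(real \<Rightarrow> real ^ 'n) \<Rightarrow> real ^ 'n \<Rightarrow> bool" where
  "admissible_initial_data hist v0 \<longleftrightarrow>
     continuous_on {-1..0} hist \<and> (\<forall>s\<in>{-1..0}. ones \<bullet> hist s = 0) \<and> ones \<bullet> v0 = 0"

text \<open>The expectation of the nonnegative random variable is taken in \<open>[0, \<infinity>]\<close>, so that
  a non-integrable one is not assigned the value 0.\<close>

definition mean_square_stable ::
  "(real \<Rightarrow> 'a \<Rightarrow> real ^ 'n) \<Rightarrow> real \<Rightarrow> real ^ 'n ^ 'n \<Rightarrow> bool" where
  "mean_square_stable w \<eta> K \<longleftrightarrow>
     (\<forall>hist v0 x v. admissible_initial_data hist v0 \<and> network_error_solution w \<eta> K hist v0 x v \<longrightarrow>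
        (\<exists>L::real. ((\<lambda>t. \<integral>\<^sup>+ \<omega>. ennreal ((norm (x t \<omega>))\<^sup>2 + (norm (v t \<omega>))\<^sup>2) \<partial>M)
                     \<longlongrightarrow> ennreal L) at_top))"

definition mean_square_unstable ::
  "(real \<Rightarrow> 'a \<Rightarrow> real ^ 'n) \<Rightarrow> real \<Rightarrow> real ^ 'n ^ 'n \<Rightarrow> bool" where
  "mean_square_unstable w \<eta> K \<longleftrightarrow> \<not> mean_square_stable w \<eta> K"

end

definition stability_condition :: "nat \<Rightarrow> real \<Rightarrow> (nat \<Rightarrow> real) \<Rightarrow> bool" where
  "stability_condition N \<eta> lam \<longleftrightarrow>
     (\<exists>\<beta>\<in>{0<..<pi/2}. \<eta> = \<beta> * tan \<beta> \<and> (\<forall>j\<in>{2..N}. lam j \<in> {0<..<\<beta> / sin \<beta>}))"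

definition beta_of :: "real \<Rightarrow> real" where
  "beta_of \<eta> = (THE \<beta>. \<beta> \<in> {0<..<pi/2} \<and> \<beta> * tan \<beta> = \<eta>)"

text \<open>Meaningful for \<open>\<eta> \<ge> 0\<close> only; the value at 0 is the limit from the right.\<close>

definition phi :: "real \<Rightarrow> real" where
  "phi \<eta> = (if \<eta> = 0 then Lim (at_right 0) (\<lambda>h. beta_of h / sin (beta_of h))
            else beta_of \<eta> / sin (beta_of \<eta>))"

definition stability_region :: "(real \<times> real) set" where
  "stability_region = {(\<eta>, l). \<eta> > 0 \<and> l > 0 \<and> l < phi \<eta>}"

end

theory Submission
  imports Defs "HOL-Complex_Analysis.Complex_Analysis" "HOL-Real_Asymp.Real_Asymp"
begin

text \<open>In an orthonormal eigenbasis of \<open>K\<close> containing a multiple of \<open>ones\<close> the network error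
  splits into scalar equations \<open>x'' = - \<eta> x' - c x(t - 1) + noise\<close> with \<open>c = \<eta> \<lambda>\<close>, whose
  characteristic function is \<open>z\<^sup>2 + \<eta> z + c exp (- z)\<close>. Variation of constants with the fundamental
  solution \<open>g\<close> writes the second moments of \<open>x\<close> and \<open>x'\<close> at time \<open>t\<close> as the square of the solution
  without noise plus the integral over \<open>[0, t]\<close> of \<open>g\<^sup>2\<close> and \<open>g'\<^sup>2\<close> respectively.

  Under the stability condition a root with \<open>Re z \<ge> 0\<close> is excluded by comparing moduli if
  \<open>\<bar>Im z\<bar> \<ge> \<beta>\<close> and arguments if \<open>\<bar>Im z\<bar> < \<beta>\<close>. Roots in a right half-plane being bounded, a strip to the
  left of the imaginary axis is also free of roots, and moving the line of Laplace inversion into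
  that strip shows that \<open>g\<close> and \<open>g'\<close> decay exponentially. Outside the closed region the intermediate
  value theorem, on the real axis or along the curve of roots with prescribed imaginary part, gives a
  root with \<open>Re z > 0\<close>, hence an unbounded solution of the equation without noise, and adding it to a
  solution with noise makes a second moment unbounded.

  In terms of \<open>\<beta>\<close> the derivative of \<open>phi\<close> at \<open>\<beta> tan \<beta>\<close> is positive with nonpositive logarithmic
  derivative, whence \<open>phi\<close> is increasing and concave.\<close>

section \<open>The boundary curve\<close>

text \<open>The diffusion coefficient is constant, so the equations are solved path by path, for
  noise paths that are merely continuous. The velocity is then not differentiable; only velocity
  minus noise is, and Wiener integrals appear integrated by parts, as ordinary integrals of the path
  against the derivative of the kernel. What probability has to supply for the second moments is the
  mean 0, the covariance \<open>min s r\<close> and the continuity of paths. Stability quantifies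
  over all solutions and would hold vacuously if there were none, so instability needs an adapted
  solution to be constructed; solving path by path does not by itself give measurability. For
  \<open>\<eta> = 0\<close> the gain \<open>c = \<eta> \<lambda>\<close> vanishes and the
  characteristic function is \<open>z\<^sup>2\<close>, without roots in the open right half-plane.
  This value of \<open>\<eta>\<close> is unstable through linear instead of exponential
  growth.\<close>

lemma sin_minus_mult_cos_pos:
  fixes b :: real assumes "0 < b" "b < pi" shows "b * cos b < sin b"
proof -
  have "sin 0 - 0 * cos 0 < sin b - b * cos b"
  proof (rule DERIV_pos_imp_increasing_open[OF assms(1)])
    fix x :: real assume "0 < x" "x < b"
    then show "\<exists>y. ((\<lambda>b. sin b - b * cos b) has_real_derivative y) (at x) \<and> 0 < y"
      using assms by (intro exI[of _ "x * sin x"] conjI)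
        (auto intro!: derivative_eq_intros simp: sin_gt_zero)
  qed (auto intro!: continuous_intros)
  then show ?thesis by simp
qed

lemma mult_tan_strict_mono:
  fixes x y :: real
  assumes "0 \<le> x" "x < y" "y < pi/2"
  shows "x * tan x < y * tan y"
proof -
  have "tan x < tan y" using assms by (intro tan_monotone) auto
  moreover have "0 \<le> tan x" using assms tan_gt_zero[of x] by (cases "x = 0") auto
  ultimately show ?thesis using assms by (intro mult_strict_mono') auto
qed

lemma filterlim_mult_tan_at_left: "filterlim (\<lambda>b::real. b * tan b) at_top (at_left (pi/2))"
  by (rule filterlim_tendsto_pos_mult_at_top[of _ "pi/2"])
    (auto intro!: tendsto_eq_intros filterlim_tan_at_left)

lemma ex1_mult_tan_eq:
  fixes h :: real assumes "h > 0"
  shows "\<exists>!b. b \<in> {0<..<pi/2} \<and> b * tan b = h"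
proof -
  have "\<forall>\<^sub>F b in at_left (pi/2). b * tan b \<ge> h"
    using filterlim_mult_tan_at_left by (auto simp: filterlim_at_top)
  moreover have "\<forall>\<^sub>F b in at_left (pi/2). b \<in> {0<..<pi/2::real}"
    by (intro eventually_at_left_real) simp
  ultimately have "\<forall>\<^sub>F b in at_left (pi/2). b \<in> {0<..<pi/2::real} \<and> b * tan b \<ge> h"
    by eventually_elim simp
  then obtain c where c: "c \<in> {0<..<pi/2}" "c * tan c \<ge> h"
    using eventually_happens trivial_limit_at_left_real by blast
  have "cos x \<noteq> 0" if "x \<in> {0..c}" for x
    using that c cos_gt_zero_pi[of x] by auto
  then have "continuous_on {0..c} (\<lambda>x. x * tan x)" by (intro continuous_intros) auto
  then have "\<exists>x\<ge>0. x \<le> c \<and> x * tan x = h"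
    using assms c by (intro IVT') auto
  then obtain x where x: "0 \<le> x" "x \<le> c" "x * tan x = h" by auto
  moreover have "x \<noteq> 0" using x assms by auto
  ultimately have 1: "x \<in> {0<..<pi/2} \<and> x * tan x = h" using c by auto
  show ?thesis
  proof (rule ex1I, rule 1)
    fix y assume "y \<in> {0<..<pi/2} \<and> y * tan y = h"
    then show "y = x"
      using mult_tan_strict_mono[of x y] mult_tan_strict_mono[of y x] 1
      by (cases x y rule: linorder_cases) auto
  qed
qed

section \<open>The inverse function of \<open>b * tan b\<close> and the derivative of
  \<open>phi\<close>\<close>

lemma beta_of:
  assumes "h > 0" shows "0 < beta_of h" "beta_of h < pi/2" "beta_of h * tan (beta_of h) = h"
  using theI'[OF ex1_mult_tan_eq[OF assms]] unfolding beta_of_def by auto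

lemma beta_of_unique:
  assumes "0 < b" "b < pi/2" shows "beta_of (b * tan b) = b"
proof -
  have "b * tan b > 0" using assms by (intro mult_pos_pos tan_gt_zero) auto
  then show ?thesis
    using beta_of[of "b * tan b"] ex1_mult_tan_eq[of "b * tan b"] assms by auto
qed

lemma beta_of_strict_mono:
  assumes "0 < x" "x < y" shows "beta_of x < beta_of y"
proof (rule ccontr)
  assume "\<not> ?thesis"
  then have "beta_of y \<le> beta_of x" by simp
  then have "beta_of y * tan (beta_of y) \<le> beta_of x * tan (beta_of x)"
    using mult_tan_strict_mono[of "beta_of y" "beta_of x"] beta_of[of x] beta_of[of y] assms
    by (cases "beta_of y = beta_of x") auto
  then show False using beta_of[of x] beta_of[of y] assms by simp
qed

lemma DERIV_mult_tan:
  fixes b :: real assumes "0 < b" "b < pi/2"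
  shows "((\<lambda>b. b * tan b) has_real_derivative ((sin b * cos b + b) / (cos b)\<^sup>2)) (at b)"
proof -
  have c: "cos b \<noteq> 0" using assms cos_gt_zero_pi[of b] by auto
  have "((\<lambda>b. b * tan b) has_real_derivative (tan b + b * inverse ((cos b)\<^sup>2))) (at b)"
    using c by (auto intro!: derivative_eq_intros)
  moreover have "tan b + b * inverse ((cos b)\<^sup>2) = (sin b * cos b + b) / (cos b)\<^sup>2"
    using c by (simp add: tan_def field_simps power2_eq_square)
  ultimately show ?thesis by simp
qed

text \<open>Differentiating an inverse function presupposes its continuity, which is therefore
  settled before \<open>DERIV_beta_of\<close>.\<close>

lemma isCont_beta_of:
  assumes "h > 0" shows "isCont beta_of h"
proof -
  \<comment> \<open>Half the distance to the nearer end of \<open>(0, pi/2)\<close>, so that the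
    whole neighbourhood stays where \<open>beta_of_unique\<close> applies.\<close>
  let ?b = "beta_of h" let ?d = "min (?b / 2) ((pi/2 - ?b) / 2)"
  have "isCont beta_of (?b * tan ?b)"
  proof (rule isCont_inverse_function[where d = ?d and x = ?b])
    show "0 < ?d" using beta_of[OF assms] by auto
    fix z :: real assume "\<bar>z - ?b\<bar> \<le> ?d"
    then have z: "0 < z" "z < pi/2" using beta_of[OF assms] by (auto simp: abs_le_iff min_def split: if_splits)
    show "beta_of (z * tan z) = z" using beta_of_unique z by auto
    show "isCont (\<lambda>b. b * tan b) z" using DERIV_mult_tan[OF z] DERIV_isCont by blast
  qed
  then show ?thesis using beta_of[OF assms] by simp
qed

lemma DERIV_beta_of:
  assumes "h > 0" and b: "b = beta_of h"
  shows "(beta_of has_real_derivative inverse ((sin b * cos b + b) / (cos b)\<^sup>2)) (at h)"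
proof (rule DERIV_inverse_function[where f = "\<lambda>b. b * tan b" and a = 0 and b = "h + 1"])
  have bb: "0 < b" "b < pi/2" using beta_of[OF assms(1)] b by auto
  show "((\<lambda>b. b * tan b) has_real_derivative (sin b * cos b + b) / (cos b)\<^sup>2) (at (beta_of h))"
    using DERIV_mult_tan[OF bb] b by simp
  have "0 < sin b" "0 < cos b" using bb by (auto intro: sin_gt_zero cos_gt_zero)
  then show "(sin b * cos b + b) / (cos b)\<^sup>2 \<noteq> 0" using bb
    by (simp add: add_pos_pos less_imp_neq[symmetric])
qed (use assms beta_of isCont_beta_of in auto)

text \<open>\<open>phi_slope b\<close> is \<open>(d/db (b / sin b)) / (d/db (b tan b))\<close>, the derivative of \<open>phi\<close> at
  \<open>b tan b\<close>.\<close>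

definition phi_slope :: "real \<Rightarrow> real" where
  "phi_slope b = (sin b - b * cos b) / (sin b)\<^sup>2 * ((cos b)\<^sup>2 / (sin b * cos b + b))"

lemma DERIV_phi:
  assumes "h > 0" shows "(phi has_real_derivative phi_slope (beta_of h)) (at h)"
proof -
  define b where "b = beta_of h"
  have b: "0 < b" "b < pi/2" using beta_of[OF assms] by (auto simp: b_def)
  have s: "0 < sin b" using b by (auto intro: sin_gt_zero)
  have "((\<lambda>x. beta_of x / sin (beta_of x)) has_real_derivative phi_slope b) (at h)"
  proof -
    let ?d = "inverse ((sin b * cos b + b) / (cos b)\<^sup>2)"
    have "((\<lambda>x. beta_of x / sin (beta_of x)) has_real_derivative
        (?d * sin b - b * (cos b * ?d)) / (sin b)\<^sup>2) (at h)"
      using DERIV_beta_of[OF assms b_def] s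
      by (auto intro!: derivative_eq_intros simp: b_def[symmetric] power2_eq_square)
    also have "(?d * sin b - b * (cos b * ?d)) / (sin b)\<^sup>2 = phi_slope b"
    proof -
      have "inverse (X / Y) * S - b * (C * inverse (X / Y)) = (S - b * C) * (Y / X)"
        for X Y S C :: real by (simp add: algebra_simps diff_divide_distrib)
      then show ?thesis by (simp add: phi_slope_def)
    qed
    finally show ?thesis .
  qed
  moreover have "\<forall>\<^sub>F x in nhds h. phi x = beta_of x / sin (beta_of x)"
    by (rule eventually_mono[OF eventually_nhds_in_open[of "{0<..}" h]])
      (use assms in \<open>auto simp: phi_def\<close>)
  ultimately show ?thesis
    using DERIV_cong_ev[of h h phi "\<lambda>x. beta_of x / sin (beta_of x)"] b_def by blast
qed

lemma phi_slope_pos: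
  assumes "0 < b" "b < pi/2" shows "phi_slope b > 0"
proof -
  have "0 < sin b" "0 < cos b" using assms by (auto intro: sin_gt_zero cos_gt_zero)
  then show ?thesis unfolding phi_slope_def using sin_minus_mult_cos_pos[of b] assms
    by (intro mult_pos_pos divide_pos_pos add_pos_pos) auto
qed

text \<open>After division this is \<open>b s / (s - b c) \<le> 3 / b\<close>. The constant 3 is
  forced at 0, where \<open>sin b - b * cos b\<close> behaves like \<open>b^3 / 3\<close>; the
  difference of the two sides has the derivative \<open>b * (sin b - b * cos b)\<close>.\<close>

lemma square_mult_sin_le:
  fixes b :: real assumes "0 \<le> b" "b \<le> pi" shows "b\<^sup>2 * sin b \<le> 3 * (sin b - b * cos b)"
proof -
  let ?f = "\<lambda>b. 3 * (sin b - b * cos b) - b\<^sup>2 * sin b"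
  have "?f 0 \<le> ?f b"
  proof (rule DERIV_nonneg_imp_nondecreasing[OF assms(1)])
    fix x assume x: "0 \<le> x" "x \<le> b"
    then have "0 \<le> x * (sin x - x * cos x)"
      using sin_minus_mult_cos_pos[of x] assms by (cases "x = 0 \<or> x = pi") auto
    moreover have "(?f has_real_derivative x * (sin x - x * cos x)) (at x)"
      by (auto intro!: derivative_eq_intros simp: algebra_simps power2_eq_square)
    ultimately show "\<exists>y. (?f has_real_derivative y) (at x) \<and> 0 \<le> y" by blast
  qed
  then show ?thesis by simp
qed

text \<open>Needed at the angle \<open>2 * b\<close>, to bound \<open>3 / b\<close> from above. Both
  sides agree to third order at 0, so two differentiations are made; the second derivative of the
  difference is \<open>4 * sin x * (2 * sin x - x * cos x)\<close>, nonnegative by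
  \<open>sin_minus_mult_cos_pos\<close>.\<close>

lemma three_sin_square_le:
  fixes x :: real assumes "0 \<le> x" "x \<le> pi"
  shows "3 * (sin x)\<^sup>2 \<le> 2 * x\<^sup>2 + x * sin x * cos x"
proof -
  let ?g = "\<lambda>x. 4 * x + x * (2 * (cos x)\<^sup>2 - 1) - 5 * sin x * cos x"
  let ?f = "\<lambda>x. 2 * x\<^sup>2 + x * sin x * cos x - 3 * (sin x)\<^sup>2"
  have sc: "sin x * sin x = 1 - cos x * cos x" for x :: real
    using sin_cos_squared_add3[of x] by (simp add: algebra_simps)
  have sc3: "sin x * (sin x * 3) = 3 - cos x * (cos x * 3)" for x :: real
    using sc[of x] by simp
  have g: "0 \<le> ?g x" if "0 \<le> x" "x \<le> pi" for x
  proof -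
    have "?g 0 \<le> ?g x"
    proof (rule DERIV_nonneg_imp_nondecreasing[OF that(1)])
      fix y assume y: "0 \<le> y" "y \<le> x"
      then have "y * cos y \<le> sin y" using sin_minus_mult_cos_pos[of y] that
        by (cases "y = 0 \<or> y = pi") auto
      moreover have "0 \<le> sin y" using y that by (auto intro: sin_ge_zero)
      ultimately have "0 \<le> 4 * sin y * ((sin y - y * cos y) + sin y)" by simp
      also have "4 * sin y * ((sin y - y * cos y) + sin y)
          = 3 + 2 * (cos y)\<^sup>2 - 4 * y * sin y * cos y - 5 * ((cos y)\<^sup>2 - (sin y)\<^sup>2)"
        using sc3[of y] by (simp add: algebra_simps power2_eq_square)
      finally have "0 \<le> \<dots>" .
      moreover have "(?g has_real_derivative \<dots>) (at y)"
        using sc3[of y] by (auto intro!: derivative_eq_intros simp: algebra_simps power2_eq_square)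
      ultimately show "\<exists>z. (?g has_real_derivative z) (at y) \<and> 0 \<le> z" by blast
    qed
    then show ?thesis by simp
  qed
  have "?f 0 \<le> ?f x"
  proof (rule DERIV_nonneg_imp_nondecreasing[OF assms(1)])
    fix y assume y: "0 \<le> y" "y \<le> x"
    have "(?f has_real_derivative ?g y) (at y)"
      using arg_cong[OF sc[of y], of "\<lambda>z. y * z"]
      by (auto intro!: derivative_eq_intros simp: algebra_simps power2_eq_square)
    then show "\<exists>z. (?f has_real_derivative z) (at y) \<and> 0 \<le> z" using g[of y] y assms by auto
  qed
  then show ?thesis by simp
qed

text \<open>The logarithmic derivative of \<open>phi_slope\<close> is
  \<open>b s / (s - b c) - 2 / (s c) - 2 c\<^sup>2 / (s c + b)\<close> with \<open>s = sin b\<close>, \<open>c = cos b\<close>; the value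
  \<open>3 / b\<close> separates its positive part from its negative part.\<close>

lemma phi_slope_antimono:
  assumes "0 < x" "x \<le> y" "y < pi/2" shows "phi_slope y \<le> phi_slope x"
proof -
  let ?L = "\<lambda>b. ln (sin b - b * cos b) - 2 * ln (sin b) + 2 * ln (cos b) - ln (sin b * cos b + b)"
  have pos: "0 < sin b" "0 < cos b" "0 < sin b - b * cos b" "0 < sin b * cos b + b"
    if "0 < b" "b < pi/2" for b
    using that sin_minus_mult_cos_pos[of b]
    by (auto intro!: sin_gt_zero cos_gt_zero add_pos_pos mult_pos_pos)
  have L: "phi_slope b = exp (?L b)" if "0 < b" "b < pi/2" for b
    using pos[OF that] unfolding phi_slope_def exp_add exp_diff mult_2 power2_eq_square
    by (simp add: times_divide_times_eq)
  have "?L y \<le> ?L x"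
  proof (rule DERIV_nonpos_imp_nonincreasing[OF assms(2)])
    fix b assume "x \<le> b" "b \<le> y"
    then have b: "0 < b" "b < pi/2" using assms by auto
    define s c where "s = sin b" and "c = cos b"
    have sc: "s\<^sup>2 + c\<^sup>2 = 1" by (simp add: s_def c_def)
    have p: "0 < s" "0 < c" "0 < s - b * c" "0 < s * c + b"
      using pos[OF b] by (auto simp: s_def c_def)
    have "((\<lambda>b. ln (sin b - b * cos b)) has_real_derivative (c - (c - b * s)) / (s - b * c)) (at b)"
      using p by (auto intro!: derivative_eq_intros simp: s_def c_def)
    moreover have "((\<lambda>b. 2 * ln (sin b)) has_real_derivative 2 * (c / s)) (at b)"
      using p by (auto intro!: derivative_eq_intros simp: s_def c_def)
    moreover have "((\<lambda>b. 2 * ln (cos b)) has_real_derivative 2 * (- s / c)) (at b)"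
      using p by (auto intro!: derivative_eq_intros simp: s_def c_def)
    moreover have "((\<lambda>b. ln (sin b * cos b + b)) has_real_derivative
        (c * c - s * s + 1) / (s * c + b)) (at b)"
      using p by (auto intro!: derivative_eq_intros simp: s_def c_def)
    ultimately have "(?L has_real_derivative (c - (c - b * s)) / (s - b * c) - 2 * (c / s)
        + 2 * (- s / c) - (c * c - s * s + 1) / (s * c + b)) (at b)"
      by (intro DERIV_diff DERIV_add)
    also have "(c - (c - b * s)) / (s - b * c) - 2 * (c / s) + 2 * (- s / c)
        - (c * c - s * s + 1) / (s * c + b)
        = b * s / (s - b * c) - (2 / (s * c) + 2 * c\<^sup>2 / (s * c + b))"
    proof -
      have "2 * (c / s) + 2 * (s / c) = 2 * (s\<^sup>2 + c\<^sup>2) / (s * c)"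
        using p by (simp add: field_simps power2_eq_square)
      moreover have "c * c - s * s + 1 = 2 * c\<^sup>2" using sc by (simp add: power2_eq_square)
      ultimately show ?thesis by (simp add: sc)
    qed
    finally have D: "(?L has_real_derivative
        b * s / (s - b * c) - (2 / (s * c) + 2 * c\<^sup>2 / (s * c + b))) (at b)" .
    have "b * s / (s - b * c) \<le> 3 / b"
      using square_mult_sin_le[of b] b p by (simp add: field_simps power2_eq_square s_def c_def)
    moreover have "3 / b \<le> 2 / (s * c) + 2 * c\<^sup>2 / (s * c + b)"
    proof -
      \<comment> \<open>With \<open>sin (2 * b) = 2 * s * c\<close> and
        \<open>cos (2 * b) = 2 * c\<^sup>2 - 1\<close> a common factor 4 cancels, and what remains
        is the claim with its denominators cleared.\<close>
      have "3 * (sin (2 * b))\<^sup>2 \<le> 2 * (2 * b)\<^sup>2 + 2 * b * sin (2 * b) * cos (2 * b)"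
        using b by (intro three_sin_square_le) auto
      then have "3 * (s * c)\<^sup>2 \<le> 2 * b\<^sup>2 + b * (s * c) * (2 * c\<^sup>2 - 1)"
        unfolding sin_double cos_double_cos s_def[symmetric] c_def[symmetric]
        by (simp add: power_mult_distrib algebra_simps)
      then have "3 * (s * c) * (s * c + b) \<le> b * (2 * (s * c + b) + 2 * c\<^sup>2 * (s * c))"
        by (simp add: algebra_simps power2_eq_square)
      then show ?thesis using p b
        by (simp add: divide_simps) (simp add: algebra_simps)
    qed
    ultimately show "\<exists>z. (?L has_real_derivative z) (at b) \<and> z \<le> 0" using D by force
  qed
  then show ?thesis using L[of x] L[of y] assms by auto
qed

section \<open>Limits of \<open>phi\<close> at 0 and at infinity\<close>

lemma tendsto_div_sin_0: "((\<lambda>b::real. b / sin b) \<longlongrightarrow> 1) (at 0)"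
  by real_asymp

lemma beta_of_tendsto_0: "(beta_of \<longlongrightarrow> 0) (at_right 0)"
proof (rule order_tendstoI)
  fix a :: real assume "a < 0"
  then show "\<forall>\<^sub>F x in at_right 0. a < beta_of x"
    using eventually_at_right_less[of "0::real"] beta_of(1)
    by (auto elim!: eventually_mono intro: less_trans)
next
  fix a :: real assume a: "0 < a"
  let ?a = "min a 1"
  have "?a < pi/2" "0 < ?a" using a pi_gt3 by auto
  then have *: "beta_of (?a * tan ?a) = ?a" "?a * tan ?a > 0"
    using beta_of_unique[of ?a] tan_gt_zero[of ?a] by (auto intro!: mult_pos_pos)
  then have "\<forall>\<^sub>F x in at_right 0. x \<in> {0<..<?a * tan ?a}"
    by (intro eventually_at_right_real)
  then show "\<forall>\<^sub>F x in at_right 0. beta_of x < a"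
    using beta_of_strict_mono[of _ "?a * tan ?a"] * by (auto elim!: eventually_mono)
qed

lemma ratio_tendsto_1: "((\<lambda>h. beta_of h / sin (beta_of h)) \<longlongrightarrow> 1) (at_right 0)"
proof -
  have "filterlim beta_of (at 0) (at_right 0)"
    unfolding filterlim_at
  proof (intro conjI beta_of_tendsto_0 eventually_mono[OF eventually_at_right_less[of "0::real"]])
    fix x :: real assume "0 < x"
    then show "beta_of x \<in> UNIV" "beta_of x \<noteq> 0" using beta_of(1)[of x] by auto
  qed
  then show ?thesis using filterlim_compose[OF tendsto_div_sin_0] by blast
qed

lemma phi_0: "phi 0 = 1"
  using tendsto_Lim[OF trivial_limit_at_right_real ratio_tendsto_1] by (simp add: phi_def)

lemma phi_tendsto_0: "(phi \<longlongrightarrow> phi 0) (at_right 0)"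
  unfolding phi_0
  by (rule Lim_transform_eventually[OF ratio_tendsto_1],
      rule eventually_mono[OF eventually_at_right_less[of "0::real"]]) (simp add: phi_def)

lemma beta_of_tendsto_top: "(beta_of \<longlongrightarrow> pi/2) at_top"
proof (rule order_tendstoI)
  fix a :: real assume a: "a < pi/2"
  let ?a = "max a 1"
  have "?a < pi/2" "0 < ?a" using a pi_gt3 by auto
  then have *: "beta_of (?a * tan ?a) = ?a" "?a * tan ?a > 0"
    using beta_of_unique[of ?a] tan_gt_zero[of ?a] by (auto intro!: mult_pos_pos)
  show "\<forall>\<^sub>F x in at_top. a < beta_of x"
    by (rule eventually_mono[OF eventually_gt_at_top[of "?a * tan ?a"]])
      (use beta_of_strict_mono[of "?a * tan ?a"] * in \<open>metis max_less_iff_conj\<close>)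
next
  fix a :: real assume "pi/2 < a"
  then show "\<forall>\<^sub>F x in at_top. beta_of x < a"
    by (intro eventually_mono[OF eventually_gt_at_top[of "0::real"]] less_trans[OF beta_of(2)])
qed

lemma phi_tendsto_top: "(phi \<longlongrightarrow> pi/2) at_top"
proof -
  have "((\<lambda>h. beta_of h / sin (beta_of h)) \<longlongrightarrow> pi/2 / sin (pi/2)) at_top"
    by (intro tendsto_intros beta_of_tendsto_top) simp
  moreover have "\<forall>\<^sub>F h in at_top. beta_of h / sin (beta_of h) = phi h"
    by (rule eventually_mono[OF eventually_gt_at_top[of "0::real"]]) (simp add: phi_def)
  ultimately show ?thesis using Lim_transform_eventually by fastforce
qed

lemma continuous_on_phi: "continuous_on {0..} phi"
proof -
  have "isCont phi x" if "x > 0" for x using DERIV_phi[OF that] DERIV_isCont by blast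
  then show ?thesis using phi_tendsto_0 unfolding continuous_on_def
    by (metis (no_types, opaque_lifting) at_within_Ici_at_right atLeast_iff continuous_within_subset
        continuous_within isCont_def less_eq_real_def top_greatest tendsto_within_subset)
qed

text \<open>Derivatives are available at positive arguments, but continuity at 0 is enough for the
  mean value theorem; this brings the end point 0 into monotonicity and concavity.\<close>

lemma phi_mean_value:
  assumes "0 \<le> x" "x < y"
  obtains z where "x < z" "z < y" "phi y - phi x = (y - x) * phi_slope (beta_of z)"
proof -
  have "\<exists>l z. x < z \<and> z < y \<and> DERIV phi z :> l \<and> phi y - phi x = (y - x) * l"
  proof (rule MVT[OF assms(2)])
    show "continuous_on {x..y} phi"
      using assms by (auto intro: continuous_on_subset[OF continuous_on_phi])
    show "phi differentiable at u" if "x < u" "u < y" for u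
      using DERIV_phi[of u] assms that by (auto simp: real_differentiable_def)
  qed
  then show ?thesis using that DERIV_unique[OF DERIV_phi] assms
    by (metis le_less_trans)
qed

lemma strict_mono_on_phi: "strict_mono_on {0..} phi"
proof (rule strict_mono_onI)
  fix x y :: real assume xy: "x \<in> {0..}" "y \<in> {0..}" "x < y"
  then obtain z where "x < z" "phi y - phi x = (y - x) * phi_slope (beta_of z)"
    by (auto elim: phi_mean_value)
  moreover have "phi_slope (beta_of z) > 0"
    using beta_of[of z] phi_slope_pos calculation xy by auto
  ultimately show "phi x < phi y" using xy by (smt (verit) mult_pos_pos)
qed

text \<open>The chord slopes on the two sides of an intermediate point \<open>z\<close> are values
  of \<open>phi_slope\<close> at \<open>beta_of p\<close> and \<open>beta_of q\<close> with
  \<open>p < z < q\<close>, and \<open>phi_slope\<close> decreases. No second derivative of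
  \<open>phi\<close> is formed.\<close>

lemma concave_on_phi: "concave_on {0..} phi"
  unfolding concave_on_def
proof (rule convex_on_linorderI)
  fix t x y :: real
  assume t: "t > 0" "t < 1" and xy: "x \<in> {0..}" "y \<in> {0..}" "x < y"
  define z where "z = (1 - t) * x + t * y"
  have zx: "z - x = t * (y - x)" and yz: "y - z = (1 - t) * (y - x)"
    by (auto simp: z_def algebra_simps)
  then have "z - x > 0" "y - z > 0" using t xy by auto
  then have xzy: "x < z" "z < y" by auto
  from xzy xy obtain p where p: "x < p" "p < z" "phi z - phi x = (z - x) * phi_slope (beta_of p)"
    by (auto elim: phi_mean_value)
  have "0 \<le> z" using xzy xy by auto
  then obtain q where q: "z < q" "q < y" "phi y - phi z = (y - z) * phi_slope (beta_of q)"
    using xzy by (auto elim: phi_mean_value)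
  have "beta_of p < beta_of q" using beta_of_strict_mono[of p q] p q xy by auto
  then have "phi_slope (beta_of q) \<le> phi_slope (beta_of p)"
    using beta_of[of p] beta_of[of q] p q xy by (intro phi_slope_antimono) auto
  then have "t * (1 - t) * (y - x) * phi_slope (beta_of q) \<le> t * (1 - t) * (y - x) * phi_slope (beta_of p)"
    using t xy by (intro mult_left_mono) auto
  then have "t * (phi y - phi z) \<le> (1 - t) * (phi z - phi x)"
    unfolding p q zx yz by (simp add: algebra_simps)
  then show "- phi ((1 - t) *\<^sub>R x + t *\<^sub>R y) \<le> (1 - t) * - phi x + t * - phi y"
    unfolding real_scaleR_def z_def[symmetric] by (simp add: algebra_simps)
qed simp

lemma stability_condition_iff:
  assumes "N \<ge> 2"
  shows "stability_condition N \<eta> lam \<longleftrightarrow> (\<forall>j\<in>{2..N}. (\<eta>, lam j) \<in> stability_region)"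
proof
  assume "stability_condition N \<eta> lam"
  then obtain b where b: "0 < b" "b < pi/2" "\<eta> = b * tan b" "\<forall>j\<in>{2..N}. lam j \<in> {0<..<b / sin b}"
    unfolding stability_condition_def by auto
  have "\<eta> > 0" using b by (auto intro!: mult_pos_pos tan_gt_zero)
  moreover have "phi \<eta> = b / sin b" using calculation beta_of_unique[of b] b by (auto simp: phi_def)
  ultimately show "\<forall>j\<in>{2..N}. (\<eta>, lam j) \<in> stability_region"
    using b by (auto simp: stability_region_def)
next
  assume *: "\<forall>j\<in>{2..N}. (\<eta>, lam j) \<in> stability_region"
  \<comment> \<open>The index 2 exists because \<open>N \<ge> 2\<close>; over an empty index set the
    right-hand side would say nothing about \<open>\<eta>\<close>.\<close>
  then have "(\<eta>, lam 2) \<in> stability_region" using assms by auto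
  then have "\<eta> > 0" by (simp add: stability_region_def)
  then show "stability_condition N \<eta> lam"
    using * beta_of[of \<eta>] unfolding stability_condition_def
    by (intro bexI[of _ "beta_of \<eta>"]) (auto simp: stability_region_def phi_def)
qed

lemma phi_pos: "\<eta> > 0 \<Longrightarrow> phi \<eta> > 0"
  using beta_of[of \<eta>] by (auto simp: phi_def intro!: divide_pos_pos sin_gt_zero)

text \<open>Over a fixed \<open>\<eta> > 0\<close> the region has an open interval as its fibre, and
  the closed interval belongs to the closure. The alternative \<open>\<eta> \<le> 0\<close> is left
  coarse, because instability holds there for every \<open>l\<close>.\<close>

lemma not_in_closure_stability_region:
  assumes "(\<eta>, l) \<notin> closure stability_region"
  shows "\<eta> \<le> 0 \<or> l < 0 \<or> l > phi \<eta>"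
proof (rule ccontr)
  assume "\<not> ?thesis"
  then have *: "\<eta> > 0" "0 \<le> l" "l \<le> phi \<eta>" by auto
  have "{\<eta>} \<times> {0<..<phi \<eta>} \<subseteq> stability_region" using * by (auto simp: stability_region_def)
  then have "closure ({\<eta>} \<times> {0<..<phi \<eta>}) \<subseteq> closure stability_region" by (rule closure_mono)
  then have "{\<eta>} \<times> {0..phi \<eta>} \<subseteq> closure stability_region"
    using phi_pos[of \<eta>] * by (simp add: closure_Times)
  moreover have "(\<eta>, l) \<in> {\<eta>} \<times> {0..phi \<eta>}" using * by auto
  ultimately show False using assms by blast
qed

section \<open>The characteristic function\<close>

definition char_fun :: "real \<Rightarrow> real \<Rightarrow> complex \<Rightarrow> complex" where
  "char_fun \<eta> c z = z\<^sup>2 + of_real \<eta> * z + of_real c * exp (- z)"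

lemma char_fun_cnj: "char_fun \<eta> c (cnj z) = cnj (char_fun \<eta> c z)"
  by (simp add: char_fun_def exp_cnj)

lemma char_fun_eq_0_iff:
  "char_fun \<eta> c (Complex a b) = 0 \<longleftrightarrow>
     a\<^sup>2 - b\<^sup>2 + \<eta> * a + c * exp (- a) * cos b = 0 \<and> (2 * a + \<eta>) * b = c * exp (- a) * sin b"
  by (auto simp: char_fun_def complex_eq_iff Re_exp Im_exp power2_eq_square algebra_simps)

text \<open>Conjugation reduces the claim to \<open>Im z \<ge> 0\<close>. At the critical gain
  \<open>\<eta> * (\<beta> / sin \<beta>)\<close> there is a root at \<open>i \<beta>\<close>, which
  is why the two comparisons meet at height \<open>\<beta>\<close>.\<close>

lemma char_fun_no_root:
  assumes b: "0 < \<beta>" "\<beta> < pi/2" and \<eta>: "\<eta> = \<beta> * tan \<beta>"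
    and c: "0 < c" "c < \<eta> * (\<beta> / sin \<beta>)" and z: "Re z \<ge> 0"
  shows "char_fun \<eta> c z \<noteq> 0"
proof -
  have pos: "0 < sin \<beta>" "0 < cos \<beta>" "0 < tan \<beta>" using b by (auto intro: sin_gt_zero cos_gt_zero tan_gt_zero)
  then have \<eta>0: "\<eta> > 0" using b \<eta> by simp
  \<comment> \<open>\<open>\<beta>\<^sup>2 / cos \<beta>\<close> is the modulus of
    \<open>z\<^sup>2 + \<eta> z\<close> at \<open>z = i \<beta>\<close>, written without a square
    root.\<close>
  have cb: "c < \<beta>\<^sup>2 / cos \<beta>"
    using c(2) pos by (simp add: \<eta> tan_def power2_eq_square)
  have main: False if root: "char_fun \<eta> c (Complex a y) = 0" and a: "a \<ge> 0" and y: "y \<ge> 0" for a y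
  proof -
    define E where "E = c * exp (- a)"
    have E: "0 < E" "E \<le> c" using c a by (auto simp: E_def mult_le_cancel_left1)
    have r: "E * cos y = y\<^sup>2 - a\<^sup>2 - \<eta> * a" and i: "E * sin y = (2 * a + \<eta>) * y"
      using root by (auto simp: char_fun_eq_0_iff E_def algebra_simps)
    consider "y = 0" | "0 < y" "y < \<beta>" | "\<beta> \<le> y" using y by linarith
    then show False
    proof cases
      case 1
      then have "E + a\<^sup>2 + \<eta> * a = 0" using r by simp
      moreover have "0 \<le> \<eta> * a" "0 \<le> a\<^sup>2" using a \<eta>0 by auto
      ultimately show False using E by linarith
    next
      case 2
      then have p: "0 < sin y" "0 < cos y" using b by (auto intro: sin_gt_zero cos_gt_zero)
      \<comment> \<open>Eliminates \<open>E\<close>: both sides are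
        \<open>E * sin y * cos y\<close>. This is the comparison of the arguments of
        \<open>z\<^sup>2 + \<eta> z\<close> and \<open>- c exp (- z)\<close>.\<close>
      have "(2 * a + \<eta>) * y * cos y = (y\<^sup>2 - a\<^sup>2 - \<eta> * a) * sin y"
        unfolding r[symmetric] i[symmetric] by simp
      also have "\<dots> \<le> y\<^sup>2 * sin y"
      proof (rule mult_right_mono)
        have "0 \<le> a\<^sup>2" "0 \<le> \<eta> * a" using a \<eta>0 by auto
        then show "y\<^sup>2 - a\<^sup>2 - \<eta> * a \<le> y\<^sup>2" by linarith
      qed (use p in simp)
      finally have "y * ((2 * a + \<eta>) * cos y) \<le> y * (y * sin y)"
        by (simp add: algebra_simps power2_eq_square)
      then have "(2 * a + \<eta>) * cos y \<le> y * sin y" using 2 by simp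
      moreover have "\<eta> * cos y \<le> (2 * a + \<eta>) * cos y" using p a by (intro mult_right_mono) auto
      ultimately have "\<eta> \<le> y * tan y" using p by (simp add: tan_def field_simps)
      then show False using mult_tan_strict_mono[of y \<beta>] 2 b \<eta> by simp
    next
      case 3
      have "(\<beta>\<^sup>2 / cos \<beta>)\<^sup>2 = \<beta>\<^sup>2 * (\<eta>\<^sup>2 + \<beta>\<^sup>2)"
      proof -
        have "\<eta>\<^sup>2 + \<beta>\<^sup>2 = \<beta>\<^sup>2 * ((sin \<beta>)\<^sup>2 + (cos \<beta>)\<^sup>2) / (cos \<beta>)\<^sup>2"
          using pos unfolding \<eta> tan_def power_mult_distrib power_divide distrib_left add_divide_distrib
          by simp
        also have "\<beta>\<^sup>2 * ((sin \<beta>)\<^sup>2 + (cos \<beta>)\<^sup>2) / (cos \<beta>)\<^sup>2 = \<beta>\<^sup>2 / (cos \<beta>)\<^sup>2" by simp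
        finally have "\<eta>\<^sup>2 + \<beta>\<^sup>2 = \<beta>\<^sup>2 / (cos \<beta>)\<^sup>2" .
        then show ?thesis unfolding power_divide by (simp add: power2_eq_square)
      qed
      \<comment> \<open>The right-hand side is the square of the modulus of
        \<open>z (z + \<eta>)\<close>, which only grows with \<open>a\<close> and \<open>y\<close>
        from its value at \<open>i \<beta>\<close>.\<close>
      also have "\<dots> \<le> (a\<^sup>2 + y\<^sup>2) * ((a + \<eta>)\<^sup>2 + y\<^sup>2)"
      proof (rule mult_mono)
        have "\<beta>\<^sup>2 \<le> y\<^sup>2" "\<eta>\<^sup>2 \<le> (a + \<eta>)\<^sup>2" using 3 b a \<eta>0 by (auto intro: power_mono)
        then show "\<beta>\<^sup>2 \<le> a\<^sup>2 + y\<^sup>2" "\<eta>\<^sup>2 + \<beta>\<^sup>2 \<le> (a + \<eta>)\<^sup>2 + y\<^sup>2"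
          using zero_le_power2[of a] by linarith+
      qed auto
      finally have 1: "(\<beta>\<^sup>2 / cos \<beta>)\<^sup>2 \<le> (a\<^sup>2 + y\<^sup>2) * ((a + \<eta>)\<^sup>2 + y\<^sup>2)" .
      have "(a\<^sup>2 + y\<^sup>2) * ((a + \<eta>)\<^sup>2 + y\<^sup>2) = (E * cos y)\<^sup>2 + (E * sin y)\<^sup>2"
        unfolding r i by (simp add: power2_eq_square algebra_simps)
      also have "\<dots> = E\<^sup>2"
        unfolding power_mult_distrib distrib_left[symmetric] by simp
      finally have "(\<beta>\<^sup>2 / cos \<beta>)\<^sup>2 \<le> E\<^sup>2" using 1 by simp
      then have "\<beta>\<^sup>2 / cos \<beta> \<le> E" by (rule power2_le_imp_le) (use E in simp)
      then show False using cb E by simp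
    qed
  qed
  show ?thesis
  proof
    assume *: "char_fun \<eta> c z = 0"
    show False
    proof (cases "Im z \<ge> 0")
      case True then show ?thesis using main[of "Re z" "Im z"] * z by simp
    next
      case False
      then show ?thesis using main[of "Re z" "- Im z"] char_fun_cnj[of \<eta> c z] * z
        by (simp add: complex_eq_iff cnj.code)
    qed
  qed
qed

text \<open>On \<open>Re z \<ge> -1\<close> the exponential term is at most
  \<open>c * exp 1\<close>. The choice of \<open>R\<close> leaves at most half of the quadratic term
  to the linear one and a quarter to the exponential one.\<close>

lemma norm_char_fun_ge:
  assumes "Re z \<ge> -1" "c \<ge> 0" and R: "R \<ge> 1 + 2 * \<bar>\<eta>\<bar> + 4 * c * exp 1" "cmod z \<ge> R"
  shows "cmod (char_fun \<eta> c z) \<ge> (cmod z)\<^sup>2 / 4"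
proof -
  let ?r = "cmod z"
  have c0: "0 \<le> c * exp 1" using assms by simp
  then have r: "?r \<ge> 1" "?r \<ge> 2 * \<bar>\<eta>\<bar>" "?r \<ge> 4 * c * exp 1" using R by auto
  have "cmod (of_real c * exp (- z)) \<le> c * exp 1"
    using assms by (simp add: norm_mult mult_left_mono)
  moreover have "cmod (of_real \<eta> * z) \<le> ?r / 2 * ?r"
    unfolding norm_mult using r by (intro mult_right_mono) auto
  moreover have "cmod (z\<^sup>2) = ?r * ?r" by (simp add: norm_mult power2_eq_square)
  moreover have "4 * c * exp 1 \<le> ?r * ?r"
    using r mult_mono[of 1 ?r "4 * c * exp 1" ?r] c0 by simp
  moreover have "cmod (char_fun \<eta> c z) \<ge> cmod (z\<^sup>2) - cmod (of_real \<eta> * z) - cmod (of_real c * exp (- z))"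
    unfolding char_fun_def
    by (smt (verit) norm_diff_ineq)
  ultimately show ?thesis by (simp add: power2_eq_square)
qed

lemma continuous_on_char_fun: "continuous_on S (char_fun \<eta> c)"
  unfolding char_fun_def by (intro continuous_intros)

text \<open>Besides a strip free of roots this gives a lower bound quadratic in
  \<open>cmod z\<close>, which makes \<open>1 / char_fun\<close> absolutely integrable on vertical
  lines in the strip. Inside a disc the bound comes from compactness, outside from
  \<open>norm_char_fun_ge\<close>.\<close>

lemma char_fun_margin:
  assumes "c \<ge> 0" and nr: "\<And>z. Re z \<ge> 0 \<Longrightarrow> char_fun \<eta> c z \<noteq> 0"
  obtains \<epsilon> B where "\<epsilon> > 0" "B > 0"
    "\<And>z. Re z \<ge> - \<epsilon> \<Longrightarrow> cmod (char_fun \<eta> c z) \<ge> B * (1 + (cmod z)\<^sup>2)"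
proof -
  define R where "R = 1 + 2 * \<bar>\<eta>\<bar> + 4 * c * exp 1"
  have R1: "R \<ge> 1" using assms by (simp add: R_def)
  let ?A = "{z. Re z \<ge> -1 \<and> char_fun \<eta> c z = 0} \<inter> cball 0 R"
  have cl: "closed {z. Re z \<ge> r}" for r by (rule closed_halfspace_Re_ge)
  have "closed {z. Re z \<ge> -1 \<and> char_fun \<eta> c z = 0}"
    by (intro closed_Collect_conj cl closed_Collect_eq continuous_on_char_fun continuous_intros)
  then have A: "compact ?A" by (intro closed_Int_compact) auto
  obtain \<epsilon> where \<epsilon>: "\<epsilon> > 0" "\<epsilon> \<le> 1" "\<And>z. z \<in> ?A \<Longrightarrow> Re z < - \<epsilon>"
  proof (cases "?A = {}")
    case True then show ?thesis using that[of 1] by auto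
  next
    case False
    obtain w where w: "w \<in> ?A" "\<And>z. z \<in> ?A \<Longrightarrow> Re z \<le> Re w"
      using continuous_attains_sup[OF A False continuous_on_Re[OF continuous_on_id]] by blast
    have "\<not> Re w \<ge> 0" "Re w \<ge> -1" using nr[of w] w(1) by auto
    \<comment> \<open>\<open>w\<close> is a root of largest real part among the compact set
      \<open>?A\<close>; half its distance to the imaginary axis keeps all of them strictly to the
      left of \<open>- \<epsilon>\<close>.\<close>
    then have h: "- Re w / 2 > 0" "- Re w / 2 \<le> 1" "Re w < - (- Re w / 2)" by auto
    show ?thesis
    proof (rule that[of "- Re w / 2", OF h(1,2)])
      fix z assume "z \<in> ?A"
      then show "Re z < - (- Re w / 2)" using w(2)[of z] h(3) by linarith
    qed
  qed
  have nz: "char_fun \<eta> c z \<noteq> 0" if "Re z \<ge> - \<epsilon>" "cmod z \<le> R" for z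
    using \<epsilon>(2) \<epsilon>(3)[of z] that by auto
  let ?S = "{z. Re z \<ge> - \<epsilon>} \<inter> cball 0 R"
  have "compact ?S" by (intro closed_Int_compact cl) auto
  moreover have "0 \<in> ?S" using R1 \<epsilon> by simp
  moreover from this have "?S \<noteq> {}" by blast
  ultimately obtain w where w: "w \<in> ?S" "\<And>z. z \<in> ?S \<Longrightarrow> cmod (char_fun \<eta> c w) \<le> cmod (char_fun \<eta> c z)"
    using continuous_attains_inf[OF _ _ continuous_on_norm[OF continuous_on_char_fun], of ?S \<eta> c] by blast
  define m where "m = cmod (char_fun \<eta> c w)"
  have m: "m > 0" using nz[of w] w by (auto simp: m_def)
  show ?thesis
  proof (rule that[OF \<epsilon>(1)])
    \<comment> \<open>\<open>1/8\<close> because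
      \<open>r\<^sup>2 / 4 \<ge> (1 + r\<^sup>2) / 8\<close> once \<open>r \<ge> 1\<close>;
      \<open>m / (1 + R\<^sup>2)\<close> because \<open>m\<close> is the minimum over the part of
      the disc with \<open>Re z \<ge> - \<epsilon>\<close>.\<close>
    show "min (1/8) (m / (1 + R\<^sup>2)) > 0" using m by (auto intro!: divide_pos_pos add_pos_nonneg)
    fix z assume z: "Re z \<ge> - \<epsilon>"
    show "cmod (char_fun \<eta> c z) \<ge> min (1/8) (m / (1 + R\<^sup>2)) * (1 + (cmod z)\<^sup>2)"
    proof (cases "cmod z \<le> R")
      case True
      have "min (1/8) (m / (1 + R\<^sup>2)) * (1 + (cmod z)\<^sup>2) \<le> m / (1 + R\<^sup>2) * (1 + R\<^sup>2)"
        using m True R1 by (intro mult_mono add_left_mono power_mono) auto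
      also have "\<dots> = m" using R1 by (simp add: add_nonneg_eq_0_iff)
      finally show ?thesis using w(2)[of z] z True by (simp add: m_def)
    next
      case False
      then have "1 \<le> (cmod z)\<^sup>2" using R1 by (simp add: one_le_power)
      have "min (1/8) (m / (1 + R\<^sup>2)) * (1 + (cmod z)\<^sup>2) \<le> 1/8 * (2 * (cmod z)\<^sup>2)"
      proof (rule mult_mono)
        show "1 + (cmod z)\<^sup>2 \<le> 2 * (cmod z)\<^sup>2" using \<open>1 \<le> (cmod z)\<^sup>2\<close> by simp
        show "min (1/8) (m / (1 + R\<^sup>2)) \<le> 1/8" by (rule min.cobounded1)
      qed auto
      also have "\<dots> \<le> cmod (char_fun \<eta> c z)"
        using norm_char_fun_ge[of z c \<eta> R] z \<epsilon> False assms by (auto simp: R_def)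
      finally show ?thesis .
    qed
  qed
qed

text \<open>For a root \<open>z = (s - \<eta>/2) + i b\<close> with \<open>0 < b < pi\<close> the ratio of the real and the imaginary
  equation is a quadratic equation for \<open>s\<close> free of \<open>c\<close>; \<open>root_re\<close> is its positive solution, and
  \<open>root_gain\<close> the value of \<open>c\<close> for which \<open>z\<close> is then a root.\<close>

definition root_re :: "real \<Rightarrow> real \<Rightarrow> real" where
  "root_re \<eta> b = - (b * cos b / sin b) + sqrt ((b / sin b)\<^sup>2 + \<eta>\<^sup>2 / 4)"

definition root_gain :: "real \<Rightarrow> real \<Rightarrow> real" where
  "root_gain \<eta> b = 2 * root_re \<eta> b * exp (root_re \<eta> b - \<eta> / 2) * (b / sin b)"

lemma root_re_pos:
  assumes "0 < b" "b < pi" shows "root_re \<eta> b > 0"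
proof -
  have s: "0 < sin b" using assms by (auto intro: sin_gt_zero)
  have "(b * cos b / sin b)\<^sup>2 < (b / sin b)\<^sup>2"
  proof -
    have "(cos b)\<^sup>2 < 1" using s sin_cos_squared_add[of b] by (smt (verit) zero_less_power)
    then have "(b / sin b)\<^sup>2 * (cos b)\<^sup>2 < (b / sin b)\<^sup>2 * 1"
      using s assms by (intro mult_strict_left_mono) auto
    then show ?thesis by (simp add: power_mult_distrib power_divide mult.commute)
  qed
  then have "(b * cos b / sin b)\<^sup>2 < (b / sin b)\<^sup>2 + \<eta>\<^sup>2 / 4" by (smt (verit) zero_le_power2 divide_nonneg_pos)
  then have "b * cos b / sin b < sqrt ((b / sin b)\<^sup>2 + \<eta>\<^sup>2 / 4)" by (rule real_less_rsqrt)
  then show ?thesis by (simp add: root_re_def)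
qed

lemma char_fun_root_gain:
  assumes "0 < b" "b < pi"
  shows "char_fun \<eta> (root_gain \<eta> b) (Complex (root_re \<eta> b - \<eta> / 2) b) = 0"
proof -
  define s where "s = root_re \<eta> b"
  have sb: "0 < sin b" using assms by (auto intro: sin_gt_zero)
  have "(s + b * cos b / sin b)\<^sup>2 = (b / sin b)\<^sup>2 + \<eta>\<^sup>2 / 4"
    unfolding s_def root_re_def by (simp add: add_nonneg_nonneg)
  moreover have "(b / sin b)\<^sup>2 = b\<^sup>2 + (b * cos b / sin b)\<^sup>2"
  proof -
    have "(b / sin b)\<^sup>2 * ((sin b)\<^sup>2 + (cos b)\<^sup>2) = b\<^sup>2 + (b * cos b / sin b)\<^sup>2"
      unfolding distrib_left using sb by (simp add: power_mult_distrib power_divide)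
    then show ?thesis by simp
  qed
  \<comment> \<open>The quadratic equation for \<open>s\<close>. Measuring the real part from the
    centre \<open>- \<eta> / 2\<close> removes every odd power of \<open>\<eta>\<close>.\<close>
  ultimately have q: "s\<^sup>2 + 2 * s * (b * cos b / sin b) = b\<^sup>2 + \<eta>\<^sup>2 / 4"
    by (simp add: power2_sum)
  have e: "root_gain \<eta> b * exp (- (s - \<eta> / 2)) = 2 * s * (b / sin b)"
    by (simp add: root_gain_def s_def[symmetric] exp_minus field_simps)
  show ?thesis
    unfolding s_def[symmetric] char_fun_eq_0_iff e
  proof
    show "(s - \<eta> / 2)\<^sup>2 - b\<^sup>2 + \<eta> * (s - \<eta> / 2) + 2 * s * (b / sin b) * cos b = 0"
    proof -
      have "(s - \<eta> / 2)\<^sup>2 - b\<^sup>2 + \<eta> * (s - \<eta> / 2) = s\<^sup>2 - \<eta>\<^sup>2 / 4 - b\<^sup>2"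
        by (simp add: power2_eq_square field_simps)
      moreover have "2 * s * (b / sin b) * cos b = 2 * s * (b * cos b / sin b)" by simp
      ultimately show ?thesis using q by linarith
    qed
    show "(2 * (s - \<eta> / 2) + \<eta>) * b = 2 * s * (b / sin b) * sin b" using sb by simp
  qed
qed

lemma continuous_on_root_gain:
  "S \<subseteq> {0<..<pi} \<Longrightarrow> continuous_on S (root_gain \<eta>)"
  unfolding root_gain_def root_re_def
  by (intro continuous_intros) (use sin_gt_zero in \<open>force dest!: subsetD\<close>)+

text \<open>As \<open>b\<close> approaches \<open>pi\<close> the factor \<open>b / sin b\<close>
  blows up, while \<open>root_re \<eta> b\<close> stays at least 1 because \<open>cos b\<close> is
  negative.\<close>

lemma root_gain_large:
  assumes "b0 < pi" obtains b where "b0 < b" "pi/2 < b" "b < pi" "root_gain \<eta> b \<ge> c"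
proof -
  \<comment> \<open>\<open>k\<close> bounds
    \<open>2 * root_re \<eta> b * exp (root_re \<eta> b - \<eta> / 2)\<close> from below once
    \<open>root_re \<eta> b \<ge> 1\<close>. The three entries of the minimum \<open>d\<close> give
    \<open>b > pi/2\<close>, \<open>b > b0\<close> and \<open>k / d \<ge> c\<close> in turn.\<close>
  define k where "k = 2 * exp (- (\<eta> / 2))"
  define d where "d = min (min 1 ((pi - b0) / 2)) (k / (\<bar>c\<bar> + 1))"
  have k: "k > 0" by (simp add: k_def)
  have d: "0 < d" "d \<le> 1" "d < pi - b0" "d \<le> k / (\<bar>c\<bar> + 1)"
    using assms k unfolding d_def by (auto intro!: divide_pos_pos simp: min_less_iff_disj)
  define b where "b = pi - d"
  have b: "b0 < b" "pi/2 < b" "b < pi" using d pi_gt3 by (auto simp: b_def)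
  have sb: "0 < sin b" using b pi_gt_zero by (intro sin_gt_zero) auto
  have "sin b = sin d" by (simp add: b_def)
  also have "\<dots> \<le> d" using d by (intro sin_x_le_x) auto
  finally have sd: "sin b \<le> d" .
  have b1: "1 \<le> b / sin b" using b pi_gt3 sb by (simp add: order_trans[OF sin_le_one])
  have "cos b < 0" using b cos_monotone_0_pi[of "pi/2" b] by simp
  then have "0 \<le> - (b * cos b / sin b)" using b sb pi_gt_zero
    by (simp add: divide_nonpos_pos mult_nonneg_nonpos)
  moreover have "b / sin b \<le> sqrt ((b / sin b)\<^sup>2 + \<eta>\<^sup>2 / 4)" by (rule real_le_rsqrt) simp
  ultimately have r: "root_re \<eta> b \<ge> 1" using b1 by (simp add: root_re_def)
  have "c \<le> k / d"
  proof -
    have "(\<bar>c\<bar> + 1) * d \<le> k" using d by (simp add: field_simps)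
    then have "\<bar>c\<bar> + 1 \<le> k / d" using d by (simp add: field_simps)
    then show ?thesis by linarith
  qed
  also have "\<dots> \<le> k * (b / sin b)"
  proof -
    have "1 / d \<le> 1 / sin b" using sd sb by (simp add: frac_le)
    also have "\<dots> \<le> b / sin b" using b pi_gt3 sb by (intro divide_right_mono) auto
    finally have "k * (1 / d) \<le> k * (b / sin b)" using k by (intro mult_left_mono) auto
    then show ?thesis by simp
  qed
  also have "\<dots> \<le> root_gain \<eta> b"
    unfolding root_gain_def k_def using r b1
    by (intro mult_right_mono mult_mono) auto
  finally show ?thesis using that b by blast
qed

lemma ex_root_of_gain_le:
  assumes "0 < b0" "b0 < pi" "root_gain \<eta> b0 \<le> c"
  obtains b where "b0 \<le> b" "b < pi" "char_fun \<eta> c (Complex (root_re \<eta> b - \<eta> / 2) b) = 0"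
    "root_gain \<eta> b = c"
proof -
  obtain b1 where b1: "b0 < b1" "b1 < pi" "root_gain \<eta> b1 \<ge> c"
    using root_gain_large[OF assms(2)] by metis
  have "\<exists>b\<ge>b0. b \<le> b1 \<and> root_gain \<eta> b = c"
    using b1 assms by (intro IVT' continuous_on_root_gain) auto
  then show ?thesis using that char_fun_root_gain b1 assms
    by (metis less_le_trans le_less_trans)
qed

section \<open>Roots in the open right half-plane\<close>

lemma char_fun_of_real: "char_fun \<eta> c (of_real x) = of_real (x\<^sup>2 + \<eta> * x + c * exp (- x))"
  by (simp add: char_fun_def exp_of_real[symmetric])

lemma ex_real_root:
  assumes "0 < x0" "x0\<^sup>2 + \<eta> * x0 + c * exp (- x0) \<le> 0"
  obtains z where "Re z > 0" "char_fun \<eta> c z = 0"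
proof -
  let ?f = "\<lambda>x. x\<^sup>2 + \<eta> * x + c * exp (- x)"
  \<comment> \<open>Large enough for \<open>x1\<^sup>2\<close> to outweigh both other terms:
    \<open>x1 \<ge> 1\<close> and \<open>x1 \<ge> \<bar>\<eta>\<bar> + \<bar>c\<bar>\<close>, while
    the exponential is at most 1.\<close>
  define x1 where "x1 = x0 + 1 + \<bar>\<eta>\<bar> + \<bar>c\<bar>"
  have x1: "x0 \<le> x1" "1 \<le> x1" "\<bar>\<eta>\<bar> + \<bar>c\<bar> \<le> x1" using assms by (auto simp: x1_def)
  have "\<bar>c\<bar> * exp (- x1) \<le> \<bar>c\<bar> * 1" using x1 by (intro mult_left_mono) auto
  also have "\<dots> \<le> \<bar>c\<bar> * x1" using x1 by (intro mult_left_mono) auto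
  finally have "\<bar>c * exp (- x1)\<bar> \<le> \<bar>c\<bar> * x1" by (simp add: abs_mult)
  moreover have "\<bar>\<eta> * x1\<bar> \<le> \<bar>\<eta>\<bar> * x1" using x1 by (simp add: abs_mult)
  moreover have "(\<bar>\<eta>\<bar> + \<bar>c\<bar>) * x1 \<le> x1 * x1" using x1 by (intro mult_right_mono) auto
  ultimately have "0 \<le> ?f x1" by (simp add: power2_eq_square distrib_right abs_le_iff)
  then have "\<exists>x\<ge>x0. x \<le> x1 \<and> ?f x = 0"
    using assms x1 by (intro IVT') (auto intro!: continuous_intros)
  then obtain x where "x \<ge> x0" "?f x = 0" by blast
  then show ?thesis using that[of "of_real x"] assms by (simp add: char_fun_of_real)
qed

text \<open>The curve of roots meets the imaginary axis at \<open>b = \<beta>\<close>, with exactly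
  the critical gain. A larger gain is taken at some \<open>b > \<beta>\<close>, and there the real
  part is positive: by the identity \<open>sq\<close> this amounts to
  \<open>\<eta> * (b * cos b / sin b) < b\<^sup>2\<close>, which follows from the monotonicity of
  \<open>b * tan b\<close> below \<open>pi/2\<close> and from signs beyond.\<close>

lemma ex_unstable_root_large_gain:
  assumes b: "0 < \<beta>" "\<beta> < pi/2" and \<eta>: "\<eta> = \<beta> * tan \<beta>" and c: "\<eta> * (\<beta> / sin \<beta>) < c"
  obtains z where "Re z > 0" "char_fun \<eta> c z = 0"
proof -
  have pos: "0 < sin \<beta>" "0 < cos \<beta>" "0 < tan \<beta>" using b by (auto intro: sin_gt_zero cos_gt_zero tan_gt_zero)
  then have \<eta>0: "\<eta> > 0" using b \<eta> by simp
  have sq: "(\<eta> / 2 + b * cos b / sin b)\<^sup>2 - ((b / sin b)\<^sup>2 + \<eta>\<^sup>2 / 4) = \<eta> * (b * cos b / sin b) - b\<^sup>2"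
    if "0 < b" "b < pi" for b
  proof -
    have "0 < sin b" using that by (auto intro: sin_gt_zero)
    then have "(b / sin b)\<^sup>2 * ((sin b)\<^sup>2 + (cos b)\<^sup>2) = b\<^sup>2 + (b * cos b / sin b)\<^sup>2"
      unfolding distrib_left by (simp add: power_mult_distrib power_divide)
    then show ?thesis by (simp add: power2_sum) (simp add: power2_eq_square)
  qed
  have "\<eta> * (\<beta> * cos \<beta> / sin \<beta>) = \<beta>\<^sup>2" using pos by (simp add: \<eta> tan_def power2_eq_square)
  then have "(\<eta> / 2 + \<beta> * cos \<beta> / sin \<beta>)\<^sup>2 = (\<beta> / sin \<beta>)\<^sup>2 + \<eta>\<^sup>2 / 4"
    using sq[of \<beta>] b by simp
  then have "sqrt ((\<beta> / sin \<beta>)\<^sup>2 + \<eta>\<^sup>2 / 4) = \<eta> / 2 + \<beta> * cos \<beta> / sin \<beta>"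
    using pos b \<eta>0 by (intro real_sqrt_unique) auto
  then have re: "root_re \<eta> \<beta> = \<eta> / 2" by (simp add: root_re_def)
  have gain: "root_gain \<eta> \<beta> = \<eta> * (\<beta> / sin \<beta>)" unfolding root_gain_def re by simp
  then obtain b where *: "\<beta> \<le> b" "b < pi" "char_fun \<eta> c (Complex (root_re \<eta> b - \<eta> / 2) b) = 0"
      "root_gain \<eta> b = c"
    using ex_root_of_gain_le[of \<beta> \<eta> c] b c by auto
  then have "\<beta> < b" using c gain by (cases "\<beta> = b") auto
  have sb: "0 < sin b" using * b by (intro sin_gt_zero) auto
  have "\<eta> * cos b < b * sin b"
  proof (cases "b < pi/2")
    case True
    then have "0 < cos b" using \<open>\<beta> < b\<close> b by (intro cos_gt_zero) auto
    moreover have "\<eta> < b * tan b" using mult_tan_strict_mono[of \<beta> b] True \<open>\<beta> < b\<close> b \<eta> by simp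
    ultimately show ?thesis by (simp add: tan_def field_simps)
  next
    case False
    then have "cos b \<le> 0" using * cos_monotone_0_pi_le[of "pi/2" b] by simp
    then have "\<eta> * cos b \<le> 0" using \<eta>0 by (simp add: mult_nonneg_nonpos)
    moreover have "0 < b * sin b" using sb \<open>\<beta> < b\<close> b by simp
    ultimately show ?thesis by linarith
  qed
  then have "\<eta> * (b * cos b / sin b) < b\<^sup>2"
    using sb \<open>\<beta> < b\<close> b by (simp add: field_simps power2_eq_square)
  then have "(\<eta> / 2 + b * cos b / sin b)\<^sup>2 < (b / sin b)\<^sup>2 + \<eta>\<^sup>2 / 4"
    using sq[of b] * b by simp
  then have "\<eta> / 2 < root_re \<eta> b" using real_less_rsqrt by (fastforce simp: root_re_def)
  then show ?thesis using that[OF _ *(3)] by simp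
qed

text \<open>For \<open>\<eta> < 0\<close> every \<open>root_re \<eta> b - \<eta> / 2\<close> is
  positive, so any root on the curve will do; gains below the reach of the curve are served by a
  real root.\<close>

lemma ex_unstable_root_neg_damping:
  assumes "\<eta> < 0" obtains z where "Re z > 0" "char_fun \<eta> c z = 0"
proof -
  \<comment> \<open>\<open>s0\<close> and \<open>c0\<close> are the limits of
    \<open>root_re \<eta> b\<close> and \<open>root_gain \<eta> b\<close> as \<open>b\<close> tends
    to 0; at the gain \<open>c0\<close> the point \<open>s0 - \<eta> / 2\<close> is a double real
    root. The real axis covers \<open>c \<le> c0\<close>, the curve \<open>c > c0\<close>.\<close>
  define s0 where "s0 = sqrt (1 + \<eta>\<^sup>2 / 4) - 1"
  define c0 where "c0 = 2 * s0 * exp (s0 - \<eta> / 2)"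
  have s0: "s0 > 0" using assms by (simp add: s0_def)
  have "(s0 + 1)\<^sup>2 = 1 + \<eta>\<^sup>2 / 4" by (simp add: s0_def)
  then have sq: "s0\<^sup>2 - \<eta>\<^sup>2 / 4 = - 2 * s0" by (simp add: power2_sum)
  show ?thesis
  proof (cases "c \<le> c0")
    case True
    define x where "x = s0 - \<eta> / 2"
    have "c * exp (- x) \<le> c0 * exp (- x)" using True by (intro mult_right_mono) auto
    also have "\<dots> = 2 * s0" by (simp add: c0_def x_def mult_exp_exp)
    finally have "c * exp (- x) \<le> 2 * s0" .
    moreover have "x\<^sup>2 + \<eta> * x = s0\<^sup>2 - \<eta>\<^sup>2 / 4" by (simp add: x_def power2_eq_square field_simps)
    ultimately show ?thesis
      using ex_real_root[of x \<eta> c] that sq s0 assms by (auto simp: x_def)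
  next
    case False
    have b: "((\<lambda>b. b / sin b) \<longlongrightarrow> 1) (at_right (0::real))"
      using tendsto_div_sin_0 filterlim_at_split by blast
    have r: "((\<lambda>b. root_re \<eta> b) \<longlongrightarrow> s0) (at_right 0)"
    proof -
      have "((\<lambda>b. - (b / sin b * cos b) + sqrt ((b / sin b)\<^sup>2 + \<eta>\<^sup>2 / 4)) \<longlongrightarrow>
          - (1 * cos 0) + sqrt (1\<^sup>2 + \<eta>\<^sup>2 / 4)) (at_right 0)"
        by (intro tendsto_intros b)
      then show ?thesis by (simp add: root_re_def s0_def)
    qed
    have "((\<lambda>b. root_gain \<eta> b) \<longlongrightarrow> 2 * s0 * exp (s0 - \<eta> / 2) * 1) (at_right 0)"
      unfolding root_gain_def by (intro tendsto_intros b r)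
    then have "\<forall>\<^sub>F b in at_right 0. root_gain \<eta> b < c"
      using False by (intro order_tendstoD(2)) (auto simp: c0_def)
    moreover have "\<forall>\<^sub>F b in at_right 0. b \<in> {0<..<pi}" by (intro eventually_at_right_real) simp
    ultimately have "\<forall>\<^sub>F b in at_right 0. b \<in> {0<..<pi} \<and> root_gain \<eta> b < c"
      by eventually_elim simp
    then obtain b0 where "b0 \<in> {0<..<pi}" "root_gain \<eta> b0 < c"
      using eventually_happens trivial_limit_at_right_real by blast
    then obtain b where b: "b0 \<le> b" "b < pi" "char_fun \<eta> c (Complex (root_re \<eta> b - \<eta> / 2) b) = 0"
      using ex_root_of_gain_le[of b0 \<eta> c] by force
    moreover have "root_re \<eta> b > 0" using b \<open>b0 \<in> _\<close> by (intro root_re_pos) auto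
    ultimately show ?thesis using that[of "Complex (root_re \<eta> b - \<eta> / 2) b"] assms by auto
  qed
qed

lemma ex_unstable_root:
  assumes "(\<eta>, l) \<notin> closure stability_region" "\<eta> \<noteq> 0"
  obtains z where "Re z > 0" "char_fun \<eta> (\<eta> * l) z = 0"
proof -
  consider "\<eta> < 0" | "\<eta> > 0" "l < 0" | "\<eta> > 0" "l > phi \<eta>"
    using not_in_closure_stability_region[OF assms(1)] assms(2) by force
  then show ?thesis
  proof cases
    case 1 then show ?thesis using ex_unstable_root_neg_damping that by blast
  next
    case 2
    then have "\<eta> * l < 0" by (simp add: mult_pos_neg)
    \<comment> \<open>At \<open>x = 0\<close> the value is \<open>\<eta> * l < 0\<close>; the limit
      moves the sign to some \<open>x > 0\<close>, as \<open>ex_real_root\<close> starts from a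
      positive point.\<close>
    moreover have "((\<lambda>x. x\<^sup>2 + \<eta> * x + \<eta> * l * exp (- x)) \<longlongrightarrow> 0\<^sup>2 + \<eta> * 0 + \<eta> * l * exp (- 0)) (at_right 0)"
      by (intro tendsto_intros)
    ultimately have "\<forall>\<^sub>F x in at_right 0. x\<^sup>2 + \<eta> * x + \<eta> * l * exp (- x) < 0"
      by (intro order_tendstoD(2)) auto
    moreover have "\<forall>\<^sub>F x in at_right (0::real). x > 0" by (rule eventually_at_right_less)
    ultimately have "\<forall>\<^sub>F x in at_right 0. x > 0 \<and> x\<^sup>2 + \<eta> * x + \<eta> * l * exp (- x) < 0"
      by eventually_elim simp
    then obtain x where "x > 0" "x\<^sup>2 + \<eta> * x + \<eta> * l * exp (- x) < 0"
      using eventually_happens trivial_limit_at_right_real by blast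
    then show ?thesis using ex_real_root[of x \<eta> "\<eta> * l"] that by force
  next
    case 3
    have "\<eta> * (beta_of \<eta> / sin (beta_of \<eta>)) < \<eta> * l"
      using 3 by (intro mult_strict_left_mono) (auto simp: phi_def)
    then show ?thesis
      using ex_unstable_root_large_gain[of "beta_of \<eta>" \<eta> "\<eta> * l"] 3 beta_of[of \<eta>] that by metis
  qed
qed

section \<open>The scalar delay equation\<close>

lemma DERIV_transform_on:
  fixes F G :: "real \<Rightarrow> real"
  assumes "(F has_real_derivative d) (at x within S)" "x \<in> S" "\<And>y. y \<in> S \<Longrightarrow> F y = G y"
  shows "(G has_real_derivative d) (at x within S)"
  by (rule has_field_derivative_transform_within[OF assms(1), of 1]) (use assms in auto)

lemma at_within_Ici: "(0::real) < t \<Longrightarrow> at t within {0..} = at t"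
  by (rule at_within_interior) simp

lemma at_within_Ici_eq_Icc:
  fixes t :: real assumes "0 \<le> t" "t < b" shows "at t within {0..} = at t within {0..b}"
  by (rule at_within_nhd[of _ "{..<b}"]) (use assms in auto)

lemma integral_has_real_derivative_Ici:
  fixes f :: "real \<Rightarrow> real"
  assumes "continuous_on {0..} f" "t \<ge> 0"
  shows "((\<lambda>t. integral {0..t} f) has_real_derivative f t) (at t within {0..})"
  using integral_has_real_derivative[of 0 "t + 1" f t] assms continuous_on_subset[OF assms(1), of "{0..t + 1}"]
  by (auto simp: at_within_Ici_eq_Icc[of t "t + 1"])

lemma continuous_on_integral_Ici:
  fixes f :: "real \<Rightarrow> real"
  assumes "continuous_on {0..} f" shows "continuous_on {0..} (\<lambda>t. integral {0..t} f)"
  by (rule DERIV_continuous_on) (use integral_has_real_derivative_Ici[OF assms] in auto)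

lemma integral_eq_of_derivative_Ici:
  fixes f :: "real \<Rightarrow> real"
  assumes "\<And>s. s \<ge> 0 \<Longrightarrow> (F has_real_derivative f s) (at s within {0..})" "t \<ge> 0"
  shows "(f has_integral (F t - F 0)) {0..t}"
proof (rule fundamental_theorem_of_calculus[OF assms(2)])
  fix s assume "s \<in> {0..t}"
  then show "(F has_vector_derivative f s) (at s within {0..t})"
    unfolding has_real_derivative_iff_has_vector_derivative[symmetric]
    using assms(1)[of s] by (auto intro: DERIV_subset)
qed

text \<open>Integrating the second-order equation once gives a first-order one: \<open>x'\<close>
  equals \<open>f - \<eta> x\<close> minus \<open>c\<close> times the integral of
  \<open>x (s - 1)\<close>. This is its variation-of-constants solution with zero history when the
  delayed argument is replaced by a given \<open>y\<close>, so solutions are fixed points, and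
  continuity of \<open>f\<close> is all that it takes.\<close>

definition delay_step :: "real \<Rightarrow> real \<Rightarrow> (real \<Rightarrow> real) \<Rightarrow> (real \<Rightarrow> real) \<Rightarrow> real \<Rightarrow> real" where
  "delay_step \<eta> c f y t = (if t \<le> 0 then 0 else
     exp (- (\<eta> * t)) * integral {0..t} (\<lambda>s. exp (\<eta> * s) * (f s - c * integral {0..s} (\<lambda>r. y (r - 1)))))"

lemma delay_step_DERIV:
  assumes f: "continuous_on {0..} f" and y: "continuous_on UNIV y" and t: "t \<ge> 0"
  shows "(delay_step \<eta> c f y has_real_derivative
    f t - c * integral {0..t} (\<lambda>r. y (r - 1)) - \<eta> * delay_step \<eta> c f y t) (at t within {0..})"
proof -
  let ?h = "\<lambda>s. f s - c * integral {0..s} (\<lambda>r. y (r - 1))"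
  let ?J = "\<lambda>t. exp (- (\<eta> * t)) * integral {0..t} (\<lambda>s. exp (\<eta> * s) * ?h s)"
  have y1: "continuous_on {0..} (\<lambda>r. y (r - 1))"
    by (intro continuous_on_compose2[OF y] continuous_intros) auto
  have "continuous_on {0..} (\<lambda>s. exp (\<eta> * s) * ?h s)"
    by (intro continuous_intros f continuous_on_integral_Ici y1)
  note D = integral_has_real_derivative_Ici[OF this t]
  have "(?J has_real_derivative exp (- (\<eta> * t)) * (exp (\<eta> * t) * ?h t) - \<eta> * ?J t) (at t within {0..})"
    by (auto intro!: derivative_eq_intros D)
  also have "exp (- (\<eta> * t)) * (exp (\<eta> * t) * ?h t) = ?h t"
    by (simp add: mult.assoc[symmetric] exp_add[symmetric])
  finally have J: "(?J has_real_derivative ?h t - \<eta> * ?J t) (at t within {0..})" .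
  have eq: "delay_step \<eta> c f y s = ?J s" if "s \<in> {0..}" for s
    using that by (auto simp: delay_step_def)
  show ?thesis
    unfolding eq[OF t[folded atLeast_iff]]
    by (rule DERIV_transform_on[OF J]) (use t eq in auto)
qed

lemma delay_step_continuous:
  assumes "continuous_on {0..} f" "continuous_on UNIV y"
  shows "continuous_on UNIV (delay_step \<eta> c f y)"
proof -
  have "continuous_on {0..} (delay_step \<eta> c f y)"
    by (rule DERIV_continuous_on) (use delay_step_DERIV[OF assms] in auto)
  moreover have "continuous_on {..0} (delay_step \<eta> c f y)"
    by (rule continuous_on_cong[THEN iffD2, OF refl _ continuous_on_const[of _ 0]]) (auto simp: delay_step_def)
  moreover have "UNIV = {..0} \<union> {0::real..}" by auto
  ultimately show ?thesis by (metis continuous_on_closed_Un closed_atLeast closed_atMost)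
qed

text \<open>The operator looks back by at least 1. This is why the iteration becomes stationary
  instead of merely converging.\<close>

lemma delay_step_cong:
  assumes "\<And>s. s \<le> t - 1 \<Longrightarrow> y s = z s"
  shows "delay_step \<eta> c f y t = delay_step \<eta> c f z t"
proof -
  have "integral {0..s} (\<lambda>r. y (r - 1)) = integral {0..s} (\<lambda>r. z (r - 1))" if "s \<in> {0..t}" for s
    by (rule integral_cong) (use that assms in auto)
  then have "integral {0..t} (\<lambda>s. exp (\<eta> * s) * (f s - c * integral {0..s} (\<lambda>r. y (r - 1))))
      = integral {0..t} (\<lambda>s. exp (\<eta> * s) * (f s - c * integral {0..s} (\<lambda>r. z (r - 1))))"
    by (intro integral_cong) simp
  then show ?thesis by (simp add: delay_step_def)
qed

text \<open>Because of the delay, the iterates of \<open>delay_step\<close> are stationary on \<open>{..n}\<close> from the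
  \<open>n\<close>-th one on.\<close>

lemma delay_step_fixpoint:
  assumes f: "continuous_on {0..} f"
  obtains x where "continuous_on UNIV x" "\<And>t. x t = delay_step \<eta> c f x t"
proof -
  define X where "X n = (delay_step \<eta> c f ^^ n) (\<lambda>_. 0)" for n
  have X0: "X 0 = (\<lambda>_. 0)" and XS: "X (Suc n) = delay_step \<eta> c f (X n)" for n
    by (auto simp: X_def)
  have cont: "continuous_on UNIV (X n)" for n
    by (induction n) (auto simp: X0 XS intro: delay_step_continuous f)
  have step: "X (Suc n) t = X n t" if "t \<le> real n" for n t
    using that
  proof (induction n arbitrary: t)
    case 0 then show ?case by (simp add: X0 XS delay_step_def)
  next
    case (Suc n)
    have "delay_step \<eta> c f (X (Suc n)) t = delay_step \<eta> c f (X n) t"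
      by (rule delay_step_cong) (use Suc in auto)
    then show ?case by (simp add: XS)
  qed
  have stat: "X (n + m) t = X n t" if "t \<le> real n" for n m t
    using that by (induction m) (auto simp: step)
  define x where "x t = X (nat \<lceil>t\<rceil>) t" for t
  have x: "x t = X n t" if "t \<le> real n" for n t
  proof -
    have "nat \<lceil>t\<rceil> \<le> n" "t \<le> real (nat \<lceil>t\<rceil>)" using that by linarith+
    then show ?thesis using stat[of t "nat \<lceil>t\<rceil>" "n - nat \<lceil>t\<rceil>"] by (simp add: x_def)
  qed
  show ?thesis
  proof (rule that)
    show "continuous_on UNIV x"
    proof (rule continuous_at_imp_continuous_on, rule ballI)
      fix t :: real
      obtain n where n: "t < real n" using reals_Archimedean2 by blast
      have "continuous_on {..<real n} x"
        using continuous_on_subset[OF cont subset_UNIV, of "{..<real n}" n]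
        by (rule continuous_on_cong[THEN iffD2, rotated 2]) (auto simp: x)
      then show "isCont x t" using n by (simp add: continuous_on_eq_continuous_at)
    qed
    fix t
    obtain n where n: "t \<le> real n" using real_arch_simple by blast
    have "x t = X (Suc n) t" using x[of t "Suc n"] n by simp
    also have "\<dots> = delay_step \<eta> c f x t"
      unfolding XS by (rule delay_step_cong) (use n in \<open>simp add: x[symmetric]\<close>)
    finally show "x t = delay_step \<eta> c f x t" .
  qed
qed

lemma delay_equation_ex:
  assumes f: "continuous_on {0..} f"
  obtains x v where "continuous_on UNIV x" "\<And>t. t \<le> 0 \<Longrightarrow> x t = 0" "continuous_on {0..} v"
    "\<And>t. t \<ge> 0 \<Longrightarrow> (x has_real_derivative v t) (at t within {0..})"
    "\<And>t. t \<ge> 0 \<Longrightarrow> v t = f t - \<eta> * x t - c * integral {0..t} (\<lambda>s. x (s - 1))"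
    "\<And>t. t < 0 \<Longrightarrow> v t = 0"
    "\<And>t. x t = delay_step \<eta> c f x t"
proof -
  obtain x where x: "continuous_on UNIV x" "\<And>t. x t = delay_step \<eta> c f x t"
    using delay_step_fixpoint[OF f] by blast
  define v where "v t = (if t < 0 then 0 else f t - \<eta> * x t - c * integral {0..t} (\<lambda>s. x (s - 1)))" for t
  have x1: "continuous_on {0..} (\<lambda>r. x (r - 1))"
    by (intro continuous_on_compose2[OF x(1)] continuous_intros) auto
  have "continuous_on {0..} (\<lambda>t. f t - \<eta> * x t - c * integral {0..t} (\<lambda>s. x (s - 1)))"
    by (intro continuous_intros f continuous_on_integral_Ici x1 continuous_on_subset[OF x(1)]) auto
  then have "continuous_on {0..} v"
    by (rule continuous_on_cong[THEN iffD2, rotated 2]) (auto simp: v_def)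
  moreover have "(x has_real_derivative v t) (at t within {0..})" if "t \<ge> 0" for t
  proof -
    have "x = delay_step \<eta> c f x" using x(2) by blast
    moreover have "v t = f t - c * integral {0..t} (\<lambda>r. x (r - 1)) - \<eta> * delay_step \<eta> c f x t"
      using that x(2)[of t] by (simp add: v_def)
    ultimately show ?thesis using delay_step_DERIV[OF f x(1) that, of \<eta> c] by simp
  qed
  moreover have "x t = 0" if "t \<le> 0" for t using that x(2)[of t] by (simp add: delay_step_def)
  ultimately show ?thesis using that[of x v] x by (simp add: v_def)
qed

text \<open>The noise path \<open>f\<close> enters the integrated equation, so it need not be
  differentiable. No history is prescribed: projections of vector solutions and pure exponentials
  are both instances.\<close>

definition delay_solution ::
  "real \<Rightarrow> real \<Rightarrow> (real \<Rightarrow> real) \<Rightarrow> (real \<Rightarrow> real) \<Rightarrow> (real \<Rightarrow> real) \<Rightarrow> bool" where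
  "delay_solution \<eta> c f x v \<longleftrightarrow>
     continuous_on {0..} f \<and> continuous_on {-1..} x \<and> continuous_on {0..} v \<and>
     (\<forall>t\<ge>0. x t = x 0 + integral {0..t} v) \<and>
     (\<forall>t\<ge>0. v t = v 0 + integral {0..t} (\<lambda>s. - (\<eta> * v s) - c * x (s - 1)) + f t)"

text \<open>The solution for the constant forcing 1 and zero history. In integrated form this
  forcing is a unit initial velocity, so \<open>k 0 = 1\<close> and \<open>g\<close> is the impulse
  response. At 0 \<open>g\<close> has a kink and \<open>k\<close> a jump, hence the one-sided
  derivatives. \<open>g_step\<close> keeps the fixed-point form for the growth bound.\<close>

locale fundamental_solution =
  fixes \<eta> c :: real and g k :: "real \<Rightarrow> real"
  assumes g_zero: "\<And>t. t \<le> 0 \<Longrightarrow> g t = 0" and k_neg: "\<And>t. t < 0 \<Longrightarrow> k t = 0"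
    and g_cont: "continuous_on UNIV g" and k_cont: "continuous_on {0..} k"
    and g_DERIV: "\<And>t. t \<ge> 0 \<Longrightarrow> (g has_real_derivative k t) (at t within {0..})"
    and k_eq: "\<And>t. t \<ge> 0 \<Longrightarrow> k t = 1 - \<eta> * g t - c * integral {0..t} (\<lambda>s. g (s - 1))"
    and g_step: "\<And>t. g t = delay_step \<eta> c (\<lambda>_. 1) g t"

lemma fundamental_solution_ex: "\<exists>g k. fundamental_solution \<eta> c g k"
  by (rule delay_equation_ex[of "\<lambda>_. 1" \<eta> c, OF continuous_on_const])
    (unfold fundamental_solution_def, blast)

section \<open>Variation of constants\<close>

lemma integral_shift_Icc:
  fixes f :: "real \<Rightarrow> real"
  shows "integral {a..b} (\<lambda>s. f (s + d)) = integral {a + d..b + d} f"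
proof -
  have "((\<lambda>s. f (s + d)) has_integral y) {a..b} \<longleftrightarrow> (f has_integral y) {a + d..b + d}" for y
    using has_integral_affinity_iff[of 1 f d y "a + d" "b + d"] 
    by simp
  then show ?thesis unfolding integral_def integrable_on_def by simp
qed

text \<open>Duality: \<open>p (t - s) * (v s - f s) + r (t - s) * x s\<close> is differentiated in
  \<open>s\<close> and integrated over \<open>[0, t]\<close>, the kernels solving the adjoint
  equation. In its derivative \<open>f\<close> survives only in \<open>q (t - s) * f s\<close>, and
  the two delayed terms cancel up to a shift by 1, which leaves the history on
  \<open>[0, 1]\<close>. Taking \<open>g\<close> or \<open>k\<close> for \<open>p\<close> gives
  position or velocity.\<close>

lemma kernel_representation:
  fixes p q r f x v :: "real \<Rightarrow> real"
  assumes sol: "delay_solution \<eta> c f x v"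
    and p: "\<And>u. u < 0 \<Longrightarrow> p u = 0" "continuous_on {0..} p"
      "\<And>u. u \<ge> 0 \<Longrightarrow> (p has_real_derivative q u) (at u within {0..})"
    and q: "continuous_on {0..} q"
    and r: "\<And>u. u \<ge> 0 \<Longrightarrow> r u = q u + \<eta> * p u" "continuous_on {0..} r"
      "\<And>u. u > 0 \<Longrightarrow> u \<noteq> 1 \<Longrightarrow> (r has_real_derivative - c * p (u - 1)) (at u)"
    and t: "t \<ge> 0"
  shows "p 0 * v t + r 0 * x t = p t * (v 0 - f 0) + r t * x 0 - c * integral {0..1} (\<lambda>s. p (t - s) * x (s - 1))
    + (p 0 * f t + integral {0..t} (\<lambda>s. q (t - s) * f s))"
proof -
  note S = sol[unfolded delay_solution_def]
  have fc: "continuous_on {0..} f" and xc: "continuous_on {-1..} x" and vc: "continuous_on {0..} v"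
    using S by blast+
  have xeq: "x 0 + integral {0..t} v = x t" if "t \<ge> 0" for t
    using S that by presburger
  have veq: "v 0 + integral {0..t} (\<lambda>s. - (\<eta> * v s) - c * x (s - 1)) = v t - f t" if "t \<ge> 0" for t
  proof -
    have "v t = v 0 + integral {0..t} (\<lambda>s. - (\<eta> * v s) - c * x (s - 1)) + f t"
      using S that by blast
    then show ?thesis by linarith
  qed
  \<comment> \<open>Unlike \<open>v\<close>, the difference \<open>v - f\<close> is
    differentiable.\<close>
  define Y where "Y s = v s - f s" for s
  let ?\<Phi> = "\<lambda>s. p (t - s) * Y s + r (t - s) * x s"
  let ?\<Phi>' = "\<lambda>s. q (t - s) * f s - c * (p (t - s) * x (s - 1)) + c * (p (t - s - 1) * x s)"
  have x1: "continuous_on {0..} (\<lambda>s. x (s - 1))"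
    by (intro continuous_on_compose2[OF xc] continuous_intros) auto
  have xD: "(x has_real_derivative v s) (at s)" if "s > 0" for s
  proof -
    have "((\<lambda>t. x 0 + integral {0..t} v) has_real_derivative v s) (at s within {0..})"
      using that by (auto intro!: derivative_eq_intros integral_has_real_derivative_Ici vc)
    then have "(x has_real_derivative v s) (at s within {0..})"
      by (rule DERIV_transform_on) (use that in \<open>simp_all add: xeq\<close>)
    moreover have "at s within {0..} = at s" using that by (simp add: at_within_Ici)
    ultimately show ?thesis by simp
  qed
  have YD: "(Y has_real_derivative - (\<eta> * v s) - c * x (s - 1)) (at s)" if "s > 0" for s
  proof -
    have "continuous_on {0..} (\<lambda>s. - (\<eta> * v s) - c * x (s - 1))"
      by (intro continuous_intros vc x1)
    then have "((\<lambda>t. v 0 + integral {0..t} (\<lambda>s. - (\<eta> * v s) - c * x (s - 1))) has_real_derivative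
        - (\<eta> * v s) - c * x (s - 1)) (at s within {0..})"
      using that by (auto intro!: derivative_eq_intros integral_has_real_derivative_Ici)
    then have "(Y has_real_derivative - (\<eta> * v s) - c * x (s - 1)) (at s within {0..})"
      by (rule DERIV_transform_on) (use that in \<open>simp_all add: Y_def veq\<close>)
    moreover have "at s within {0..} = at s" using that by (simp add: at_within_Ici)
    ultimately show ?thesis by simp
  qed
  have refl_cont: "continuous_on {0..t} (\<lambda>s. h (t - s))" if "continuous_on {0..} h" for h :: "real \<Rightarrow> real"
    by (rule continuous_on_compose2[OF that]) (auto intro!: continuous_intros)
  have "(?\<Phi>' has_integral (?\<Phi> t - ?\<Phi> 0)) {0..t}"
  \<comment> \<open>\<open>r\<close> may fail to be differentiable at the argument 1, that is at
    \<open>s = t - 1\<close>; for the velocity \<open>r\<close> is a delayed \<open>g\<close>, with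
    its kink there.\<close>
  proof (rule fundamental_theorem_of_calculus_interior_strong[of "{t - 1}"])
    fix s assume s: "s \<in> {0<..<t} - {t - 1}"
    have rD0: "((\<lambda>s. t - s) has_real_derivative -1) (at s)" by (auto intro!: derivative_eq_intros)
    have pD: "((\<lambda>s. p (t - s)) has_real_derivative - q (t - s)) (at s)"
    proof -
      have "(p has_real_derivative q (t - s)) (at (t - s))"
        using p(3)[of "t - s"] s by (simp add: at_within_Ici)
      then show ?thesis using DERIV_chain2[where f = p and g = "\<lambda>s. t - s", OF _ rD0] by simp
    qed
    have rD: "((\<lambda>s. r (t - s)) has_real_derivative c * p (t - s - 1)) (at s)"
      using DERIV_chain2[where f = r and g = "\<lambda>s. t - s", OF r(3)[of "t - s"] rD0] s by simp
    have "(?\<Phi> has_real_derivative (- q (t - s) * Y s + p (t - s) * (- (\<eta> * v s) - c * x (s - 1))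
        + (c * p (t - s - 1) * x s + r (t - s) * v s))) (at s)"
      using s by (auto intro!: derivative_eq_intros pD rD YD xD)
    also have "(- q (t - s) * Y s + p (t - s) * (- (\<eta> * v s) - c * x (s - 1))
        + (c * p (t - s - 1) * x s + r (t - s) * v s)) = ?\<Phi>' s"
      using s by (simp add: r(1) Y_def algebra_simps)
    finally show "(?\<Phi> has_vector_derivative ?\<Phi>' s) (at s)"
      by (simp add: has_real_derivative_iff_has_vector_derivative)
  next
    show "continuous_on {0..t} ?\<Phi>"
      unfolding Y_def
      by (intro continuous_intros refl_cont p r continuous_on_subset[OF vc] continuous_on_subset[OF fc]
          continuous_on_subset[OF xc]) auto
  qed (use t in auto)
  then have "integral {0..t} ?\<Phi>' = ?\<Phi> t - ?\<Phi> 0" by (rule integral_unique)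
  then have main: "integral {0..t} ?\<Phi>' = p 0 * (v t - f t) + r 0 * x t - (p t * (v 0 - f 0) + r t * x 0)"
    by (simp only: Y_def diff_self diff_zero)
  let ?F = "\<lambda>s. p (t - s) * x (s - 1)"
  have F1: "?F integrable_on {0..t}"
    by (intro integrable_continuous_real continuous_intros refl_cont p continuous_on_subset[OF x1]) auto
  \<comment> \<open>Beyond \<open>t\<close> the integrand vanishes, except possibly at
    \<open>s = t\<close>, where \<open>p 0\<close> need not be 0. Extending to \<open>t + 1\<close>
    lets the shifted integral be subtracted without a separate case \<open>t < 1\<close>.\<close>
  have F2: "(?F has_integral 0) {t..t + 1}"
    by (rule has_integral_spike_finite[of "{t}" _ _ "\<lambda>_. 0"]) (use p(1) in auto)
  have F: "?F integrable_on {0..t + 1}"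
    using Henstock_Kurzweil_Integration.integrable_combine[of 0 t "t + 1" ?F] F1 F2 t by auto
  have "integral {0..t} ?F + integral {t..t + 1} ?F = integral {0..t + 1} ?F"
    by (rule Henstock_Kurzweil_Integration.integral_combine) (use t F in auto)
  moreover have "integral {0..1} ?F + integral {1..t + 1} ?F = integral {0..t + 1} ?F"
    by (rule Henstock_Kurzweil_Integration.integral_combine) (use t F in auto)
  moreover have "integral {t..t + 1} ?F = 0" using F2 by (rule integral_unique)
  moreover have "integral {0..t} (\<lambda>s. p (t - s - 1) * x s) = integral {1..t + 1} ?F"
    using integral_shift_Icc[of 0 t ?F 1] by (simp add: algebra_simps)
  ultimately have diff: "integral {0..t} ?F - integral {0..t} (\<lambda>s. p (t - s - 1) * x s) = integral {0..1} ?F"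
    by simp
  have G: "(\<lambda>s. p (t - s - 1) * x s) integrable_on {0..t}"
  proof -
    have "?F integrable_on {1..t + 1}" by (rule integrable_subinterval_real[OF F]) auto
    then show ?thesis
      using has_integral_affinity_iff[of 1 ?F 1 _ 1 "t + 1"] unfolding integrable_on_def
      by (simp add: algebra_simps)
  qed
  have Q: "(\<lambda>s. q (t - s) * f s) integrable_on {0..t}"
    by (intro integrable_continuous_real continuous_intros refl_cont q continuous_on_subset[OF fc]) auto
  have "integral {0..t} ?\<Phi>' = integral {0..t} (\<lambda>s. q (t - s) * f s) - c * integral {0..t} ?F
      + c * integral {0..t} (\<lambda>s. p (t - s - 1) * x s)"
    by (intro integral_unique has_integral_add has_integral_diff has_integral_mult_right
        integrable_integral Q F1 G)
  also have "\<dots> = integral {0..t} (\<lambda>s. q (t - s) * f s) - c * integral {0..1} ?F"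
    unfolding diff[symmetric] right_diff_distrib by simp
  finally show ?thesis using main unfolding right_diff_distrib by linarith
qed

context fundamental_solution
begin

lemma k_0: "k 0 = 1"
  using k_eq[of 0] g_zero[of 0] by simp

definition k' :: "real \<Rightarrow> real" where "k' u = - \<eta> * k u - c * g (u - 1)"

lemma g_shift_cont: "continuous_on S (\<lambda>u. g (u - a))"
  by (intro continuous_on_compose2[OF g_cont] continuous_intros) auto

lemma k'_cont: "continuous_on {0..} k'"
  unfolding k'_def[abs_def] by (intro continuous_intros k_cont g_shift_cont)

lemma k_DERIV: "(k has_real_derivative k' t) (at t within {0..})" if "t \<ge> 0" for t
proof -
  have "((\<lambda>t. 1 - \<eta> * g t - c * integral {0..t} (\<lambda>s. g (s - 1))) has_real_derivative k' t) (at t within {0..})"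
    using that unfolding k'_def
    by (auto intro!: derivative_eq_intros g_DERIV integral_has_real_derivative_Ici g_shift_cont)
  then show ?thesis
    by (rule DERIV_transform_on) (use k_eq that in auto)
qed

lemma g_DERIV_at: "(g has_real_derivative k t) (at t)" if "t \<noteq> 0" for t
proof (cases "t > 0")
  case True
  then show ?thesis using g_DERIV[of t] by (simp add: at_within_Ici)
next
  case False
  then have "\<forall>\<^sub>F s in nhds t. g s = 0"
    using that by (intro eventually_mono[OF eventually_nhds_in_open[of "{..<0}" t]]) (auto simp: g_zero)
  then show ?thesis using False that k_neg[of t]
      DERIV_cong_ev[of t t g "\<lambda>_. 0" "k t" 0] by simp
qed

lemma position_representation:
  assumes "delay_solution \<eta> c f x v" "f 0 = 0" "t \<ge> 0"
  shows "x t = g t * v 0 + (k t + \<eta> * g t) * x 0 - c * integral {0..1} (\<lambda>s. g (t - s) * x (s - 1))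
    + (g 0 * f t + integral {0..t} (\<lambda>s. k (t - s) * f s))"
proof -
  have "((\<lambda>u. k u + \<eta> * g u) has_real_derivative - c * g (u - 1)) (at u)" if "u > 0" for u
  proof -
    have "(k has_real_derivative k' u) (at u)" using k_DERIV[of u] that by (simp add: at_within_Ici)
    then show ?thesis using g_DERIV_at[of u] that
      by (auto intro!: derivative_eq_intros simp: k'_def)
  qed
  note D = this
  have C: "continuous_on {0..} (\<lambda>u. k u + \<eta> * g u)"
    by (intro continuous_intros k_cont continuous_on_subset[OF g_cont]) auto
  have "g 0 * v t + (k 0 + \<eta> * g 0) * x t = g t * (v 0 - f 0) + (k t + \<eta> * g t) * x 0
      - c * integral {0..1} (\<lambda>s. g (t - s) * x (s - 1))
      + (g 0 * f t + integral {0..t} (\<lambda>s. k (t - s) * f s))"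
    by (rule kernel_representation[OF assms(1) _ _ g_DERIV k_cont _ C D assms(3)])
      (auto simp: g_zero intro: continuous_on_subset[OF g_cont])
  then show ?thesis using k_0 g_zero[of 0] assms(2) by simp
qed

text \<open>Here \<open>p = k\<close> and the companion kernel is \<open>- c * g (u - 1)\<close>,
  which equals \<open>k' u + \<eta> * k u\<close>. The last bracket is the Wiener integral of
  \<open>k (t - s)\<close> after integration by parts.\<close>

lemma velocity_representation:
  assumes "delay_solution \<eta> c f x v" "f 0 = 0" "t \<ge> 0"
  shows "v t = k t * v 0 - c * g (t - 1) * x 0 - c * integral {0..1} (\<lambda>s. k (t - s) * x (s - 1))
    + (k 0 * f t + integral {0..t} (\<lambda>s. k' (t - s) * f s))"
proof -
  have D: "((\<lambda>u. - c * g (u - 1)) has_real_derivative - c * k (u - 1)) (at u)" if "u \<noteq> 1" for u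
  proof -
    have "((\<lambda>u. u - 1) has_real_derivative 1) (at u)" by (auto intro!: derivative_eq_intros)
    then have "((\<lambda>u. g (u - 1)) has_real_derivative k (u - 1) * 1) (at u)"
      by (intro DERIV_chain2[where f = g and g = "\<lambda>u. u - 1"] g_DERIV_at) (use that in auto)
    then show ?thesis by (auto intro!: derivative_eq_intros)
  qed
  have C: "continuous_on {0..} (\<lambda>u. - c * g (u - 1))"
    by (intro continuous_intros g_shift_cont)
  have "k 0 * v t + (- c * g (0 - 1)) * x t = k t * (v 0 - f 0) + (- c * g (t - 1)) * x 0
      - c * integral {0..1} (\<lambda>s. k (t - s) * x (s - 1))
      + (k 0 * f t + integral {0..t} (\<lambda>s. k' (t - s) * f s))"
    by (rule kernel_representation[OF assms(1) k_neg k_cont k_DERIV k'_cont _ C D assms(3)])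
      (auto simp: k'_def)
  then show ?thesis using k_0 g_zero[of "-1"] assms(2) by simp
qed

end

lemma delay_solution_ex:
  assumes f: "continuous_on {0..} f" "f 0 = 0"
  obtains x v where "delay_solution \<eta> c f x v" "\<And>t. t \<le> 0 \<Longrightarrow> x t = 0" "v 0 = 0"
proof -
  obtain x v where x: "continuous_on UNIV x" "\<And>t. t \<le> 0 \<Longrightarrow> x t = 0" "continuous_on {0..} v"
    "\<And>t. t \<ge> 0 \<Longrightarrow> (x has_real_derivative v t) (at t within {0..})"
    "\<And>t. t \<ge> 0 \<Longrightarrow> v t = f t - \<eta> * x t - c * integral {0..t} (\<lambda>s. x (s - 1))"
    by (rule delay_equation_ex[OF f(1), of \<eta> c]) blast
  have x1: "continuous_on {0..} (\<lambda>s. x (s - 1))"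
    by (intro continuous_on_compose2[OF x(1)] continuous_intros) auto
  have xi: "(v has_integral x t) {0..t}" if "t \<ge> 0" for t
    using integral_eq_of_derivative_Ici[OF x(4) that] x(2)[of 0] by simp
  have "v t = integral {0..t} (\<lambda>s. - (\<eta> * v s) - c * x (s - 1)) + f t" if "t \<ge> 0" for t
  proof -
    have "((\<lambda>s. x (s - 1)) has_integral integral {0..t} (\<lambda>s. x (s - 1))) {0..t}"
      by (intro integrable_integral integrable_continuous_real continuous_on_subset[OF x1]) auto
    then have "((\<lambda>s. - (\<eta> * v s) - c * x (s - 1)) has_integral
        - (\<eta> * x t) - c * integral {0..t} (\<lambda>s. x (s - 1))) {0..t}"
      by (intro has_integral_diff has_integral_neg has_integral_mult_right xi that)
    then show ?thesis using x(5)[OF that] by (simp add: integral_unique)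
  qed
  moreover have "v 0 = 0" using x(5)[of 0] x(2)[of 0] f by simp
  ultimately have "delay_solution \<eta> c f x v"
    unfolding delay_solution_def using f x(1-3) continuous_on_subset[OF x(1) subset_UNIV]
      integral_unique[OF xi] by auto
  then show ?thesis using that x(2) \<open>v 0 = 0\<close> by blast
qed

section \<open>Fourier inversion\<close>

lemma integrable_inverse_1_plus_square_UNIV: "integrable lborel (\<lambda>x::real. inverse (1 + x\<^sup>2))"
  using integrable_inverse_1_plus_square by (simp add: set_integrable_def einterval_def)

lemma integral_std_normal_iexp:
  "(\<integral>y. std_normal_density y *\<^sub>R iexp (u * y) \<partial>lborel) = complex_of_real (exp (- u\<^sup>2 / 2))"
  using fun_cong[OF char_std_normal_distribution, of u]
  by (simp add: char_def integral_density normal_density_nonneg)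

text \<open>The Gaussian factor makes the iterated integral absolutely convergent; as its width
  grows, the other side becomes the convolution of \<open>f\<close> with an approximate identity.\<close>

lemma fourier_inversion:
  fixes f :: "real \<Rightarrow> complex"
  assumes cont: "continuous_on UNIV f" and bnd: "\<And>x. cmod (f x) \<le> B" and int: "integrable lborel f"
    and F: "\<And>\<omega>. F \<omega> = (\<integral>s. iexp (- (\<omega> * s)) * f s \<partial>lborel)" and intF: "integrable lborel F"
  shows "2 * pi * f t = (\<integral>\<omega>. iexp (\<omega> * t) * F \<omega> \<partial>lborel)"
proof -
  let ?\<phi> = std_normal_density
  have [measurable]: "f \<in> borel_measurable borel" using cont by (rule borel_measurable_continuous_onI)
  have [measurable]: "F \<in> borel_measurable borel" using intF by auto
  define A where "A n = (\<integral>\<omega>. ?\<phi> (\<omega> / real (Suc n)) *\<^sub>R (iexp (\<omega> * t) * F \<omega>) \<partial>lborel)" for n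
  have n_int: "integrable lborel (\<lambda>\<omega>. ?\<phi> (\<omega> / real (Suc n)))" for n
    using lborel_integrable_real_affine[of ?\<phi> "1 / real (Suc n)" 0]
      integrable_normal_density[of 1 0] by simp
  have \<phi>_le: "?\<phi> x \<le> 1 / sqrt (2 * pi)" for x
    using divide_right_mono[of "exp (- (x\<^sup>2 / 2))" 1 "sqrt (2 * pi)"] by (simp add: std_normal_density_def)
  have lim1: "A \<longlonglongrightarrow> (\<integral>\<omega>. (1 / sqrt (2 * pi)) *\<^sub>R (iexp (\<omega> * t) * F \<omega>) \<partial>lborel)"
    unfolding A_def
  proof (rule integral_dominated_convergence)
    show "integrable lborel (\<lambda>\<omega>. 1 / sqrt (2 * pi) * cmod (F \<omega>))"
      by (intro integrable_mult_right integrable_norm intF)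
    show "AE \<omega> in lborel. (\<lambda>n. ?\<phi> (\<omega> / real (Suc n)) *\<^sub>R (iexp (\<omega> * t) * F \<omega>))
        \<longlonglongrightarrow> (1 / sqrt (2 * pi)) *\<^sub>R (iexp (\<omega> * t) * F \<omega>)"
    proof (rule AE_I2, rule tendsto_scaleR[OF _ tendsto_const])
      fix \<omega> :: real
      have "(\<lambda>n. \<omega> / real (Suc n)) \<longlonglongrightarrow> 0" by real_asymp
      then have "(\<lambda>n. ?\<phi> (\<omega> / real (Suc n))) \<longlonglongrightarrow> (1 / sqrt (2 * pi)) * exp (- 0\<^sup>2 / 2)"
        unfolding std_normal_density_def by (intro tendsto_intros) auto
      then show "(\<lambda>n. ?\<phi> (\<omega> / real (Suc n))) \<longlonglongrightarrow> 1 / sqrt (2 * pi)" by simp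
    qed
    show "AE \<omega> in lborel. norm (?\<phi> (\<omega> / real (Suc n)) *\<^sub>R (iexp (\<omega> * t) * F \<omega>))
        \<le> 1 / sqrt (2 * pi) * cmod (F \<omega>)" for n
    proof (rule AE_I2)
      fix \<omega>
      show "norm (?\<phi> (\<omega> / real (Suc n)) *\<^sub>R (iexp (\<omega> * t) * F \<omega>)) \<le> 1 / sqrt (2 * pi) * cmod (F \<omega>)"
        using mult_right_mono[OF \<phi>_le[of "\<omega> / real (Suc n)"] norm_ge_zero[of "F \<omega>"]]
        by (simp add: norm_mult abs_of_nonneg normal_density_nonneg)
    qed
  qed measurable
  have scaling: "(\<integral>\<omega>. ?\<phi> (\<omega> / m) *\<^sub>R iexp (\<omega> * u) \<partial>lborel)
      = m *\<^sub>R (\<integral>y. ?\<phi> y *\<^sub>R iexp ((m * u) * y) \<partial>lborel)" if "m > 0" for m u :: real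
  proof -
    have "(\<integral>\<omega>. ?\<phi> (\<omega> / m) *\<^sub>R iexp (\<omega> * u) \<partial>lborel)
        = \<bar>m\<bar> *\<^sub>R (\<integral>y. ?\<phi> ((0 + m * y) / m) *\<^sub>R iexp ((0 + m * y) * u) \<partial>lborel)"
      by (rule lborel_integral_real_affine) (use that in simp)
    moreover have "(0 + m * y) / m = y" "(0 + m * y) * u = (m * u) * y" for y
      using that by auto
    ultimately show ?thesis using that by (simp only:) simp
  qed
  \<comment> \<open>After Fubini the inner integral is the Fourier transform of a Gaussian, again a
    Gaussian; the substitution \<open>s = t - y / Suc n\<close> gives it unit width and moves the
    shrinking scale into the argument of \<open>f\<close>.\<close>
  have A_eq: "A n = (\<integral>y. (sqrt (2 * pi) * ?\<phi> y) *\<^sub>R f (t - y / real (Suc n)) \<partial>lborel)" for n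
  proof -
    let ?n = "real (Suc n)"
    let ?h = "\<lambda>\<omega> s. ?\<phi> (\<omega> / ?n) *\<^sub>R (iexp (\<omega> * (t - s)) * f s)"
    have e: "iexp (\<omega> * t) * (iexp (- (\<omega> * s)) * f s) = iexp (\<omega> * (t - s)) * f s" for \<omega> s
      unfolding mult.assoc[symmetric] mult_exp_exp
      by (rule arg_cong[of _ _ "\<lambda>u. exp u * f s"]) (simp add: algebra_simps)
    have "A n = (\<integral>\<omega>. (\<integral>s. ?h \<omega> s \<partial>lborel) \<partial>lborel)"
      unfolding A_def F by (simp only: integral_mult_right_zero[symmetric] integral_scaleR_right[symmetric] e)
    also have "\<dots> = (\<integral>s. (\<integral>\<omega>. ?h \<omega> s \<partial>lborel) \<partial>lborel)"
    proof (rule lborel_pair.Fubini_integral[symmetric], rule lborel_pair.Fubini_integrable)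
      have "(\<lambda>\<omega>. \<integral>s. norm (?h \<omega> s) \<partial>lborel) = (\<lambda>\<omega>. ?\<phi> (\<omega> / ?n) * (\<integral>s. cmod (f s) \<partial>lborel))"
        by (simp add: norm_mult abs_of_nonneg normal_density_nonneg)
      then show "integrable lborel (\<lambda>\<omega>. \<integral>s. norm (case (\<omega>, s) of (\<omega>, s) \<Rightarrow> ?h \<omega> s) \<partial>lborel)"
        using n_int by simp
      show "AE \<omega> in lborel. integrable lborel (\<lambda>s. case (\<omega>, s) of (\<omega>, s) \<Rightarrow> ?h \<omega> s)"
      proof (rule AE_I2)
        fix \<omega> :: real
        have "integrable lborel (\<lambda>s. iexp (\<omega> * (t - s)) * f s)"
          by (rule Bochner_Integration.integrable_bound[OF int]) (auto simp: norm_mult)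
        then show "integrable lborel (\<lambda>s. case (\<omega>, s) of (\<omega>, s) \<Rightarrow> ?h \<omega> s)" by simp
      qed
    qed measurable
    also have "\<dots> = (\<integral>s. (?n * exp (- (?n * (t - s))\<^sup>2 / 2)) *\<^sub>R f s \<partial>lborel)"
    proof (intro Bochner_Integration.integral_cong refl)
      fix s
      have "(\<integral>\<omega>. ?h \<omega> s \<partial>lborel) = (\<integral>\<omega>. ?\<phi> (\<omega> / ?n) *\<^sub>R iexp (\<omega> * (t - s)) \<partial>lborel) * f s"
        unfolding integral_mult_left_zero[symmetric] by simp
      also have "(\<integral>\<omega>. ?\<phi> (\<omega> / ?n) *\<^sub>R iexp (\<omega> * (t - s)) \<partial>lborel)
          = ?n *\<^sub>R (\<integral>y. ?\<phi> y *\<^sub>R iexp ((?n * (t - s)) * y) \<partial>lborel)"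
        by (rule scaling) simp
      also have "\<dots> = ?n *\<^sub>R complex_of_real (exp (- (?n * (t - s))\<^sup>2 / 2))"
        unfolding integral_std_normal_iexp ..
      finally show "(\<integral>\<omega>. ?h \<omega> s \<partial>lborel) = (?n * exp (- (?n * (t - s))\<^sup>2 / 2)) *\<^sub>R f s"
        by (simp add: scaleR_conv_of_real)
    qed
    also have "\<dots> = \<bar>- (1 / ?n)\<bar> *\<^sub>R (\<integral>y. (?n * exp (- (?n * (t - (t + - (1 / ?n) * y)))\<^sup>2 / 2)) *\<^sub>R
        f (t + - (1 / ?n) * y) \<partial>lborel)"
      by (rule lborel_integral_real_affine) simp
    also have "\<dots> = (\<integral>y. (1 / ?n) *\<^sub>R ((?n * exp (- (?n * (t - (t + - (1 / ?n) * y)))\<^sup>2 / 2)) *\<^sub>R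
        f (t + - (1 / ?n) * y)) \<partial>lborel)"
    proof -
      have "\<bar>- (1 / ?n)\<bar> = 1 / ?n" by simp
      then show ?thesis unfolding integral_scaleR_right by (simp only:)
    qed
    also have "\<dots> = (\<integral>y. (sqrt (2 * pi) * ?\<phi> y) *\<^sub>R f (t - y / ?n) \<partial>lborel)"
      by (intro Bochner_Integration.integral_cong refl) (simp add: std_normal_density_def)
    finally show ?thesis .
  qed
  have lim2: "A \<longlonglongrightarrow> (\<integral>y. (sqrt (2 * pi) * ?\<phi> y) *\<^sub>R f t \<partial>lborel)"
    unfolding A_eq
  proof (rule integral_dominated_convergence)
    show "integrable lborel (\<lambda>y. sqrt (2 * pi) * ?\<phi> y * B)"
      by (intro integrable_mult_left integrable_mult_right) (auto intro: integrable_normal_density)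
    show "AE y in lborel. (\<lambda>n. (sqrt (2 * pi) * ?\<phi> y) *\<^sub>R f (t - y / real (Suc n)))
        \<longlonglongrightarrow> (sqrt (2 * pi) * ?\<phi> y) *\<^sub>R f t"
    proof (rule AE_I2, rule tendsto_scaleR[OF tendsto_const])
      fix y :: real
      have "(\<lambda>n. t - y / real (Suc n)) \<longlonglongrightarrow> t" by real_asymp
      then show "(\<lambda>n. f (t - y / real (Suc n))) \<longlonglongrightarrow> f t"
        using cont by (intro isCont_tendsto_compose[of t f]) (auto simp: continuous_on_eq_continuous_at)
    qed
    show "AE y in lborel. norm ((sqrt (2 * pi) * ?\<phi> y) *\<^sub>R f (t - y / real (Suc n)))
        \<le> sqrt (2 * pi) * ?\<phi> y * B" for n
      using bnd by (auto simp: abs_mult abs_of_nonneg normal_density_nonneg intro!: AE_I2 mult_left_mono)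
  qed measurable
  have "(\<integral>y. (sqrt (2 * pi) * ?\<phi> y) *\<^sub>R f t \<partial>lborel) = sqrt (2 * pi) *\<^sub>R f t"
    using integral_normal_density[of 1 0] integrable_normal_density[of 1 0] by simp
  then have "sqrt (2 * pi) *\<^sub>R f t = (1 / sqrt (2 * pi)) *\<^sub>R (\<integral>\<omega>. iexp (\<omega> * t) * F \<omega> \<partial>lborel)"
    using LIMSEQ_unique[OF lim1 lim2] by simp
  then have "sqrt (2 * pi) *\<^sub>R (sqrt (2 * pi) *\<^sub>R f t) = (\<integral>\<omega>. iexp (\<omega> * t) * F \<omega> \<partial>lborel)"
    by simp
  then show ?thesis by (simp add: scaleR_conv_of_real mult.assoc[symmetric] of_real_mult[symmetric] del: of_real_mult)
qed

section \<open>Exponential decay of the fundamental solution\<close>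

text \<open>On the convex half-plane \<open>h\<close> has a primitive \<open>Q\<close>, so truncated
  integrals over both lines are differences of \<open>Q\<close>. They differ by the increments of
  \<open>Q\<close> along two horizontal segments, which vanish like
  \<open>1 / (1 + n\<^sup>2)\<close>.\<close>

lemma vertical_line_shift:
  fixes h :: "complex \<Rightarrow> complex"
  assumes hol: "h holomorphic_on {z. Re z > a}" and ab: "a < b" "b \<le> c"
    and bnd: "\<And>z. b \<le> Re z \<Longrightarrow> Re z \<le> c \<Longrightarrow> cmod (h z) \<le> C / (1 + (Im z)\<^sup>2)" and C: "C \<ge> 0"
  shows "(\<integral>\<omega>. h (Complex c \<omega>) \<partial>lborel) = (\<integral>\<omega>. h (Complex b \<omega>) \<partial>lborel)"
proof -
  let ?S = "{z. Re z > a}"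
  have op: "open ?S" "convex ?S" by (auto intro: open_halfspace_Re_gt convex_halfspace_Re_gt)
  then obtain Q where "\<And>z. z \<in> ?S \<Longrightarrow> (Q has_field_derivative h z) (at z within ?S)"
    using holomorphic_convex_primitive'[OF op(2,1) hol] by blast
  then have Q: "(Q has_field_derivative h z) (at z)" if "Re z > a" for z
    using op(1) that at_within_open[of z ?S] by (metis mem_Collect_eq)
  have hc: "continuous_on ?S h" using hol by (rule holomorphic_on_imp_continuous_on)
  have cont: "continuous_on UNIV (\<lambda>\<omega>. h (Complex s \<omega>))" if "b \<le> s" for s
    by (rule continuous_on_compose2[OF hc]) (use that ab in \<open>auto intro!: continuous_intros simp: Complex_eq\<close>)
  have int: "integrable lborel (\<lambda>\<omega>. h (Complex s \<omega>))" if "b \<le> s" "s \<le> c" for s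
  proof (rule Bochner_Integration.integrable_bound)
    show "integrable lborel (\<lambda>\<omega>. C * inverse (1 + \<omega>\<^sup>2))"
      by (intro integrable_mult_right integrable_inverse_1_plus_square_UNIV)
    show "(\<lambda>\<omega>. h (Complex s \<omega>)) \<in> borel_measurable lborel"
      using borel_measurable_continuous_onI[OF cont[OF that(1)]] by simp
    show "AE \<omega> in lborel. norm (h (Complex s \<omega>)) \<le> norm (C * inverse (1 + \<omega>\<^sup>2))"
      using bnd[of "Complex s _"] that C by (auto simp: divide_inverse abs_mult intro!: AE_I2)
  qed
  define I where "I s n = (\<integral>\<omega>. indicator {- real n..real n} \<omega> *\<^sub>R h (Complex s \<omega>) \<partial>lborel)" for s n
  have lim: "I s \<longlonglongrightarrow> (\<integral>\<omega>. h (Complex s \<omega>) \<partial>lborel)" if "b \<le> s" "s \<le> c" for s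
    unfolding I_def
  proof (rule integral_dominated_convergence[OF _ _ integrable_norm[OF int[OF that]]])
    show "AE \<omega> in lborel. (\<lambda>n. indicator {- real n..real n} \<omega> *\<^sub>R h (Complex s \<omega>)) \<longlonglongrightarrow> h (Complex s \<omega>)"
    proof (rule AE_I2)
      fix \<omega> :: real
      obtain N where N: "\<bar>\<omega>\<bar> \<le> real N" using real_arch_simple by blast
      show "(\<lambda>n. indicator {- real n..real n} \<omega> *\<^sub>R h (Complex s \<omega>)) \<longlonglongrightarrow> h (Complex s \<omega>)"
        by (rule tendsto_eventually, rule eventually_sequentiallyI[of N])
          (use N in \<open>auto simp: indicator_def abs_le_iff\<close>)
    qed
  qed (use int[OF that] in \<open>auto simp: indicator_def\<close>)
  have I: "\<i> * I s n = Q (Complex s (real n)) - Q (Complex s (- real n))" if "b \<le> s" for s n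
  proof -
    have "(\<integral>\<omega>. indicator {- real n..real n} \<omega> *\<^sub>R (\<i> * h (Complex s \<omega>)) \<partial>lborel)
        = Q (Complex s (real n)) - Q (Complex s (- real n))"
    proof (rule integral_FTC_atLeastAtMost)
      fix \<omega> :: real
      have "((\<lambda>\<omega>. Complex s \<omega>) has_vector_derivative \<i>) (at \<omega> within {- real n..real n})"
        unfolding Complex_eq by (auto intro!: derivative_eq_intros)
      moreover have "(Q has_field_derivative h (Complex s \<omega>)) (at (Complex s \<omega>))"
        using Q ab that by simp
      ultimately show "((\<lambda>\<omega>. Q (Complex s \<omega>)) has_vector_derivative \<i> * h (Complex s \<omega>))
          (at \<omega> within {- real n..real n})"
        using field_vector_diff_chain_within[of "\<lambda>\<omega>. Complex s \<omega>" \<i> \<omega> _ Q "h (Complex s \<omega>)"]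
        by (simp add: o_def has_field_derivative_at_within)
    qed (auto intro!: continuous_intros continuous_on_subset[OF cont[OF that]])
    then show ?thesis by (simp add: I_def mult_scaleR_right[symmetric] del: mult_scaleR_right)
  qed
  have Qb: "cmod (Q (Complex c y) - Q (Complex b y)) \<le> C / (1 + y\<^sup>2) * (c - b)" for y
  proof -
    let ?T = "closed_segment (Complex b y) (Complex c y)"
    have T: "b \<le> Re z \<and> Re z \<le> c \<and> Im z = y" if "z \<in> ?T" for z
    proof -
      obtain u where u: "0 \<le> u" "u \<le> 1" "z = (1 - u) *\<^sub>R Complex b y + u *\<^sub>R Complex c y"
        using \<open>z \<in> ?T\<close> by (auto simp: closed_segment_def)
      have "Re z = b + u * (c - b)" "Im z = y" by (auto simp: u(3) algebra_simps)
      moreover have "0 \<le> u * (c - b)" "u * (c - b) \<le> 1 * (c - b)"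
        using u ab mult_right_mono[of u 1 "c - b"] by auto
      ultimately show ?thesis by auto
    qed
    have "cmod (Q (Complex c y) - Q (Complex b y)) \<le> C / (1 + y\<^sup>2) * cmod (Complex c y - Complex b y)"
    proof (rule field_differentiable_bound[of ?T Q h])
      show "(Q has_field_derivative h z) (at z within ?T)" if "z \<in> ?T" for z
        using Q T[OF that] ab by (auto intro: has_field_derivative_at_within)
      show "cmod (h z) \<le> C / (1 + y\<^sup>2)" if "z \<in> ?T" for z
        using bnd[of z] T[OF that] by auto
    qed auto
    also have "Complex c y - Complex b y = of_real (c - b)" by (simp add: complex_eq_iff)
    finally show ?thesis using ab unfolding norm_of_real by simp
  qed
  have "(\<lambda>n. \<i> * (I c n - I b n)) \<longlonglongrightarrow> 0"
  proof (rule tendsto_norm_zero_cancel, rule tendsto_sandwich[OF _ _ tendsto_const])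
    have "cmod (\<i> * (I c n - I b n)) \<le> 2 * (C * (c - b) / (1 + (real n)\<^sup>2))" for n
    proof -
      have "\<i> * (I c n - I b n) = (Q (Complex c (real n)) - Q (Complex b (real n)))
          - (Q (Complex c (- real n)) - Q (Complex b (- real n)))"
        using I[of c n] I[of b n] ab by (simp add: algebra_simps)
      then show ?thesis
        using Qb[of "real n"] Qb[of "- real n"]
          norm_triangle_ineq4[of "Q (Complex c (real n)) - Q (Complex b (real n))"
            "Q (Complex c (- real n)) - Q (Complex b (- real n))"]
        by simp
    qed
    then show "\<forall>\<^sub>F n in sequentially. cmod (\<i> * (I c n - I b n)) \<le> 2 * (C * (c - b) / (1 + (real n)\<^sup>2))"
      by simp
    show "(\<lambda>n. 2 * (C * (c - b) / (1 + (real n)\<^sup>2))) \<longlonglongrightarrow> 0" by real_asymp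
  qed simp
  moreover have "(\<lambda>n. \<i> * (I c n - I b n)) \<longlonglongrightarrow>
      \<i> * ((\<integral>\<omega>. h (Complex c \<omega>) \<partial>lborel) - (\<integral>\<omega>. h (Complex b \<omega>) \<partial>lborel))"
    using ab by (intro tendsto_intros lim) auto
  ultimately show ?thesis using LIMSEQ_unique by fastforce
qed

context fundamental_solution
begin

text \<open>Induction over unit intervals, inserting the bound into the fixed-point equation. The
  rate \<open>L = 1 + c\<close> satisfies \<open>L + c \<le> L * L\<close>, which is what reproduces
  the constant 1 in front of the exponential.\<close>

lemma g_exp_bound:
  assumes "\<eta> \<ge> 0" "c \<ge> 0" shows "\<bar>g t\<bar> \<le> exp ((1 + c) * t)"
proof -
  define L where "L = 1 + c"
  have L: "L \<ge> 1" "L > 0" using assms by (auto simp: L_def)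
  have expint: "((\<lambda>s. exp (L * s)) has_integral (exp (L * s) - 1) / L) {0..s}" if "s \<ge> 0" for s
  proof -
    have "((\<lambda>s. exp (L * s) / L) has_real_derivative exp (L * s)) (at s within {0..})" for s
      using L by (auto intro!: derivative_eq_intros)
    from integral_eq_of_derivative_Ici[OF this that] show ?thesis by (simp add: diff_divide_distrib)
  qed
  have "\<bar>g t\<bar> \<le> exp (L * t)" if "t \<le> real n" for n t
    using that
  proof (induction n arbitrary: t)
    case 0 then show ?case by (simp add: g_zero)
  next
    case (Suc n)
    show ?case
    proof (cases "t \<le> 0")
      case True then show ?thesis by (simp add: g_zero)
    next
      case False
      let ?h = "\<lambda>s. 1 - c * integral {0..s} (\<lambda>r. g (r - 1))"
      have h: "\<bar>?h s\<bar> \<le> (1 + c / L) * exp (L * s)" if s: "0 \<le> s" "s \<le> t" for s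
      proof -
        have "norm (integral {0..s} (\<lambda>r. g (r - 1))) \<le> integral {0..s} (\<lambda>r. exp (L * r))"
        proof (rule Henstock_Kurzweil_Integration.integral_norm_bound_integral)
          fix r assume r: "r \<in> {0..s}"
          have "\<bar>g (r - 1)\<bar> \<le> exp (L * (r - 1))" using Suc r s by auto
          also have "\<dots> \<le> exp (L * r)" using L by simp
          finally show "norm (g (r - 1)) \<le> exp (L * r)" by simp
        qed (auto intro!: integrable_continuous_real continuous_intros g_shift_cont)
        also have "\<dots> = (exp (L * s) - 1) / L" using expint[OF s(1)] by (rule integral_unique)
        also have "\<dots> \<le> exp (L * s) / L" using L by (simp add: divide_right_mono)
        finally have "c * \<bar>integral {0..s} (\<lambda>r. g (r - 1))\<bar> \<le> c * (exp (L * s) / L)"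
          using assms by (intro mult_left_mono) auto
        moreover have "1 \<le> exp (L * s)" using L s by simp
        moreover have "\<bar>?h s\<bar> \<le> 1 + c * \<bar>integral {0..s} (\<lambda>r. g (r - 1))\<bar>"
          using assms abs_triangle_ineq4[of 1 "c * integral {0..s} (\<lambda>r. g (r - 1))"]
          by (simp add: abs_mult)
        moreover have "(1 + c / L) * exp (L * s) = exp (L * s) + c * (exp (L * s) / L)"
          by (simp add: distrib_right)
        ultimately show ?thesis by linarith
      qed
      have cont: "continuous_on {0..t} (\<lambda>s. exp (\<eta> * s) * ?h s)"
        by (intro continuous_intros continuous_on_subset[OF continuous_on_integral_Ici[OF g_shift_cont]]) auto
      \<comment> \<open>\<open>exp (\<eta> * s)\<close> is replaced by its largest value, to be
        cancelled by the outer factor \<open>exp (- (\<eta> * t))\<close>.\<close>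
      have "norm (integral {0..t} (\<lambda>s. exp (\<eta> * s) * ?h s))
          \<le> integral {0..t} (\<lambda>s. exp (\<eta> * t) * ((1 + c / L) * exp (L * s)))"
      proof (rule Henstock_Kurzweil_Integration.integral_norm_bound_integral)
        fix s assume s: "s \<in> {0..t}"
        show "norm (exp (\<eta> * s) * ?h s) \<le> exp (\<eta> * t) * ((1 + c / L) * exp (L * s))"
          unfolding real_norm_def abs_mult abs_exp_cancel
          using h[of s] s assms by (intro mult_mono) (auto intro!: mult_left_mono)
      qed (auto intro!: integrable_continuous_real cont continuous_intros)
      also have "\<dots> = exp (\<eta> * t) * ((1 + c / L) * ((exp (L * t) - 1) / L))"
        by (intro integral_unique has_integral_mult_right expint) (use False in auto)
      also have "\<dots> \<le> exp (\<eta> * t) * exp (L * t)"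
      proof (rule mult_left_mono)
        have "(1 + c / L) * ((exp (L * t) - 1) / L) \<le> (1 + c / L) * (exp (L * t) / L)"
          using assms L by (intro mult_left_mono divide_right_mono) auto
        also have "\<dots> = (L + c) / (L * L) * exp (L * t)" using L by (simp add: field_simps)
        also have "\<dots> \<le> 1 * exp (L * t)"
        proof (rule mult_right_mono)
          have "L + c \<le> L * L" using assms by (simp add: L_def algebra_simps)
          then show "(L + c) / (L * L) \<le> 1" using L by simp
        qed simp
        finally show "(1 + c / L) * ((exp (L * t) - 1) / L) \<le> exp (L * t)" by simp
      qed simp
      finally have "exp (- (\<eta> * t)) * \<bar>integral {0..t} (\<lambda>s. exp (\<eta> * s) * ?h s)\<bar>
          \<le> exp (- (\<eta> * t)) * (exp (\<eta> * t) * exp (L * t))"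
        by (intro mult_left_mono) auto
      also have "\<dots> = exp (L * t)" by (simp add: mult.assoc[symmetric] mult_exp_exp)
      finally show ?thesis
        using g_step[of t] False by (simp add: delay_step_def abs_mult)
    qed
  qed
  then show ?thesis using real_arch_simple[of t] unfolding L_def by blast
qed

lemma k_exp_bound:
  assumes "\<eta> \<ge> 0" "c \<ge> 0" "t \<ge> 0" shows "\<bar>k t\<bar> \<le> (1 + \<eta> + c) * exp ((1 + c) * t)"
proof -
  let ?E = "exp ((1 + c) * t)"
  have E: "1 \<le> ?E" using assms by simp
  have expint: "((\<lambda>s. exp ((1 + c) * s)) has_integral (?E - 1) / (1 + c)) {0..t}"
  proof -
    have "((\<lambda>s. exp ((1 + c) * s) / (1 + c)) has_real_derivative exp ((1 + c) * s)) (at s within {0..})" for s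
      using assms by (auto intro!: derivative_eq_intros)
    from integral_eq_of_derivative_Ici[OF this assms(3)] show ?thesis by (simp add: diff_divide_distrib)
  qed
  have "norm (integral {0..t} (\<lambda>r. g (r - 1))) \<le> integral {0..t} (\<lambda>r. exp ((1 + c) * r))"
  proof (rule Henstock_Kurzweil_Integration.integral_norm_bound_integral)
    fix r assume r: "r \<in> {0..t}"
    have "\<bar>g (r - 1)\<bar> \<le> exp ((1 + c) * (r - 1))" using g_exp_bound assms by blast
    also have "\<dots> \<le> exp ((1 + c) * r)" using assms by (simp add: mult_left_mono)
    finally show "norm (g (r - 1)) \<le> exp ((1 + c) * r)" by simp
  qed (auto intro!: integrable_continuous_real continuous_intros g_shift_cont)
  also have "\<dots> = (?E - 1) / (1 + c)" using expint by (rule integral_unique)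
  also have "\<dots> \<le> ?E / 1" using assms E by (intro frac_le) auto
  finally have "c * \<bar>integral {0..t} (\<lambda>r. g (r - 1))\<bar> \<le> c * ?E"
    using assms by (intro mult_left_mono) auto
  moreover have "\<eta> * \<bar>g t\<bar> \<le> \<eta> * ?E" using g_exp_bound[of t] assms by (intro mult_left_mono) auto
  moreover have "\<bar>k t\<bar> \<le> 1 + \<eta> * \<bar>g t\<bar> + c * \<bar>integral {0..t} (\<lambda>r. g (r - 1))\<bar>"
    using k_eq[of t] assms by (simp add: abs_mult[of \<eta>, simplified] abs_le_iff)
      (smt (verit) abs_ge_self abs_ge_minus_self mult_left_mono mult_minus_right)
  ultimately show ?thesis using E unfolding distrib_right[of _ _ ?E] by linarith
qed

text \<open>The Laplace transform on the line \<open>Re z = c + 2\<close>, to the right of the growth rate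
  \<open>1 + c\<close> of \<open>g_exp_bound\<close>.\<close>

lemma g_laplace:
  assumes pos: "\<eta> \<ge> 0" "c \<ge> 0" and z: "Re z = c + 2"
  shows "integrable lborel (\<lambda>t. exp (- z * of_real t) * of_real (g t))"
    and "char_fun \<eta> c z * (\<integral>t. exp (- z * of_real t) * of_real (g t) \<partial>lborel) = 1"
proof -
  let ?F = "\<lambda>t. exp (- z * of_real t) * of_real (g t) :: complex"
  have nE: "cmod (exp (- z * of_real t)) = exp (- (c + 2) * t)" for t
    unfolding norm_exp_eq_Re by (simp add: z algebra_simps)
  have Fb: "cmod (?F t) \<le> exp (- t)" "t < 0 \<Longrightarrow> ?F t = 0" for t
  proof -
    have "cmod (?F t) \<le> exp (- (c + 2) * t) * exp ((1 + c) * t)"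
      unfolding norm_mult nE using g_exp_bound[OF pos, of t] by (intro mult_left_mono) auto
    also have "\<dots> = exp (- t)" by (simp add: mult_exp_exp algebra_simps)
    finally show "cmod (?F t) \<le> exp (- t)" .
  qed (simp add: g_zero)
  \<comment> \<open>The one-sided exponential bound is traded for a multiple of
    \<open>inverse (1 + t\<^sup>2)\<close>, whose integrability over the whole line is at
    hand.\<close>
  have Fb2: "cmod (?F t) \<le> 2 * inverse (1 + t\<^sup>2)" for t
  proof (cases "t < 0")
    case False
    have "1 + t\<^sup>2 \<le> 2 * exp t" using exp_lower_Taylor_quadratic[of t] False by simp
    then have "exp (- t) \<le> 2 * inverse (1 + t\<^sup>2)"
      by (simp add: exp_minus field_simps add_pos_nonneg)
    then show ?thesis using Fb(1)[of t] by linarith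
  next
    case True
    have "0 \<le> inverse (1 + t\<^sup>2)" by simp
    then show ?thesis unfolding Fb(2)[OF True] by simp
  qed
  have Fc: "continuous_on UNIV ?F"
    by (intro continuous_intros continuous_on_compose2[OF continuous_on_of_real_id] g_cont) auto
  have Fc1: "continuous_on UNIV (\<lambda>t. ?F (-1 + 1 * t))"
    by (rule continuous_on_compose2[OF Fc]) (auto intro!: continuous_intros)
  show intF: "integrable lborel ?F"
  proof (rule Bochner_Integration.integrable_bound)
    show "integrable lborel (\<lambda>t::real. 2 * inverse (1 + t\<^sup>2))"
      by (intro integrable_mult_right integrable_inverse_1_plus_square_UNIV)
    show "?F \<in> borel_measurable lborel" using borel_measurable_continuous_onI[OF Fc] by simp
    show "AE t in lborel. norm (?F t) \<le> norm (2 * inverse (1 + t\<^sup>2))"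
      using Fb2 by (intro AE_I2) (simp add: add_pos_nonneg)
  qed
  let ?G = "\<integral>t. ?F t \<partial>lborel"
  \<comment> \<open>Its integral is \<open>char_fun \<eta> c z * ?G\<close>. The argument
    \<open>t - 1\<close> is written \<open>-1 + 1 * t\<close> to match the affine substitution rules
    for \<open>lborel\<close>.\<close>
  let ?\<Phi> = "\<lambda>t. of_real c * exp (- z) * ?F (-1 + 1 * t) + z * (z + of_real \<eta>) * ?F t"
  have int1: "integrable lborel (\<lambda>t. ?F (-1 + 1 * t))"
    by (rule lborel_integrable_real_affine[OF intF]) simp
  have I1: "(\<integral>t. ?F (-1 + 1 * t) \<partial>lborel) = ?G"
    using lborel_integral_real_affine[of 1 ?F "-1"] by simp
  have int\<Phi>: "integrable lborel ?\<Phi>"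
    by (intro Bochner_Integration.integrable_add integrable_mult_right int1 intF)
  have I\<Phi>: "(\<integral>t. ?\<Phi> t \<partial>lborel) = char_fun \<eta> c z * ?G"
    using int1 intF I1 by (simp add: Bochner_Integration.integral_add char_fun_def power2_eq_square algebra_simps)
  \<comment> \<open>On \<open>t \<ge> 0\<close> the function \<open>- H\<close> is an antiderivative
    of \<open>?\<Phi>\<close>; the value 1 of the transform identity is
    \<open>H 0 = k 0\<close>.\<close>
  define H where "H t = exp (- z * of_real t) * (of_real (k t) + (z + of_real \<eta>) * of_real (g t))" for t
  have FTC: "(\<integral>t. indicator {..T} t *\<^sub>R ?\<Phi> t \<partial>lborel) = 1 - H T" if T: "T \<ge> 0" for T
  proof -
    have "(\<integral>t. indicator {..T} t *\<^sub>R ?\<Phi> t \<partial>lborel) = (\<integral>t. indicator {0..T} t *\<^sub>R ?\<Phi> t \<partial>lborel)"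
      by (intro Bochner_Integration.integral_cong refl) (auto simp: indicator_def g_zero)
    also have "\<dots> = - H T - (- H 0)"
    proof (rule integral_FTC_atLeastAtMost[OF T])
      fix t assume t: "0 \<le> t" "t \<le> T"
      have e: "((\<lambda>t. exp (- z * of_real t)) has_vector_derivative - z * exp (- z * of_real t)) (at t within {0..T})"
        by (rule has_vector_derivative_real_field[of "\<lambda>w. exp (- z * w)"]) (auto intro!: derivative_eq_intros)
      have kD: "((\<lambda>t. complex_of_real (k t)) has_vector_derivative of_real (k' t)) (at t within {0..T})"
        by (intro has_vector_derivative_of_real has_real_derivative_iff_has_vector_derivative[THEN iffD1]
            DERIV_subset[OF k_DERIV[OF t(1)]]) auto
      have gD: "((\<lambda>t. complex_of_real (g t)) has_vector_derivative of_real (k t)) (at t within {0..T})"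
        by (intro has_vector_derivative_of_real has_real_derivative_iff_has_vector_derivative[THEN iffD1]
            DERIV_subset[OF g_DERIV[OF t(1)]]) auto
      have inner: "((\<lambda>t. of_real (k t) + (z + of_real \<eta>) * of_real (g t)) has_vector_derivative
          of_real (k' t) + (z + of_real \<eta>) * of_real (k t)) (at t within {0..T})"
        by (intro has_vector_derivative_add has_vector_derivative_mult_right kD gD)
      have "((\<lambda>t. - H t) has_vector_derivative - (exp (- z * of_real t) * (of_real (k' t) + (z + of_real \<eta>) * of_real (k t))
          + (- z * exp (- z * of_real t)) * (of_real (k t) + (z + of_real \<eta>) * of_real (g t)))) (at t within {0..T})"
        unfolding H_def by (intro has_vector_derivative_minus has_vector_derivative_mult e inner)
      also have "- (exp (- z * of_real t) * (of_real (k' t) + (z + of_real \<eta>) * of_real (k t))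
          + (- z * exp (- z * of_real t)) * (of_real (k t) + (z + of_real \<eta>) * of_real (g t))) = ?\<Phi> t"
      proof -
        have g1: "-1 + 1 * t = t - 1" by simp
        have E: "exp (- z * of_real t) = exp (- z) * exp (- z * complex_of_real (t - 1))"
          unfolding mult_exp_exp by (rule arg_cong[of _ _ exp]) (simp add: algebra_simps)
        have P: "of_real c * exp (- z) * ?F (-1 + 1 * t) = of_real c * exp (- z * of_real t) * of_real (g (t - 1))"
          unfolding g1 E mult.assoc ..
        have alg: "- (e * ((- h * k - c * g1) + (z + h) * k) + (- z * e) * (k + (z + h) * g))
            = c * e * g1 + z * (z + h) * (e * g)" for e h k c g1 g :: complex
          by (simp add: algebra_simps)
        show ?thesis unfolding P k'_def of_real_diff of_real_mult of_real_minus by (rule alg)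
      qed
      finally show "((\<lambda>t. - H t) has_vector_derivative ?\<Phi> t) (at t within {0..T})" .
    next
      show "continuous_on {0..T} ?\<Phi>"
        by (rule continuous_on_subset[OF _ subset_UNIV])
          (rule continuous_on_add[OF continuous_on_mult_left[OF Fc1] continuous_on_mult_left[OF Fc]])
    qed
    also have "\<dots> = 1 - H T" by (simp add: H_def k_0 g_zero)
    finally show ?thesis .
  qed
  have Hlim: "(H \<longlongrightarrow> 0) at_top"
  proof (rule tendsto_norm_zero_cancel, rule tendsto_sandwich[OF _ _ tendsto_const])
    let ?C = "1 + \<eta> + c + cmod (z + of_real \<eta>)"
    show "\<forall>\<^sub>F t in at_top. norm (H t) \<le> ?C * exp (- t)"
      using eventually_ge_at_top[of "0::real"]
    proof eventually_elim
      case (elim t)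
      have "cmod (of_real (k t) + (z + of_real \<eta>) * of_real (g t)) \<le> \<bar>k t\<bar> + cmod (z + of_real \<eta>) * \<bar>g t\<bar>"
        by (rule order_trans[OF norm_triangle_ineq]) (simp add: norm_mult)
      also have "\<dots> \<le> (1 + \<eta> + c) * exp ((1 + c) * t) + cmod (z + of_real \<eta>) * exp ((1 + c) * t)"
        using k_exp_bound[OF pos elim] g_exp_bound[OF pos, of t] by (intro add_mono mult_left_mono) auto
      also have "\<dots> = ?C * exp ((1 + c) * t)" by (simp add: algebra_simps)
      finally have "norm (H t) \<le> exp (- (c + 2) * t) * (?C * exp ((1 + c) * t))"
        unfolding H_def norm_mult nE by (intro mult_left_mono) auto
      also have "\<dots> = ?C * (exp (- (c + 2) * t) * exp ((1 + c) * t))" by (simp only: mult_ac)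
      also have "exp (- (c + 2) * t) * exp ((1 + c) * t) = exp (- t)" by (simp add: mult_exp_exp algebra_simps)
      finally show ?case .
    qed
    show "((\<lambda>t. ?C * exp (- t)) \<longlongrightarrow> 0) at_top"
      by (intro tendsto_mult_right_zero) real_asymp
  qed simp
  have "((\<lambda>T. \<integral>t. indicator {..T} t *\<^sub>R ?\<Phi> t \<partial>lborel) \<longlongrightarrow> char_fun \<eta> c z * ?G) at_top"
    using tendsto_integral_at_top[OF _ int\<Phi>] I\<Phi> by simp
  moreover have "((\<lambda>T. \<integral>t. indicator {..T} t *\<^sub>R ?\<Phi> t \<partial>lborel) \<longlongrightarrow> 1) at_top"
  proof -
    have "((\<lambda>T. 1 - H T) \<longlongrightarrow> 1 - 0) at_top" by (intro tendsto_intros Hlim)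
    moreover have "\<forall>\<^sub>F T in at_top. 1 - H T = (\<integral>t. indicator {..T} t *\<^sub>R ?\<Phi> t \<partial>lborel)"
      using eventually_ge_at_top[of "0::real"] by eventually_elim (rule FTC[symmetric])
    ultimately show ?thesis using Lim_transform_eventually by fastforce
  qed
  ultimately show "char_fun \<eta> c z * ?G = 1"
    by (rule tendsto_unique[rotated]) simp
qed

text \<open>The margin bounds \<open>1 / char_fun\<close> by a multiple of
  \<open>1 / (1 + (Im z)\<^sup>2)\<close>, so the inversion on \<open>Re z = c + 2\<close> and the
  shift to \<open>Re z = - \<delta>\<close> involve only absolutely convergent integrals. On the new
  line \<open>exp (z * t)\<close> has modulus \<open>exp (- \<delta> * t)\<close>.\<close>

lemma g_decay:
  assumes pos: "\<eta> \<ge> 0" "c \<ge> 0" and e: "\<epsilon> > 0" "B > 0"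
    "\<And>z. Re z \<ge> - \<epsilon> \<Longrightarrow> cmod (char_fun \<eta> c z) \<ge> B * (1 + (cmod z)\<^sup>2)"
    and d: "0 < \<delta>" "\<delta> < \<epsilon>"
  obtains C where "C \<ge> 0" "\<And>t. \<bar>g t\<bar> \<le> C * exp (- \<delta> * t)"
proof -
  let ?p = "char_fun \<eta> c" and ?\<sigma> = "c + 2"
  have pb: "cmod (?p z) \<ge> B * (1 + (Im z)\<^sup>2)" if "Re z \<ge> - \<epsilon>" for z
  proof -
    have "(Im z)\<^sup>2 \<le> (cmod z)\<^sup>2" unfolding cmod_power2 by simp
    then have "B * (1 + (Im z)\<^sup>2) \<le> B * (1 + (cmod z)\<^sup>2)" using e by (intro mult_left_mono) auto
    then show ?thesis using e(3)[OF that] by linarith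
  qed
  have p0: "0 < B * (1 + y\<^sup>2)" for y using e by (simp add: add_pos_nonneg)
  have pnz: "?p z \<noteq> 0" if "Re z \<ge> - \<epsilon>" for z
    using pb[OF that] p0[of "Im z"] by auto
  have pinv: "cmod (1 / ?p z) \<le> (1 / B) / (1 + (Im z)\<^sup>2)" if "Re z \<ge> - \<epsilon>" for z
    using frac_le[of 1 1 "B * (1 + (Im z)\<^sup>2)" "cmod (?p z)"] pb[OF that] p0[of "Im z"]
    by (simp add: norm_divide)
  have hol: "(\<lambda>z. exp (z * of_real t) / ?p z) holomorphic_on {z. Re z > - \<epsilon>}" for t
    using pnz unfolding char_fun_def by (intro holomorphic_intros) (auto simp: char_fun_def)
  have eb: "cmod (exp (z * of_real t) / ?p z) \<le> exp (Re z * t) * ((1 / B) / (1 + (Im z)\<^sup>2))"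
    if "Re z \<ge> - \<epsilon>" for z t
    using mult_left_mono[OF pinv[OF that], of "exp (Re z * t)"] by (simp add: norm_divide)
  have shift: "(\<integral>\<omega>. exp (Complex ?\<sigma> \<omega> * of_real t) / ?p (Complex ?\<sigma> \<omega>) \<partial>lborel)
      = (\<integral>\<omega>. exp (Complex (- \<delta>) \<omega> * of_real t) / ?p (Complex (- \<delta>) \<omega>) \<partial>lborel)" for t
  proof (rule vertical_line_shift[OF hol[of t]])
    show "cmod (exp (z * of_real t) / ?p z) \<le> (exp ((\<delta> + ?\<sigma>) * \<bar>t\<bar>) / B) / (1 + (Im z)\<^sup>2)"
      if z: "- \<delta> \<le> Re z" "Re z \<le> ?\<sigma>" for z
    proof -
      have "Re z * t \<le> \<bar>Re z\<bar> * \<bar>t\<bar>" by (simp add: abs_mult[symmetric])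
      also have "\<dots> \<le> (\<delta> + ?\<sigma>) * \<bar>t\<bar>" using z d pos by (intro mult_right_mono) auto
      finally have "exp (Re z * t) * ((1 / B) / (1 + (Im z)\<^sup>2)) \<le> exp ((\<delta> + ?\<sigma>) * \<bar>t\<bar>) * ((1 / B) / (1 + (Im z)\<^sup>2))"
        using e by (intro mult_right_mono) auto
      then show ?thesis using eb[of z t] z d by simp
    qed
  qed (use d e pos in auto)
  \<comment> \<open>The damping makes the function bounded and integrable; its Fourier transform is
    the Laplace transform of \<open>g\<close> on the line \<open>Re z = ?\<sigma>\<close>.\<close>
  let ?f = "\<lambda>t. complex_of_real (exp (- ?\<sigma> * t) * g t)"
  have fF: "exp (- Complex ?\<sigma> \<omega> * of_real t) * of_real (g t) = iexp (- (\<omega> * t)) * ?f t" for \<omega> t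
    unfolding of_real_mult exp_of_real[symmetric] mult.assoc[symmetric] mult_exp_exp
    by (rule arg_cong[of _ _ "\<lambda>u. exp u * of_real (g t)"])
      (simp add: complex_eq_iff algebra_simps)
  have rep: "2 * pi * ?f t = (\<integral>\<omega>. iexp (\<omega> * t) * (1 / ?p (Complex ?\<sigma> \<omega>)) \<partial>lborel)" for t
  proof (rule fourier_inversion)
    show "continuous_on UNIV ?f" by (intro continuous_intros continuous_on_of_real g_cont)
    show "cmod (?f x) \<le> 1" for x
    proof (cases "x \<le> 0")
      case False
      have "exp (- ?\<sigma> * x) * \<bar>g x\<bar> \<le> exp (- ?\<sigma> * x) * exp ((1 + c) * x)"
        using g_exp_bound[OF pos] by (intro mult_left_mono) auto
      also have "\<dots> \<le> 1" using False by (simp add: mult_exp_exp algebra_simps)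
      finally show ?thesis by (simp add: norm_mult)
    qed (simp add: g_zero)
    have "integrable lborel (\<lambda>t. exp (- Complex ?\<sigma> 0 * of_real t) * of_real (g t))"
      by (rule g_laplace(1)[OF pos]) simp
    then show "integrable lborel ?f" unfolding fF by simp
    show "1 / ?p (Complex ?\<sigma> \<omega>) = (\<integral>s. iexp (- (\<omega> * s)) * ?f s \<partial>lborel)" for \<omega>
      using g_laplace(2)[OF pos, of "Complex ?\<sigma> \<omega>"] pnz[of "Complex ?\<sigma> \<omega>"] pos e(1)
      unfolding fF by (simp add: field_simps)
    show "integrable lborel (\<lambda>\<omega>. 1 / ?p (Complex ?\<sigma> \<omega>))"
    proof (rule Bochner_Integration.integrable_bound)
      show "integrable lborel (\<lambda>t::real. 1 / B * inverse (1 + t\<^sup>2))"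
        by (intro integrable_mult_right integrable_inverse_1_plus_square_UNIV)
      have "continuous_on UNIV (\<lambda>\<omega>. 1 / ?p (Complex ?\<sigma> \<omega>))"
        using pnz e pos by (intro continuous_intros continuous_on_compose2[OF continuous_on_char_fun[of UNIV]])
          (auto simp: Complex_eq intro!: continuous_intros)
      then show "(\<lambda>\<omega>. 1 / ?p (Complex ?\<sigma> \<omega>)) \<in> borel_measurable lborel"
        using borel_measurable_continuous_onI by simp
      show "AE \<omega> in lborel. norm (1 / ?p (Complex ?\<sigma> \<omega>)) \<le> norm (1 / B * inverse (1 + \<omega>\<^sup>2))"
        using pinv[of "Complex ?\<sigma> _"] e pos by (intro AE_I2) (simp add: divide_inverse abs_mult)
    qed
  qed
  have g_eq: "2 * pi * complex_of_real (g t) = (\<integral>\<omega>. exp (Complex (- \<delta>) \<omega> * of_real t) / ?p (Complex (- \<delta>) \<omega>) \<partial>lborel)" for t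
  proof -
    have "2 * pi * complex_of_real (g t) = exp (of_real (?\<sigma> * t)) * (2 * pi * ?f t)"
    proof -
      have "exp (?\<sigma> * t) * exp (- ?\<sigma> * t) = 1" by (simp add: mult_exp_exp algebra_simps)
      then have "g t = exp (?\<sigma> * t) * (exp (- ?\<sigma> * t) * g t)" by (simp add: mult.assoc[symmetric])
      then have "complex_of_real (g t) = of_real (exp (?\<sigma> * t)) * ?f t" by (metis of_real_mult)
      then show ?thesis unfolding exp_of_real by simp
    qed
    also have "\<dots> = (\<integral>\<omega>. exp (of_real (?\<sigma> * t)) * (iexp (\<omega> * t) * (1 / ?p (Complex ?\<sigma> \<omega>))) \<partial>lborel)"
      unfolding rep by (rule integral_mult_right_zero[symmetric])
    also have "\<dots> = (\<integral>\<omega>. exp (Complex ?\<sigma> \<omega> * of_real t) / ?p (Complex ?\<sigma> \<omega>) \<partial>lborel)"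
    proof (intro Bochner_Integration.integral_cong refl)
      fix \<omega>
      have "exp (of_real (?\<sigma> * t)) * iexp (\<omega> * t) = exp (Complex ?\<sigma> \<omega> * of_real t)"
        unfolding mult_exp_exp by (rule arg_cong[of _ _ exp]) (simp add: complex_eq_iff)
      then show "exp (of_real (?\<sigma> * t)) * (iexp (\<omega> * t) * (1 / ?p (Complex ?\<sigma> \<omega>)))
          = exp (Complex ?\<sigma> \<omega> * of_real t) / ?p (Complex ?\<sigma> \<omega>)"
        by (simp add: mult.assoc[symmetric])
    qed
    finally show ?thesis unfolding shift .
  qed
  define C where "C = (\<integral>\<omega>. 1 / B * inverse (1 + \<omega>\<^sup>2) \<partial>lborel)"
  have Cint: "integrable lborel (\<lambda>\<omega>::real. 1 / B * inverse (1 + \<omega>\<^sup>2))"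
    by (intro integrable_mult_right integrable_inverse_1_plus_square_UNIV)
  have C0: "C \<ge> 0" unfolding C_def using e by (intro integral_nonneg_AE) auto
  show ?thesis
  proof (rule that[OF C0])
    fix t
    have "cmod (2 * pi * complex_of_real (g t)) \<le> (\<integral>\<omega>. exp (- \<delta> * t) * (1 / B * inverse (1 + \<omega>\<^sup>2)) \<partial>lborel)"
      unfolding g_eq
    proof (rule order_trans[OF integral_norm_bound])
      show "(\<integral>\<omega>. norm (exp (Complex (- \<delta>) \<omega> * of_real t) / ?p (Complex (- \<delta>) \<omega>)) \<partial>lborel)
          \<le> (\<integral>\<omega>. exp (- \<delta> * t) * (1 / B * inverse (1 + \<omega>\<^sup>2)) \<partial>lborel)"
      proof (rule integral_mono_AE')
        show "integrable lborel (\<lambda>\<omega>. exp (- \<delta> * t) * (1 / B * inverse (1 + \<omega>\<^sup>2)))"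
          by (rule integrable_mult_right[OF Cint])
        show "AE \<omega> in lborel. 0 \<le> exp (- \<delta> * t) * (1 / B * inverse (1 + \<omega>\<^sup>2))"
          using e by (intro AE_I2) simp
        show "AE \<omega> in lborel. norm (exp (Complex (- \<delta>) \<omega> * of_real t) / ?p (Complex (- \<delta>) \<omega>))
            \<le> exp (- \<delta> * t) * (1 / B * inverse (1 + \<omega>\<^sup>2))"
          using eb[of "Complex (- \<delta>) _" t] d by (intro AE_I2) (simp add: divide_inverse)
      qed
    qed
    also have "\<dots> = C * exp (- \<delta> * t)" by (simp add: C_def)
    finally have "2 * pi * \<bar>g t\<bar> \<le> C * exp (- \<delta> * t)" by (simp add: norm_mult)
    moreover have "1 * \<bar>g t\<bar> \<le> 2 * pi * \<bar>g t\<bar>" using pi_gt3 by (intro mult_right_mono) auto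
    ultimately show "\<bar>g t\<bar> \<le> C * exp (- \<delta> * t)" by linarith
  qed
qed

text \<open>Only \<open>g\<close> comes from inversion: the transform
  \<open>z / char_fun \<eta> c z\<close> of \<open>k\<close> decays like \<open>1 / cmod z\<close>,
  too slowly to be absolutely integrable. The bound for \<open>k\<close> follows from
  \<open>k' + \<eta> * k = - c * g (t - 1)\<close> with the integrating factor
  \<open>exp (\<eta> * t)\<close>.\<close>

lemma exponential_decay:
  assumes pos: "\<eta> > 0" "c > 0" and nr: "\<And>z. Re z \<ge> 0 \<Longrightarrow> char_fun \<eta> c z \<noteq> 0"
  obtains C \<delta> where "C \<ge> 0" "\<delta> > 0" "\<And>t. \<bar>g t\<bar> \<le> C * exp (- \<delta> * t)" "\<And>t. \<bar>k t\<bar> \<le> C * exp (- \<delta> * t)"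
proof -
  obtain \<epsilon> B where e: "\<epsilon> > 0" "B > 0"
    "\<And>z. Re z \<ge> - \<epsilon> \<Longrightarrow> cmod (char_fun \<eta> c z) \<ge> B * (1 + (cmod z)\<^sup>2)"
  proof (rule char_fun_margin[OF less_imp_le[OF pos(2)], of \<eta>])
    show "char_fun \<eta> c z \<noteq> 0" if "Re z \<ge> 0" for z using nr that .
  qed (rule that)
  \<comment> \<open>\<open>\<delta> < \<epsilon>\<close> is for the shift of the line,
    \<open>\<delta> < \<eta>\<close> for controlling the integral of
    \<open>exp ((\<eta> - \<delta>) * s)\<close> by its upper end.\<close>
  define \<delta> where "\<delta> = min \<epsilon> \<eta> / 2"
  have d: "0 < \<delta>" "\<delta> < \<epsilon>" "\<delta> < \<eta>" using e pos by (auto simp: \<delta>_def min_def)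
  obtain C where C: "C \<ge> 0" "\<And>t. \<bar>g t\<bar> \<le> C * exp (- \<delta> * t)"
  proof (rule g_decay[OF less_imp_le[OF pos(1)] less_imp_le[OF pos(2)] e(1,2)])
    show "B * (1 + (cmod z)\<^sup>2) \<le> cmod (char_fun \<eta> c z)" if "- \<epsilon> \<le> Re z" for z using e(3) that .
  qed (rule d(1) d(2) that; assumption)+
  \<comment> \<open>The summand 1 is \<open>k 0\<close>; the factor \<open>exp \<delta>\<close> pays
    for the delay in \<open>g (s - 1)\<close>.\<close>
  define D where "D = 1 + c * C * exp \<delta> / (\<eta> - \<delta>)"
  have kb: "\<bar>k t\<bar> \<le> D * exp (- \<delta> * t)" if t: "t \<ge> 0" for t
  proof -
    have "((\<lambda>t. exp (\<eta> * t) * k t) has_real_derivative - (c * (exp (\<eta> * s) * g (s - 1)))) (at s within {0..})"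
      if "s \<ge> 0" for s
      using that by (auto intro!: derivative_eq_intros k_DERIV simp: k'_def algebra_simps)
    from integral_eq_of_derivative_Ici[OF this t]
    have "integral {0..t} (\<lambda>s. - (c * (exp (\<eta> * s) * g (s - 1)))) = exp (\<eta> * t) * k t - exp (\<eta> * 0) * k 0"
      by (rule integral_unique)
    then have eq: "exp (\<eta> * t) * k t = 1 + integral {0..t} (\<lambda>s. - (c * (exp (\<eta> * s) * g (s - 1))))"
      by (simp only: k_0 mult_zero_right exp_zero)
    have "norm (integral {0..t} (\<lambda>s. - (c * (exp (\<eta> * s) * g (s - 1)))))
        \<le> integral {0..t} (\<lambda>s. c * C * exp \<delta> * exp ((\<eta> - \<delta>) * s))"
    proof (rule Henstock_Kurzweil_Integration.integral_norm_bound_integral)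
      fix s
      have "norm (- (c * (exp (\<eta> * s) * g (s - 1)))) = c * (exp (\<eta> * s) * \<bar>g (s - 1)\<bar>)"
        using pos by (simp add: abs_mult)
      also have "\<dots> \<le> c * (exp (\<eta> * s) * (C * exp (- \<delta> * (s - 1))))"
        using C(2) pos by (intro mult_left_mono) auto
      also have "\<dots> = c * C * (exp (\<eta> * s) * exp (- \<delta> * (s - 1)))" by (simp only: mult_ac)
      also have "exp (\<eta> * s) * exp (- \<delta> * (s - 1)) = exp \<delta> * exp ((\<eta> - \<delta>) * s)"
        by (simp add: mult_exp_exp algebra_simps)
      finally show "norm (- (c * (exp (\<eta> * s) * g (s - 1)))) \<le> c * C * exp \<delta> * exp ((\<eta> - \<delta>) * s)"
        by (simp only: mult_ac)
    qed (auto intro!: integrable_continuous_real continuous_intros g_shift_cont)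
    also have "\<dots> = c * C * exp \<delta> * ((exp ((\<eta> - \<delta>) * t) - 1) / (\<eta> - \<delta>))"
    proof (intro integral_unique has_integral_mult_right)
      have "((\<lambda>s. exp ((\<eta> - \<delta>) * s) / (\<eta> - \<delta>)) has_real_derivative exp ((\<eta> - \<delta>) * s)) (at s within {0..})" for s
        using d by (auto intro!: derivative_eq_intros)
      from integral_eq_of_derivative_Ici[OF this t]
      show "((\<lambda>s. exp ((\<eta> - \<delta>) * s)) has_integral (exp ((\<eta> - \<delta>) * t) - 1) / (\<eta> - \<delta>)) {0..t}"
        by (simp add: diff_divide_distrib)
    qed
    also have "\<dots> \<le> c * C * exp \<delta> * (exp ((\<eta> - \<delta>) * t) / (\<eta> - \<delta>))"
      using pos C d by (intro mult_left_mono divide_right_mono) auto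
    finally have "\<bar>exp (\<eta> * t) * k t\<bar> \<le> 1 + c * C * exp \<delta> * (exp ((\<eta> - \<delta>) * t) / (\<eta> - \<delta>))"
      unfolding eq by (simp add: abs_le_iff)
    also have "\<dots> \<le> D * exp ((\<eta> - \<delta>) * t)"
      using d t by (simp add: D_def distrib_right)
    finally have "exp (- \<eta> * t) * \<bar>exp (\<eta> * t) * k t\<bar> \<le> exp (- \<eta> * t) * (D * exp ((\<eta> - \<delta>) * t))"
      by (intro mult_left_mono) auto
    moreover have "exp (- \<eta> * t) * \<bar>exp (\<eta> * t) * k t\<bar> = \<bar>k t\<bar>"
      by (simp add: abs_mult mult.assoc[symmetric] mult_exp_exp)
    moreover have "exp (- \<eta> * t) * (D * exp ((\<eta> - \<delta>) * t)) = D * (exp (- \<eta> * t) * exp ((\<eta> - \<delta>) * t))"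
      by (simp only: mult_ac)
    moreover have "exp (- \<eta> * t) * exp ((\<eta> - \<delta>) * t) = exp (- \<delta> * t)"
      by (simp add: mult_exp_exp algebra_simps)
    ultimately show ?thesis by (simp only:)
  qed
  have D: "D \<ge> 0" using pos C d by (simp add: D_def)
  show ?thesis
  proof (rule that[of "max C D", OF _ d(1)])
    show "0 \<le> max C D" using C by simp
    show "\<bar>g t\<bar> \<le> max C D * exp (- \<delta> * t)" for t
      by (rule order_trans[OF C(2) mult_right_mono]) auto
    show "\<bar>k t\<bar> \<le> max C D * exp (- \<delta> * t)" for t
    proof (cases "t \<ge> 0")
      case True
      show ?thesis by (rule order_trans[OF kb[OF True] mult_right_mono]) auto
    qed (use C in \<open>simp add: k_neg\<close>)
  qed
qed

end

section \<open>Eigenbasis of a symmetric matrix\<close>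

text \<open>A maximiser of the Rayleigh quotient on an invariant subspace is an eigenvector.\<close>

lemma selfadjoint_eigenvector:
  fixes f :: "'a::euclidean_space \<Rightarrow> 'a"
  assumes f: "linear f" and sa: "\<And>x y. f x \<bullet> y = x \<bullet> f y"
    and S: "subspace S" "\<And>x. x \<in> S \<Longrightarrow> f x \<in> S" "S \<noteq> {0}"
  obtains u m where "u \<in> S" "norm u = 1" "f u = m *\<^sub>R u"
proof -
  let ?U = "S \<inter> sphere 0 1"
  have "compact ?U" using closed_subspace[OF S(1)] by (intro closed_Int_compact) auto
  moreover obtain a where a: "a \<in> S" "a \<noteq> 0" using S subspace_0 by blast
  then have "a /\<^sub>R norm a \<in> ?U" using S(1) by (auto simp: subspace_scale)
  then have "?U \<noteq> {}" by blast
  moreover have "continuous_on ?U (\<lambda>x. x \<bullet> f x)"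
    by (intro continuous_intros linear_continuous_on linear_linear[THEN iffD2] f)
  ultimately obtain u where u: "u \<in> ?U" "\<And>x. x \<in> ?U \<Longrightarrow> x \<bullet> f x \<le> u \<bullet> f u"
    using continuous_attains_sup[of ?U "\<lambda>x. x \<bullet> f x"] by blast
  define m where "m = u \<bullet> f u"
  define Q where "Q x = m * (x \<bullet> x) - x \<bullet> f x" for x
  have nu: "u \<bullet> u = 1" "u \<in> S" using u by (auto simp: norm_eq_1)
  have Q: "Q x \<ge> 0" if "x \<in> S" for x
  proof (cases "x = 0")
    case False
    then have "x /\<^sub>R norm x \<in> ?U" using that S(1) by (auto simp: subspace_scale)
    then have "(x /\<^sub>R norm x) \<bullet> f (x /\<^sub>R norm x) \<le> m" using u(2) unfolding m_def by blast
    then have "x \<bullet> f x / (norm x)\<^sup>2 \<le> m"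
      by (simp add: linear_scale[OF f] power2_eq_square divide_inverse mult.commute mult.left_commute)
    then show ?thesis using False
      by (simp add: Q_def power2_norm_eq_inner[symmetric] field_simps)
  qed (simp add: Q_def linear_0[OF f])
  have Qu: "Q u = 0" by (simp add: Q_def nu m_def)
  have orth: "(m *\<^sub>R u - f u) \<bullet> x = 0" if "x \<in> S" for x
  proof (rule ccontr)
    define b where "b = (m *\<^sub>R u - f u) \<bullet> x"
    assume "(m *\<^sub>R u - f u) \<bullet> x \<noteq> 0"
    then have b: "b \<noteq> 0" by (simp add: b_def)
    have exp: "Q (u + t *\<^sub>R x) = 2 * t * b + t\<^sup>2 * Q x" for t
    proof -
      have "Q (u + t *\<^sub>R x) = Q u + 2 * t * b + t\<^sup>2 * Q x"
        using sa[of u x]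
        by (simp add: Q_def b_def linear_add[OF f] linear_scale[OF f] algebra_simps power2_eq_square
            inner_commute[of x u] inner_commute[of x "f u"])
      then show ?thesis using Qu by simp
    qed
    have "Q (u + t *\<^sub>R x) \<ge> 0" for t
      using Q nu that S(1) by (simp add: subspace_add subspace_scale)
    then have le: "0 \<le> 2 * t * b + t\<^sup>2 * Q x" for t unfolding exp .
    \<comment> \<open>\<open>Q\<close> is nonnegative on \<open>S\<close> and 0 at \<open>u\<close>,
      so the linear term \<open>2 * t * b\<close> cannot survive: at \<open>t = - r\<close> the sum
      is \<open>- (r\<^sup>2 * (Q x + 2))\<close>. The 1 in the denominator allows for
      \<open>Q x = 0\<close>.\<close>
    define r where "r = b / (Q x + 1)"
    have q: "Q x + 1 > 0" using Q[OF that] by linarith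
    then have br: "b = r * (Q x + 1)" "r \<noteq> 0" using b by (auto simp: r_def)
    have "2 * (- r) * b + (- r)\<^sup>2 * Q x = - (r\<^sup>2 * (Q x + 2))"
      unfolding br(1) by (simp add: algebra_simps power2_eq_square)
    moreover have "r\<^sup>2 * (Q x + 2) > 0" using br(2) Q[OF that] by (intro mult_pos_pos) auto
    ultimately show False using le[of "- r"] by linarith
  qed
  have "m *\<^sub>R u - f u \<in> S" using nu S by (simp add: subspace_diff subspace_scale)
  from orth[OF this] have "f u = m *\<^sub>R u" by simp
  then show ?thesis using that nu u by auto
qed

text \<open>A family of orthonormal eigenvectors through \<open>e\<close> of largest cardinality
  must span: its orthogonal complement is invariant under the self-adjoint \<open>f\<close>, and a
  nonzero complement would supply one more. Prescribing \<open>e\<close> is what puts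
  \<open>ones\<close> into the basis.\<close>

lemma orthonormal_eigenvectors_extend:
  fixes f :: "'a::euclidean_space \<Rightarrow> 'a"
  assumes f: "linear f" and sa: "\<And>x y. f x \<bullet> y = x \<bullet> f y"
    and e: "norm e = 1" "f e = m *\<^sub>R e"
  obtains B where "e \<in> B" "pairwise orthogonal B" "\<And>b. b \<in> B \<Longrightarrow> norm b = 1 \<and> (\<exists>m. f b = m *\<^sub>R b)"
    "finite B" "card B = DIM('a)" "span B = UNIV"
proof -
  define P where "P B \<longleftrightarrow> e \<in> B \<and> pairwise orthogonal B \<and> (\<forall>b\<in>B. norm b = 1 \<and> (\<exists>m. f b = m *\<^sub>R b))" for B
  have ind: "independent B" if "P B" for B
    using that by (intro pairwise_orthogonal_independent) (auto simp: P_def)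
  then have bd: "card B \<le> DIM('a)" "finite B" if "P B" for B
    using independent_bound that by blast+
  have "P {e}" using e by (auto simp: P_def)
  then obtain B where B: "P B" "\<And>C. P C \<Longrightarrow> card C \<le> card B"
    using ex_has_greatest_nat[of P "{e}" card "DIM('a) + 1"] bd(1) by (auto simp: less_Suc_eq_le)
  have "span B = UNIV"
  proof (rule ccontr)
    assume "span B \<noteq> UNIV"
    then obtain a where a: "a \<noteq> 0" "\<forall>x\<in>span B. a \<bullet> x = 0" using span_not_UNIV_orthogonal by blast
    let ?S = "{x. \<forall>b\<in>B. b \<bullet> x = 0}"
    have "subspace ?S" by (auto simp: subspace_def inner_add_right)
    moreover have "f x \<in> ?S" if "x \<in> ?S" for x
    proof -
      have "b \<bullet> f x = 0" if b: "b \<in> B" for b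
      proof -
        obtain c where "f b = c *\<^sub>R b" using B b by (auto simp: P_def)
        then show ?thesis using sa[of b x] \<open>x \<in> ?S\<close> b by simp
      qed
      then show ?thesis by simp
    qed
    moreover have "a \<in> ?S" using a by (auto simp: inner_commute span_base)
    then have "?S \<noteq> {0}" using a by blast
    ultimately obtain u c where u: "u \<in> ?S" "norm u = 1" "f u = c *\<^sub>R u"
      by (rule selfadjoint_eigenvector[OF f sa]) (assumption, erule (2) that)
    have "u \<notin> B" using u by (auto simp: norm_eq_1)
    have "P (insert u B)"
      using B u by (auto simp: P_def pairwise_insert orthogonal_def inner_commute)
    then show False using B(2)[of "insert u B"] bd(2)[OF B(1)] \<open>u \<notin> B\<close> by simp
  qed
  moreover have "card B = DIM('a)"
    using dim_eq_card_independent[OF ind[OF B(1)]] calculation by (metis dim_span dim_UNIV)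
  ultimately show ?thesis using that[of B] B bd by (auto simp: P_def)
qed

lemma eigenbasis:
  fixes K :: "real ^ 'n ^ 'n"
  assumes sym: "transpose K = K" and ones: "K *v ones = 0"
  obtains u :: "'n \<Rightarrow> real ^ 'n" and \<mu> :: "'n \<Rightarrow> real" and i1 :: 'n where
    "\<And>i j. u i \<bullet> u j = (if i = j then 1 else 0)" "\<And>i. K *v u i = \<mu> i *\<^sub>R u i"
    "\<And>x. (\<Sum>i\<in>UNIV. (u i \<bullet> x) *\<^sub>R u i) = x" "u i1 = (1 / sqrt CARD('n)) *\<^sub>R ones" "\<mu> i1 = 0"
proof -
  let ?e = "(1 / sqrt CARD('n)) *\<^sub>R (ones :: real ^ 'n)"
  have "ones \<bullet> (ones :: real ^ 'n) = CARD('n)" by (simp add: ones_def inner_vec_def)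
  then have "?e \<bullet> ?e = (1 / sqrt CARD('n)) * ((1 / sqrt CARD('n)) * CARD('n))"
    by (simp only: inner_scaleR_left inner_scaleR_right)
  also have "\<dots> = CARD('n) / (sqrt CARD('n) * sqrt CARD('n))" by simp
  also have "\<dots> = 1" unfolding real_sqrt_mult_self by simp
  finally have "?e \<bullet> ?e = 1" .
  then have ne: "norm ?e = 1" by (simp only: norm_eq_1)
  have sa: "(K *v x) \<bullet> y = x \<bullet> (K *v y)" for x y
    using dot_lmul_matrix[of x K y] vector_transpose_matrix[of x K] sym by simp
  have Ke: "K *v ?e = 0 *\<^sub>R ?e" using ones by (simp add: matrix_vector_mult_scaleR)
  obtain B where B: "?e \<in> B" "pairwise orthogonal B" "\<And>b. b \<in> B \<Longrightarrow> norm b = 1 \<and> (\<exists>m. K *v b = m *\<^sub>R b)"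
    "finite B" "card B = DIM(real ^ 'n)" "span B = UNIV"
    by (rule orthonormal_eigenvectors_extend[OF matrix_vector_mul_linear[of K] sa ne Ke]) (rule that)
  have "card (UNIV :: 'n set) = card B" using B(5) by simp
  then obtain u where u: "bij_betw u (UNIV :: 'n set) B"
    using B(4) by (metis finite_same_card_bij finite)
  define \<mu> where "\<mu> i = u i \<bullet> (K *v u i)" for i
  have uB: "u i \<in> B" for i using u by (auto simp: bij_betw_def)
  have uu: "u i \<bullet> u j = (if i = j then 1 else 0)" for i j
  proof (cases "i = j")
    case True then show ?thesis using B(3)[OF uB[of i]] by (simp add: norm_eq_1)
  next
    case False
    then have "u i \<noteq> u j" using u by (auto simp: bij_betw_def inj_on_def)
    then show ?thesis using B(2) uB False by (auto simp: pairwise_def orthogonal_def)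
  qed
  have K\<mu>: "K *v u i = \<mu> i *\<^sub>R u i" for i
  proof -
    obtain c where "K *v u i = c *\<^sub>R u i" using B(3)[OF uB] by blast
    then show ?thesis by (simp add: \<mu>_def uu)
  qed
  have exp: "(\<Sum>i\<in>UNIV. (u i \<bullet> x) *\<^sub>R u i) = x" for x
  proof -
    have "(\<Sum>b\<in>B. (b \<bullet> x) *\<^sub>R b) = x"
      using orthonormal_basis_expand[of B x] B by (simp add: inner_commute[of x])
    then show ?thesis using sum.reindex_bij_betw[OF u, of "\<lambda>b. (b \<bullet> x) *\<^sub>R b"] by simp
  qed
  obtain i1 where i1: "u i1 = ?e" using u B(1) by (metis bij_betw_imp_surj_on imageE)
  have "\<mu> i1 = 0" unfolding \<mu>_def i1 Ke by simp
  then show ?thesis using that[of u \<mu> i1] uu K\<mu> exp i1 by blast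
qed

text \<open>Similarity through the matrix with columns \<open>u j\<close>. It connects the
  eigenvalues of the basis with the list \<open>lam\<close>, which is given only through the
  characteristic polynomial.\<close>

lemma det_eigenbasis:
  fixes K :: "real ^ 'n ^ 'n" and u :: "'n \<Rightarrow> real ^ 'n"
  assumes uu: "\<And>i j. u i \<bullet> u j = (if i = j then 1 else 0)" and K: "\<And>i. K *v u i = \<mu> i *\<^sub>R u i"
  shows "det (mat z - K) = (\<Prod>i\<in>UNIV. z - \<mu> i)"
proof -
  define P where "P = (\<chi> i j. u j $ i)"
  define D where "D = (\<chi> i j. if i = j then z - \<mu> j else 0 :: real ^ 'n ^ 'n)"
  have "transpose P ** P = mat 1"
    using uu by (simp add: P_def vec_eq_iff matrix_matrix_mult_def transpose_def mat_def inner_vec_def)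
  then have "det (transpose P) * det P = 1" by (metis det_mul det_I)
  then have nz: "det P \<noteq> 0" by auto
  have "(mat z - K) ** P = P ** D"
  proof (simp only: vec_eq_iff, intro allI)
    fix i j
    have "((mat z - K) ** P) $ i $ j = ((mat z - K) *v u j) $ i"
      by (simp add: matrix_matrix_mult_def matrix_vector_mult_def P_def)
    also have "(mat z - K) *v u j = (z - \<mu> j) *\<^sub>R u j"
    proof -
      have "mat z *v u j = z *\<^sub>R u j"
        by (simp add: vec_eq_iff matrix_vector_mult_def mat_def if_distrib[of "\<lambda>x. x * _"] cong: if_cong)
      then show ?thesis
        by (simp add: matrix_vector_mult_diff_rdistrib K scaleR_left_diff_distrib)
    qed
    also have "((z - \<mu> j) *\<^sub>R u j) $ i = (P ** D) $ i $ j"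
      by (simp add: matrix_matrix_mult_def P_def D_def if_distrib[of "\<lambda>x. _ * x"] cong: if_cong)
    finally show "((mat z - K) ** P) $ i $ j = (P ** D) $ i $ j" .
  qed
  then have "det (mat z - K) * det P = det P * det D" by (metis det_mul)
  moreover have "det D = (\<Prod>i\<in>UNIV. z - \<mu> i)"
    by (subst det_diagonal) (auto simp: D_def)
  ultimately show ?thesis using nz by simp
qed

text \<open>Further eigenvalues may be 0, so the lists cannot be compared by discarding the value 0.
  Instead one factor \<open>z\<close> is cancelled on each side, belonging to \<open>i1\<close> and
  to the index 1.\<close>

lemma eigenvalue_list_image:
  fixes K :: "real ^ 'n ^ 'n" and u :: "'n \<Rightarrow> real ^ 'n"
  assumes uu: "\<And>i j. u i \<bullet> u j = (if i = j then 1 else 0)" and K: "\<And>i. K *v u i = \<mu> i *\<^sub>R u i"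
    and lam: "eigenvalue_list K lam" "lam 1 = 0" and i1: "\<mu> i1 = 0"
  shows "\<mu> ` (UNIV - {i1}) = lam ` {2..CARD('n)}"
proof -
  let ?p = "\<Prod>i\<in>UNIV - {i1}. [:- \<mu> i, 1:]" and ?q = "\<Prod>j\<in>{2..CARD('n)}. [:- lam j, 1:]"
  have N: "{1..CARD('n)} = insert 1 {2..CARD('n)}" by auto
  have "(\<Prod>i\<in>UNIV. z - \<mu> i) = (\<Prod>j = 1..CARD('n). z - lam j)" for z
    using lam det_eigenbasis[OF uu K, of z] by (simp add: eigenvalue_list_def)
  moreover have "(\<Prod>i\<in>UNIV. z - \<mu> i) = z * poly ?p z" for z
    using i1 prod.remove[of UNIV i1 "\<lambda>i. z - \<mu> i"] by (simp add: poly_prod)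
  moreover have "(\<Prod>j = 1..CARD('n). z - lam j) = z * poly ?q z" for z
    unfolding N using lam by (simp add: poly_prod)
  ultimately have "z * poly ?p z = z * poly ?q z" for z by metis
  \<comment> \<open>The factor is cancelled between polynomials rather than between values, which
    takes care of \<open>z = 0\<close>.\<close>
  then have "poly ([:0, 1:] * ?p) = poly ([:0, 1:] * ?q)" by (intro ext) simp
  then have "[:0, 1:] * ?p = [:0, 1:] * ?q" by (simp only: poly_eq_poly_eq_iff)
  then have pq: "?p = ?q" by simp
  have "{z. poly ?p z = 0} = \<mu> ` (UNIV - {i1})" by (auto simp: poly_prod)
  moreover have "{z. poly ?q z = 0} = lam ` {2..CARD('n)}" by (auto simp: poly_prod)
  ultimately show ?thesis using pq by simp
qed

section \<open>Second moments of Wiener integrals\<close>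

lemma right_riemann_sums_tendsto:
  fixes h :: "real \<Rightarrow> real"
  assumes t: "t \<ge> 0" and F: "finite F" "\<And>s. s \<in> {0<..<t} - F \<Longrightarrow> isCont h s"
    and B: "\<And>s. s \<in> {0..t} \<Longrightarrow> \<bar>h s\<bar> \<le> B"
  shows "(\<lambda>n. \<Sum>j=1..Suc n. t / Suc n * h (j * (t / Suc n))) \<longlonglongrightarrow> integral {0..t} h"
proof (cases "t = 0")
  case False
  with t have t: "t > 0" by simp
  define m where "m n = t / real (Suc n)" for n
  define c where "c n s = real_of_int \<lceil>s / m n\<rceil> * m n" for n s
  have m: "m n > 0" for n using t by (simp add: m_def)
  have step: "((\<lambda>s. h (c n s)) has_integral (\<Sum>j=1..p. m n * h (j * m n))) {0..p * m n}" for n p :: nat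
  proof (induction p)
    case (Suc p)
    have le: "p * m n \<le> Suc p * m n" using m[of n] by simp
    have "((\<lambda>s. h (Suc p * m n)) has_integral m n * h (Suc p * m n)) {p * m n..Suc p * m n}"
      using has_integral_const_real[of "h (Suc p * m n)" "p * m n" "Suc p * m n"] le
      by (simp add: algebra_simps)
    then have "((\<lambda>s. h (c n s)) has_integral m n * h (Suc p * m n)) {p * m n..Suc p * m n}"
    proof (rule has_integral_spike_finite[rotated 2])
      fix s assume s: "s \<in> {p * m n..Suc p * m n} - {p * m n}"
      then have "real p < s / m n" "s / m n \<le> real (Suc p)" using m[of n] by (auto simp: field_simps)
      then have "\<lceil>s / m n\<rceil> = int (Suc p)" by (intro ceiling_unique) auto
      then show "h (c n s) = h (Suc p * m n)" by (simp add: c_def)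
    qed simp
    from has_integral_combine[OF _ le Suc this] m[of n] show ?case by simp
  qed (simp add: has_integral_refl)
  have tm: "real (Suc n) * m n = t" for n by (simp add: m_def)
  define E where "E = F \<union> {0, t}"
  have E: "finite E" using F by (simp add: E_def)
  let ?f = "\<lambda>n s. if s \<in> E then 0 else h (c n s)" and ?g = "\<lambda>s. if s \<in> E then 0 else h s"
  have fI: "(?f n has_integral (\<Sum>j=1..Suc n. m n * h (j * m n))) {0..t}" for n
    by (rule has_integral_spike_finite[OF E _ step[of n "Suc n", unfolded tm]]) auto
  have c_mem: "c n s \<in> {0..t}" and c_close: "\<bar>c n s - s\<bar> \<le> m n" if s: "s \<in> {0..t}" for n s
  proof -
    have "0 \<le> s / m n" "s / m n \<le> real (Suc n)"
      using s m[of n] tm[of n] by (auto simp: pos_divide_le_eq mult.commute)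
    then have "0 \<le> \<lceil>s / m n\<rceil>" "\<lceil>s / m n\<rceil> \<le> int (Suc n)"
      unfolding ceiling_le_iff zero_le_ceiling of_int_of_nat_eq by linarith+
    then have "0 \<le> real_of_int \<lceil>s / m n\<rceil>" "real_of_int \<lceil>s / m n\<rceil> \<le> real (Suc n)" by linarith+
    then have "0 \<le> c n s" "c n s \<le> real (Suc n) * m n"
      unfolding c_def using m[of n] by (auto intro!: mult_right_mono simp del: of_nat_Suc)
    then show "c n s \<in> {0..t}" using tm[of n] by simp
    have "s / m n * m n \<le> c n s"
      unfolding c_def by (rule mult_right_mono[OF le_of_int_ceiling less_imp_le[OF m]])
    moreover have "c n s \<le> (s / m n + 1) * m n"
      unfolding c_def by (rule mult_right_mono[OF of_int_ceiling_le_add_one less_imp_le[OF m]])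
    ultimately show "\<bar>c n s - s\<bar> \<le> m n" using m[of n] by (simp add: distrib_right)
  qed
  have "(\<lambda>n. integral {0..t} (?f n)) \<longlonglongrightarrow> integral {0..t} ?g"
  proof (rule dominated_convergence)
    show "?f n integrable_on {0..t}" for n using fI by blast
    show "(\<lambda>_. \<bar>B\<bar>) integrable_on {0..t}" by (rule integrable_const_ivl)
    show "norm (?f n s) \<le> \<bar>B\<bar>" if "s \<in> {0..t}" for n s
      using B[OF c_mem[OF that, of n]] by auto
    show "(\<lambda>n. ?f n s) \<longlonglongrightarrow> ?g s" if s: "s \<in> {0..t}" for s
    proof (cases "s \<in> E")
      case False
      have "(\<lambda>n. c n s - s) \<longlonglongrightarrow> 0"
      proof (rule tendsto_rabs_zero_cancel, rule tendsto_sandwich[OF _ _ tendsto_const])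
        show "\<forall>\<^sub>F n in sequentially. \<bar>c n s - s\<bar> \<le> m n" using c_close[OF s] by simp
        show "m \<longlonglongrightarrow> 0" unfolding m_def[abs_def]
          using LIMSEQ_Suc[OF lim_const_over_n[of t]] by simp
      qed simp
      then have "(\<lambda>n. c n s) \<longlonglongrightarrow> s" by (simp add: LIM_zero_iff)
      moreover have "isCont h s" using F(2)[of s] s False by (auto simp: E_def)
      ultimately show ?thesis using False isCont_tendsto_compose by auto
    qed simp
  qed
  moreover have "integral {0..t} ?g = integral {0..t} h"
    by (rule integral_spike[OF negligible_finite[OF E]]) simp
  moreover have "integral {0..t} (?f n) = (\<Sum>j=1..Suc n. t / Suc n * h (j * (t / Suc n)))" for n
    using integral_unique[OF fI[of n]] unfolding m_def .
  ultimately show ?thesis by (simp only:)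
qed simp

text \<open>The source of the isometry: the Brownian covariance is an inner product of indicator
  functions, so second moments of sums become integrals of squares.\<close>

lemma has_integral_indicator_min:
  assumes "0 \<le> a" "a \<le> t" "0 \<le> b" "b \<le> (t::real)"
  shows "((\<lambda>u. (if u < a then 1 else 0) * (if u < b then 1 else 0)) has_integral min a b) {0..t}"
    (is "(?f has_integral _) _")
proof -
  have "((\<lambda>_. 1) has_integral min a b) {0..min a b}"
    using has_integral_const_real[of "1::real" 0 "min a b"] assms by simp
  then have "(?f has_integral min a b) {0..min a b}"
    by (rule has_integral_spike_finite[of "{min a b}", rotated 2]) auto
  moreover have "(?f has_integral 0) {min a b..t}"
    by (rule has_integral_spike_finite[of "{}" _ _ "\<lambda>_. 0"]) auto
  ultimately show ?thesis
    using has_integral_combine[of 0 "min a b" t ?f "min a b" 0] assms by auto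
qed

text \<open>Young's inequality. A factor \<open>1 + d\<close> near 1 on the main term, against a
  large factor on an error that tends to 0, stands in for the triangle inequality of the
  second-moment norm.\<close>

lemma square_add_le:
  fixes a b d :: real assumes "d > 0"
  shows "(a + b)\<^sup>2 \<le> (1 + d) * a\<^sup>2 + (1 + 1 / d) * b\<^sup>2"
proof -
  have "0 \<le> (d * a - b)\<^sup>2 / d" using assms by simp
  also have "\<dots> = d * a\<^sup>2 + b\<^sup>2 / d - 2 * a * b" using assms by (simp add: power2_eq_square field_simps)
  finally show ?thesis by (simp add: power2_sum algebra_simps)
qed

lemma le_of_le_scaled:
  fixes x y :: real assumes "\<And>d. d > 0 \<Longrightarrow> x \<le> (1 + d) * y" "y \<ge> 0" shows "x \<le> y"
proof (rule field_le_epsilon)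
  fix e :: real assume e: "e > 0"
  have "x \<le> (1 + e / (y + 1)) * y" using e assms by (intro assms(1)) auto
  also have "\<dots> = y + e * (y / (y + 1))" by (simp add: algebra_simps)
  also have "\<dots> \<le> y + e * 1" using e assms by (intro add_left_mono mult_left_mono) auto
  finally show "x \<le> y + e" by simp
qed

text \<open>What second moments of linear functionals of a path depend on. These properties pass to
  \<open>u \<bullet> w t\<close>, for a unit vector \<open>u\<close>, by bilinearity.\<close>

locale brownian_covariance = prob_space +
  fixes W :: "real \<Rightarrow> 'a \<Rightarrow> real"
  assumes W_meas: "\<And>s. s \<ge> 0 \<Longrightarrow> W s \<in> borel_measurable M"
    and W_int: "\<And>s. s \<ge> 0 \<Longrightarrow> integrable M (W s)"
    and W_int2: "\<And>s r. s \<ge> 0 \<Longrightarrow> r \<ge> 0 \<Longrightarrow> integrable M (\<lambda>\<omega>. W s \<omega> * W r \<omega>)"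
    and W_mean: "\<And>s. s \<ge> 0 \<Longrightarrow> expectation (W s) = 0"
    and W_cov: "\<And>s r. s \<ge> 0 \<Longrightarrow> r \<ge> 0 \<Longrightarrow> expectation (\<lambda>\<omega>. W s \<omega> * W r \<omega>) = min s r"
    and W_cont: "AE \<omega> in M. continuous_on {0..} (\<lambda>t. W t \<omega>)"
begin

text \<open>Bilinear expansion of the square, with \<open>has_integral_indicator_min\<close> for
  each covariance; the vanishing means remove the cross term with the constant
  \<open>m\<close>.\<close>

lemma linear_combination:
  fixes a \<tau> :: "'i \<Rightarrow> real"
  assumes I: "finite I" and \<tau>: "\<And>i. i \<in> I \<Longrightarrow> 0 \<le> \<tau> i \<and> \<tau> i \<le> t"
  shows "integrable M (\<lambda>\<omega>. (m + (\<Sum>i\<in>I. a i * W (\<tau> i) \<omega>))\<^sup>2)"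
    and "((\<lambda>u. (\<Sum>i\<in>I. a i * (if u < \<tau> i then 1 else 0))\<^sup>2) has_integral
      (expectation (\<lambda>\<omega>. (m + (\<Sum>i\<in>I. a i * W (\<tau> i) \<omega>))\<^sup>2) - m\<^sup>2)) {0..t}"
proof -
  let ?L = "\<lambda>\<omega>. \<Sum>i\<in>I. a i * W (\<tau> i) \<omega>"
  have sq: "(\<Sum>i\<in>I. a i * x i)\<^sup>2 = (\<Sum>i\<in>I. \<Sum>j\<in>I. a i * a j * (x i * x j))" for x :: "'i \<Rightarrow> real"
    by (simp add: power2_eq_square sum_product mult_ac)
  have e: "(m + ?L \<omega>)\<^sup>2 = m\<^sup>2 + 2 * m * ?L \<omega> + (\<Sum>i\<in>I. \<Sum>j\<in>I. a i * a j * (W (\<tau> i) \<omega> * W (\<tau> j) \<omega>))" for \<omega>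
    unfolding sq[symmetric] by (simp add: power2_sum)
  have i1: "integrable M ?L" using \<tau> by (intro Bochner_Integration.integrable_sum integrable_mult_right W_int) auto
  have i2: "integrable M (\<lambda>\<omega>. \<Sum>i\<in>I. \<Sum>j\<in>I. a i * a j * (W (\<tau> i) \<omega> * W (\<tau> j) \<omega>))"
    using \<tau> by (intro Bochner_Integration.integrable_sum integrable_mult_right W_int2) auto
  show "integrable M (\<lambda>\<omega>. (m + ?L \<omega>)\<^sup>2)"
    unfolding e by (intro Bochner_Integration.integrable_add integrable_mult_right i1 i2 integrable_const)
  have E1: "expectation ?L = 0"
    using \<tau> by (subst Bochner_Integration.integral_sum) (auto intro!: integrable_mult_right W_int sum.neutral simp: W_mean)
  have E2: "expectation (\<lambda>\<omega>. \<Sum>i\<in>I. \<Sum>j\<in>I. a i * a j * (W (\<tau> i) \<omega> * W (\<tau> j) \<omega>))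
      = (\<Sum>i\<in>I. \<Sum>j\<in>I. a i * a j * min (\<tau> i) (\<tau> j))"
    using \<tau> by (simp add: Bochner_Integration.integral_sum Bochner_Integration.integrable_sum W_int2 W_cov)
  have "expectation (\<lambda>\<omega>. (m + ?L \<omega>)\<^sup>2)
      = expectation (\<lambda>\<omega>. m\<^sup>2 + 2 * m * ?L \<omega>)
        + expectation (\<lambda>\<omega>. \<Sum>i\<in>I. \<Sum>j\<in>I. a i * a j * (W (\<tau> i) \<omega> * W (\<tau> j) \<omega>))"
    unfolding e by (intro Bochner_Integration.integral_add Bochner_Integration.integrable_add
        integrable_mult_right i1 i2 integrable_const)
  also have "expectation (\<lambda>\<omega>. m\<^sup>2 + 2 * m * ?L \<omega>) = m\<^sup>2"
    using i1 E1 by (subst Bochner_Integration.integral_add) (auto simp: prob_space)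
  finally have E: "expectation (\<lambda>\<omega>. (m + ?L \<omega>)\<^sup>2) - m\<^sup>2 = (\<Sum>i\<in>I. \<Sum>j\<in>I. a i * a j * min (\<tau> i) (\<tau> j))"
    unfolding E2 by simp
  show "((\<lambda>u. (\<Sum>i\<in>I. a i * (if u < \<tau> i then 1 else 0))\<^sup>2) has_integral
      (expectation (\<lambda>\<omega>. (m + ?L \<omega>)\<^sup>2) - m\<^sup>2)) {0..t}"
    unfolding E sq using \<tau>
    by (intro has_integral_sum I has_integral_mult_right has_integral_indicator_min) auto
qed

text \<open>The random variable is \<open>m\<close> plus the Wiener integral of \<open>s \<mapsto> k (t - s)\<close> over \<open>[0, t]\<close>, in the
  form obtained by integration by parts. Its Riemann sums are linear combinations of values of
  \<open>W\<close>, for which the isometry is \<open>linear_combination\<close>.\<close>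

lemma wiener_integral_second_moment:
  fixes k q :: "real \<Rightarrow> real"
  assumes q: "continuous_on {0..} q" and k: "\<And>u. u \<ge> 0 \<Longrightarrow> (k has_real_derivative q u) (at u within {0..})"
    and t: "t \<ge> 0" and X: "X \<in> borel_measurable M"
    and X_eq: "AE \<omega> in M. X \<omega> = m + (k 0 * W t \<omega> + integral {0..t} (\<lambda>s. q (t - s) * W s \<omega>))"
  shows "(\<integral>\<^sup>+ \<omega>. ennreal ((X \<omega>)\<^sup>2) \<partial>M) = ennreal (m\<^sup>2 + integral {0..t} (\<lambda>u. (k (t - u))\<^sup>2))"
proof -
  \<comment> \<open>Index 0 holds the boundary term \<open>k 0 * W t\<close>, the indices from 1 on
    the Riemann sum for the integral of \<open>q (t - s) * W s\<close>.\<close>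
  define a where "a n j = (if j = 0 then k 0 else t / Suc n * q (t - j * (t / Suc n)))" for n j :: nat
  define \<tau> where "\<tau> n j = (if j = 0 then t else j * (t / Suc n))" for n j :: nat
  define J where "J n \<omega> = (\<Sum>j\<in>{0..Suc n}. a n j * W (\<tau> n j) \<omega>)" for n \<omega>
  define \<phi> where "\<phi> n u = (\<Sum>j\<in>{0..Suc n}. a n j * (if u < \<tau> n j then 1 else 0))" for n u
  \<comment> \<open>Every \<open>\<phi> n\<close> is 0 at \<open>u = t\<close>, since the comparison
    with \<open>\<tau> n j \<le> t\<close> is strict; the limit function is adjusted at this one
    point.\<close>
  define kt where "kt u = (if u = t then 0 else k (t - u))" for u
  have \<tau>: "0 \<le> \<tau> n j \<and> \<tau> n j \<le> t" if "j \<in> {0..Suc n}" for n j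
    using that t mult_left_mono[of "real j" "1 + real n" t] by (auto simp: \<tau>_def field_simps)
  have split: "(\<Sum>j\<in>{0..Suc n}. f j) = f 0 + (\<Sum>j=1..Suc n. f j)" for f :: "nat \<Rightarrow> real" and n
    by (subst sum.atLeast_Suc_atMost) auto
  have kc: "continuous_on {0..} k" by (rule DERIV_continuous_on) (use k in auto)
  have qc: "continuous_on {..t} (\<lambda>s. q (t - s))"
    by (rule continuous_on_compose2[OF q]) (auto intro!: continuous_intros)
  have bdd: "\<exists>B. \<forall>s\<in>{0..t}. \<bar>f s\<bar> \<le> B" if "continuous_on {0..t} f" for f :: "real \<Rightarrow> real"
    using compact_imp_bounded[OF compact_continuous_image[OF that]] by (auto simp: bounded_iff)
  obtain Q where Q: "\<And>s. s \<in> {0..t} \<Longrightarrow> \<bar>q (t - s)\<bar> \<le> Q"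
    using bdd[OF continuous_on_subset[OF qc]] by (metis atLeastAtMost_iff atMost_iff subsetI)
  have Q0: "Q \<ge> 0" using Q[of 0] t by auto
  have "continuous_on {0..t} (\<lambda>u. k (t - u))"
    by (rule continuous_on_compose2[OF kc]) (auto intro!: continuous_intros)
  then obtain D where D: "\<And>s. s \<in> {0..t} \<Longrightarrow> \<bar>k (t - s)\<bar> \<le> D" using bdd by blast
  have D0: "D \<ge> 0" using D[of 0] t by auto
  have kt_le: "\<bar>kt u\<bar> \<le> D" if "u \<in> {0..t}" for u using D[OF that] D0 by (simp add: kt_def)
  define C where "C = \<bar>k 0\<bar> + t * Q"
  have \<phi>_le: "\<bar>\<phi> n u\<bar> \<le> C" for n u
  proof -
    have "\<bar>\<phi> n u\<bar> \<le> (\<Sum>j\<in>{0..Suc n}. \<bar>a n j * (if u < \<tau> n j then 1 else 0)\<bar>)"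
      unfolding \<phi>_def by (rule sum_abs)
    also have "\<dots> \<le> (\<Sum>j\<in>{0..Suc n}. \<bar>a n j\<bar>)" by (intro sum_mono) auto
    also have "\<dots> = \<bar>k 0\<bar> + (\<Sum>j=1..Suc n. \<bar>a n j\<bar>)" unfolding split by (simp add: a_def)
    also have "(\<Sum>j=1..Suc n. \<bar>a n j\<bar>) \<le> (\<Sum>j=1..Suc n. t / Suc n * Q)"
    proof (rule sum_mono)
      fix j assume j: "j \<in> {1..Suc n}"
      then have "real j * (t / Suc n) \<in> {0..t}" using \<tau>[of j n] by (simp add: \<tau>_def)
      then have "t / Suc n * \<bar>q (t - j * (t / Suc n))\<bar> \<le> t / Suc n * Q"
        using t by (intro mult_left_mono Q) auto
      then show "\<bar>a n j\<bar> \<le> t / Suc n * Q" using j t by (simp add: a_def abs_mult)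
    qed
    also have "(\<Sum>j=1..Suc n. t / Suc n * Q) = t * Q" by simp
    finally show ?thesis by (simp add: C_def)
  qed
  have C0: "C \<ge> 0" using \<phi>_le[of 0 0] by simp
  have \<phi>_lim: "(\<lambda>n. \<phi> n u) \<longlonglongrightarrow> kt u" if u: "u \<in> {0..t}" for u
  proof (cases "u = t")
    case True
    have "\<phi> n t = 0" for n
      unfolding \<phi>_def
    proof (intro sum.neutral ballI)
      fix j assume "j \<in> {0..Suc n}"
      then have "\<not> t < \<tau> n j" using \<tau>[of j n] by simp
      then show "a n j * (if t < \<tau> n j then 1 else 0) = 0" by simp
    qed
    then show ?thesis by (simp add: True kt_def)
  next
    case False
    \<comment> \<open>Only nodes to the right of \<open>u\<close> contribute. In the limit the
      integral of \<open>q (t - s)\<close> over \<open>[u, t]\<close> is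
      \<open>k (t - u) - k 0\<close>, and index 0 restores \<open>k 0\<close>.\<close>
    let ?h = "\<lambda>s. if u < s then q (t - s) else 0"
    have "(\<lambda>n. \<Sum>j=1..Suc n. t / Suc n * ?h (j * (t / Suc n))) \<longlonglongrightarrow> integral {0..t} ?h"
    proof (rule right_riemann_sums_tendsto[OF t, of "{u}"])
      fix s assume s: "s \<in> {0<..<t} - {u}"
      have "continuous_on {..<t} (\<lambda>s. q (t - s))" by (rule continuous_on_subset[OF qc]) auto
      then have qs: "isCont (\<lambda>s. q (t - s)) s" using s by (simp add: continuous_on_eq_continuous_at)
      consider "u < s" | "s < u" using s by force
      then show "isCont ?h s"
      proof cases
        case 1
        then have "\<forall>\<^sub>F x in nhds s. ?h x = q (t - x)"
          by (intro eventually_mono[OF eventually_nhds_in_open[of "{u<..}" s]]) auto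
        from isCont_cong[OF this] qs show ?thesis by (rule iffD2)
      next
        case 2
        then have "\<forall>\<^sub>F x in nhds s. ?h x = 0"
          by (intro eventually_mono[OF eventually_nhds_in_open[of "{..<u}" s]]) auto
        from isCont_cong[OF this] show ?thesis by simp
      qed
    next
      show "\<bar>?h s\<bar> \<le> Q" if "s \<in> {0..t}" for s using Q[OF that] Q0 by simp
    qed simp
    moreover have "integral {0..t} ?h = k (t - u) - k 0"
    proof -
      have "((\<lambda>s. q (t - s)) has_integral (- k (t - t) - - k (t - u))) {u..t}"
      proof (rule fundamental_theorem_of_calculus_interior)
        show "continuous_on {u..t} (\<lambda>s. - k (t - s))"
          by (intro continuous_on_minus continuous_on_compose2[OF kc]) (auto intro!: continuous_intros)
        fix s assume s: "s \<in> {u<..<t}"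
        then have "at (t - s) within {0..} = at (t - s)" by (intro at_within_interior) simp
        then have 1: "(k has_real_derivative q (t - s)) (at (t - s))" using k[of "t - s"] s by simp
        have 2: "((\<lambda>s. t - s) has_real_derivative -1) (at s)" by (auto intro!: derivative_eq_intros)
        have "((\<lambda>s. - k (t - s)) has_real_derivative - (q (t - s) * -1)) (at s)"
          by (intro DERIV_minus DERIV_chain2[where f = k and g = "\<lambda>s. t - s", OF 1 2])
        then show "((\<lambda>s. - k (t - s)) has_vector_derivative q (t - s)) (at s)"
          by (simp add: has_real_derivative_iff_has_vector_derivative)
      qed (use u in auto)
      then have "((\<lambda>s. q (t - s)) has_integral (k (t - u) - k 0)) {u..t}" by simp
      then have h1: "(?h has_integral k (t - u) - k 0) {u..t}"
        by (rule has_integral_spike_finite[of "{u}", rotated 2]) auto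
      have h0: "(?h has_integral 0) {0..u}"
        by (rule has_integral_spike_finite[of "{}" _ _ "\<lambda>_. 0"]) auto
      have "(?h has_integral 0 + (k (t - u) - k 0)) {0..t}"
        by (rule has_integral_combine[OF _ _ h0 h1]) (use u in auto)
      then show ?thesis by (simp add: integral_unique)
    qed
    ultimately have "(\<lambda>n. k 0 + (\<Sum>j=1..Suc n. t / Suc n * ?h (j * (t / Suc n)))) \<longlonglongrightarrow> k 0 + (k (t - u) - k 0)"
      by (intro tendsto_intros) simp
    moreover have "\<phi> n u = k 0 + (\<Sum>j=1..Suc n. t / Suc n * ?h (j * (t / Suc n)))" for n
    proof -
      have "(\<Sum>j=1..Suc n. a n j * (if u < \<tau> n j then 1 else 0)) = (\<Sum>j=1..Suc n. t / Suc n * ?h (j * (t / Suc n)))"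
        by (intro sum.cong refl) (auto simp: a_def \<tau>_def)
      then show ?thesis unfolding \<phi>_def split using u False by (simp add: a_def \<tau>_def)
    qed
    ultimately show ?thesis using False by (simp add: kt_def)
  qed
  have J_lim: "AE \<omega> in M. (\<lambda>n. J n \<omega>) \<longlonglongrightarrow> X \<omega> - m"
    using W_cont X_eq
  proof eventually_elim
    case (elim \<omega>)
    have c: "continuous_on {0..t} (\<lambda>s. q (t - s) * W s \<omega>)"
      by (intro continuous_on_mult continuous_on_subset[OF qc] continuous_on_subset[OF elim(1)]) auto
    obtain B where B: "\<And>s. s \<in> {0..t} \<Longrightarrow> \<bar>q (t - s) * W s \<omega>\<bar> \<le> B" using bdd[OF c] by blast
    have "(\<lambda>n. \<Sum>j=1..Suc n. t / Suc n * (q (t - j * (t / Suc n)) * W (j * (t / Suc n)) \<omega>))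
        \<longlonglongrightarrow> integral {0..t} (\<lambda>s. q (t - s) * W s \<omega>)"
    proof (rule right_riemann_sums_tendsto[OF t, of "{}", OF _ _ B])
      fix s assume s: "s \<in> {0<..<t} - {}"
      have "continuous_on {0<..<t} (\<lambda>s. q (t - s) * W s \<omega>)"
        by (rule continuous_on_subset[OF c]) auto
      then show "isCont (\<lambda>s. q (t - s) * W s \<omega>) s" using s by (simp add: continuous_on_eq_continuous_at)
    qed simp_all
    then have "(\<lambda>n. k 0 * W t \<omega> + (\<Sum>j=1..Suc n. t / Suc n * (q (t - j * (t / Suc n)) * W (j * (t / Suc n)) \<omega>)))
        \<longlonglongrightarrow> k 0 * W t \<omega> + integral {0..t} (\<lambda>s. q (t - s) * W s \<omega>)"
      by (intro tendsto_intros)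
    moreover have "J n \<omega> = k 0 * W t \<omega> + (\<Sum>j=1..Suc n. t / Suc n * (q (t - j * (t / Suc n)) * W (j * (t / Suc n)) \<omega>))" for n
    proof -
      have "(\<Sum>j=1..Suc n. a n j * W (\<tau> n j) \<omega>)
          = (\<Sum>j=1..Suc n. t / Suc n * (q (t - j * (t / Suc n)) * W (j * (t / Suc n)) \<omega>))"
        by (intro sum.cong refl) (auto simp: a_def \<tau>_def)
      then show ?thesis unfolding J_def split by (simp add: a_def \<tau>_def)
    qed
    ultimately show ?case using elim(2) by simp
  qed
  have J_int: "integrable M (\<lambda>\<omega>. (m + J n \<omega>)\<^sup>2)" for n
    using linear_combination(1)[of "{0..Suc n}" "\<tau> n" t m "a n"] \<tau> by (simp add: J_def)
  have J_exp: "((\<lambda>u. (\<phi> n u)\<^sup>2) has_integral (expectation (\<lambda>\<omega>. (m + J n \<omega>)\<^sup>2) - m\<^sup>2)) {0..t}" for n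
    using linear_combination(2)[of "{0..Suc n}" "\<tau> n" t "a n" m] \<tau> by (simp add: J_def \<phi>_def)
  have J_meas[measurable]: "J n \<in> borel_measurable M" for n
    unfolding J_def[abs_def] using \<tau> by (intro borel_measurable_sum borel_measurable_times W_meas) auto
  have diff: "integrable M (\<lambda>\<omega>. (J n \<omega> - J l \<omega>)\<^sup>2)"
    "((\<lambda>u. (\<phi> n u - \<phi> l u)\<^sup>2) has_integral expectation (\<lambda>\<omega>. (J n \<omega> - J l \<omega>)\<^sup>2)) {0..t}" for n l
  proof -
    \<comment> \<open>The difference of two approximations is again a linear combination, over the
      disjoint union of the index sets.\<close>
    let ?I = "{0..Suc n} <+> {0..Suc l}"
    let ?a = "case_sum (a n) (\<lambda>j. - a l j)" and ?\<tau> = "case_sum (\<tau> n) (\<tau> l)"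
    have 1: "(\<Sum>i\<in>?I. ?a i * W (?\<tau> i) \<omega>) = J n \<omega> - J l \<omega>" for \<omega>
      by (simp add: sum.Plus J_def sum_negf o_def)
    have 2: "(\<Sum>i\<in>?I. ?a i * (if u < ?\<tau> i then 1 else 0)) = \<phi> n u - \<phi> l u" for u
      by (simp add: sum.Plus \<phi>_def sum_negf[symmetric] o_def)
    have 3: "0 \<le> ?\<tau> i \<and> ?\<tau> i \<le> t" if "i \<in> ?I" for i using that \<tau> by auto
    show "integrable M (\<lambda>\<omega>. (J n \<omega> - J l \<omega>)\<^sup>2)"
      using linear_combination(1)[of ?I ?\<tau> t 0 ?a] 3 unfolding 1 by simp
    show "((\<lambda>u. (\<phi> n u - \<phi> l u)\<^sup>2) has_integral expectation (\<lambda>\<omega>. (J n \<omega> - J l \<omega>)\<^sup>2)) {0..t}"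
      using linear_combination(2)[of ?I ?\<tau> t ?a 0] 3 unfolding 1 2 by simp
  qed
  \<comment> \<open>Squared distance of \<open>\<phi> n\<close> from its limit. By the isometry it
    is the limit over \<open>l\<close> of the second moment of \<open>J n - J l\<close>; since
    \<open>J l\<close> converges almost surely, Fatou makes it a bound for the second moment of
    \<open>J n - (X - m)\<close>.\<close>
  define e where "e n = integral {0..t} (\<lambda>u. (\<phi> n u - kt u)\<^sup>2)" for n
  have sq_bd: "norm ((x - y)\<^sup>2) \<le> (C + C + D)\<^sup>2" if "\<bar>x\<bar> \<le> C" "\<bar>y\<bar> \<le> C + D" for x y
  proof -
    have "\<bar>x - y\<bar> \<le> C + C + D" using that by linarith
    then have "\<bar>x - y\<bar>\<^sup>2 \<le> (C + C + D)\<^sup>2" by (intro power_mono) auto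
    then show ?thesis by simp
  qed
  have e_lim1: "(\<lambda>u. (\<phi> n u - kt u)\<^sup>2) integrable_on {0..t}"
    "(\<lambda>l. expectation (\<lambda>\<omega>. (J n \<omega> - J l \<omega>)\<^sup>2)) \<longlonglongrightarrow> e n" for n
  proof -
    note dc = dominated_convergence[of "\<lambda>l u. (\<phi> n u - \<phi> l u)\<^sup>2" "{0..t}" "\<lambda>_. (C + C + D)\<^sup>2" "\<lambda>u. (\<phi> n u - kt u)\<^sup>2"]
    have h: "(\<lambda>u. (\<phi> n u - \<phi> l u)\<^sup>2) integrable_on {0..t}"
      "norm ((\<phi> n u - \<phi> l u)\<^sup>2) \<le> (C + C + D)\<^sup>2" for l u
      using diff(2)[of n l] sq_bd[OF \<phi>_le[of n u], of "\<phi> l u"] \<phi>_le[of l u] D0 by auto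
    have h2: "(\<lambda>l. (\<phi> n u - \<phi> l u)\<^sup>2) \<longlonglongrightarrow> (\<phi> n u - kt u)\<^sup>2" if "u \<in> {0..t}" for u
      by (intro tendsto_intros \<phi>_lim that)
    show "(\<lambda>u. (\<phi> n u - kt u)\<^sup>2) integrable_on {0..t}"
      by (rule dc(1)) (use h h2 in auto)
    have "(\<lambda>l. integral {0..t} (\<lambda>u. (\<phi> n u - \<phi> l u)\<^sup>2)) \<longlonglongrightarrow> e n"
      unfolding e_def by (rule dc(2)) (use h h2 in auto)
    then show "(\<lambda>l. expectation (\<lambda>\<omega>. (J n \<omega> - J l \<omega>)\<^sup>2)) \<longlonglongrightarrow> e n"
      using integral_unique[OF diff(2)] by simp
  qed
  have e_lim: "e \<longlonglongrightarrow> 0"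
  proof -
    have "(\<lambda>n. integral {0..t} (\<lambda>u. (\<phi> n u - kt u)\<^sup>2)) \<longlonglongrightarrow> integral {0..t} (\<lambda>_. 0)"
    proof (rule dominated_convergence(2))
      show "(\<lambda>_. (C + C + D)\<^sup>2) integrable_on {0..t}" by (rule integrable_const_ivl)
      show "norm ((\<phi> n u - kt u)\<^sup>2) \<le> (C + C + D)\<^sup>2" if "u \<in> {0..t}" for n u
        using sq_bd[OF \<phi>_le[of n u], of "kt u"] kt_le[OF that] C0 by auto
      show "(\<lambda>n. (\<phi> n u - kt u)\<^sup>2) \<longlonglongrightarrow> 0" if "u \<in> {0..t}" for u
        using tendsto_power[OF tendsto_diff[OF \<phi>_lim[OF that] tendsto_const[of "kt u"]], of 2] by simp
    qed (rule e_lim1)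
    then show ?thesis by (simp add: e_def[abs_def])
  qed
  have e0: "e n \<ge> 0" for n unfolding e_def by (intro integral_nonneg e_lim1) auto
  have fatou: "(\<integral>\<^sup>+ \<omega>. ennreal ((J n \<omega> - (X \<omega> - m))\<^sup>2) \<partial>M) \<le> ennreal (e n)" for n
  proof -
    have "AE \<omega> in M. ennreal ((J n \<omega> - (X \<omega> - m))\<^sup>2) = liminf (\<lambda>l. ennreal ((J n \<omega> - J l \<omega>)\<^sup>2))"
      using J_lim
    proof eventually_elim
      case (elim \<omega>)
      have "(\<lambda>l. ennreal ((J n \<omega> - J l \<omega>)\<^sup>2)) \<longlonglongrightarrow> ennreal ((J n \<omega> - (X \<omega> - m))\<^sup>2)"
        by (intro tendsto_ennrealI tendsto_intros elim)
      then show ?case by (intro lim_imp_Liminf[symmetric]) auto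
    qed
    then have "(\<integral>\<^sup>+ \<omega>. ennreal ((J n \<omega> - (X \<omega> - m))\<^sup>2) \<partial>M)
        = (\<integral>\<^sup>+ \<omega>. liminf (\<lambda>l. ennreal ((J n \<omega> - J l \<omega>)\<^sup>2)) \<partial>M)" by (rule nn_integral_cong_AE)
    also have "\<dots> \<le> liminf (\<lambda>l. \<integral>\<^sup>+ \<omega>. ennreal ((J n \<omega> - J l \<omega>)\<^sup>2) \<partial>M)"
      by (rule nn_integral_liminf) measurable
    also have "\<dots> = liminf (\<lambda>l. ennreal (expectation (\<lambda>\<omega>. (J n \<omega> - J l \<omega>)\<^sup>2)))"
      using diff(1) by (subst nn_integral_eq_integral) auto
    also have "\<dots> = ennreal (e n)"
      by (intro lim_imp_Liminf tendsto_ennrealI e_lim1) simp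
    finally show ?thesis .
  qed
  note X[measurable]
  have R_int: "integrable M (\<lambda>\<omega>. (J n \<omega> - (X \<omega> - m))\<^sup>2)" for n
    using fatou[of n] by (intro integrableI_bounded) (auto simp: le_less_trans)
  have R_le: "expectation (\<lambda>\<omega>. (J n \<omega> - (X \<omega> - m))\<^sup>2) \<le> e n" for n
  proof -
    have "ennreal (expectation (\<lambda>\<omega>. (J n \<omega> - (X \<omega> - m))\<^sup>2)) \<le> ennreal (e n)"
      using fatou[of n] nn_integral_eq_integral[OF R_int[of n]] by simp
    then show ?thesis using e0[of n] by simp
  qed
  have X_int: "integrable M (\<lambda>\<omega>. (X \<omega>)\<^sup>2)"
  proof (rule Bochner_Integration.integrable_bound)
    show "integrable M (\<lambda>\<omega>. 2 * (m + J 0 \<omega>)\<^sup>2 + 2 * (J 0 \<omega> - (X \<omega> - m))\<^sup>2)"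
      by (intro Bochner_Integration.integrable_add integrable_mult_right J_int R_int)
    show "AE \<omega> in M. norm ((X \<omega>)\<^sup>2) \<le> norm (2 * (m + J 0 \<omega>)\<^sup>2 + 2 * (J 0 \<omega> - (X \<omega> - m))\<^sup>2)"
    proof (rule AE_I2)
      fix \<omega>
      have "(X \<omega>)\<^sup>2 \<le> 2 * (m + J 0 \<omega>)\<^sup>2 + 2 * (J 0 \<omega> - (X \<omega> - m))\<^sup>2"
        using square_add_le[of 1 "m + J 0 \<omega>" "- (J 0 \<omega> - (X \<omega> - m))"] by (simp only: power2_minus) simp
      then show "norm ((X \<omega>)\<^sup>2) \<le> norm (2 * (m + J 0 \<omega>)\<^sup>2 + 2 * (J 0 \<omega> - (X \<omega> - m))\<^sup>2)" by simp
    qed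
  qed measurable
  define y where "y = expectation (\<lambda>\<omega>. (X \<omega>)\<^sup>2)"
  define V where "V = m\<^sup>2 + integral {0..t} (\<lambda>u. (kt u)\<^sup>2)"
  have V_lim: "(\<lambda>n. expectation (\<lambda>\<omega>. (m + J n \<omega>)\<^sup>2)) \<longlonglongrightarrow> V"
  proof -
    have "(\<lambda>n. integral {0..t} (\<lambda>u. (\<phi> n u)\<^sup>2)) \<longlonglongrightarrow> integral {0..t} (\<lambda>u. (kt u)\<^sup>2)"
    proof (rule dominated_convergence(2))
      show "(\<lambda>u. (\<phi> n u)\<^sup>2) integrable_on {0..t}" for n using J_exp by blast
      show "(\<lambda>_. (C + C + D)\<^sup>2) integrable_on {0..t}" by (rule integrable_const_ivl)
      show "norm ((\<phi> n u)\<^sup>2) \<le> (C + C + D)\<^sup>2" for n u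
        using sq_bd[OF \<phi>_le[of n u], of 0] C0 D0 by simp
      show "(\<lambda>n. (\<phi> n u)\<^sup>2) \<longlonglongrightarrow> (kt u)\<^sup>2" if "u \<in> {0..t}" for u
        by (intro tendsto_intros \<phi>_lim that)
    qed
    then have "(\<lambda>n. expectation (\<lambda>\<omega>. (m + J n \<omega>)\<^sup>2) - m\<^sup>2) \<longlonglongrightarrow> integral {0..t} (\<lambda>u. (kt u)\<^sup>2)"
      using integral_unique[OF J_exp] by simp
    from tendsto_add[OF tendsto_const[of "m\<^sup>2"] this] show ?thesis by (simp add: V_def)
  qed
  \<comment> \<open>Young's inequality between \<open>X\<close> and \<open>m + J n\<close>, with
    \<open>n\<close> to infinity for fixed \<open>d\<close>; only afterwards is \<open>d\<close>
    made small.\<close>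
  have up: "y \<le> (1 + d) * V" if d: "d > 0" for d
  proof (rule LIMSEQ_le_const)
    show "(\<lambda>n. (1 + d) * expectation (\<lambda>\<omega>. (m + J n \<omega>)\<^sup>2) + (1 + 1 / d) * e n) \<longlonglongrightarrow> (1 + d) * V"
      using tendsto_add[OF tendsto_mult_left[OF V_lim, of "1 + d"] tendsto_mult_left[OF e_lim, of "1 + 1 / d"]] by simp
    have "y \<le> (1 + d) * expectation (\<lambda>\<omega>. (m + J n \<omega>)\<^sup>2) + (1 + 1 / d) * e n" for n
    proof -
      have "y \<le> expectation (\<lambda>\<omega>. (1 + d) * (m + J n \<omega>)\<^sup>2 + (1 + 1 / d) * (J n \<omega> - (X \<omega> - m))\<^sup>2)"
        unfolding y_def
      proof (rule integral_mono[OF X_int])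
        show "integrable M (\<lambda>\<omega>. (1 + d) * (m + J n \<omega>)\<^sup>2 + (1 + 1 / d) * (J n \<omega> - (X \<omega> - m))\<^sup>2)"
          by (intro Bochner_Integration.integrable_add integrable_mult_right J_int R_int)
        show "(X \<omega>)\<^sup>2 \<le> (1 + d) * (m + J n \<omega>)\<^sup>2 + (1 + 1 / d) * (J n \<omega> - (X \<omega> - m))\<^sup>2" for \<omega>
          using square_add_le[OF d, of "m + J n \<omega>" "- (J n \<omega> - (X \<omega> - m))"] by (simp only: power2_minus) simp
      qed
      also have "\<dots> = (1 + d) * expectation (\<lambda>\<omega>. (m + J n \<omega>)\<^sup>2) + (1 + 1 / d) * expectation (\<lambda>\<omega>. (J n \<omega> - (X \<omega> - m))\<^sup>2)"
        by (subst Bochner_Integration.integral_add) (auto intro!: integrable_mult_right J_int R_int)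
      also have "\<dots> \<le> (1 + d) * expectation (\<lambda>\<omega>. (m + J n \<omega>)\<^sup>2) + (1 + 1 / d) * e n"
        using d by (intro add_left_mono mult_left_mono R_le) auto
      finally show ?thesis .
    qed
    then show "\<exists>N. \<forall>n\<ge>N. y \<le> (1 + d) * expectation (\<lambda>\<omega>. (m + J n \<omega>)\<^sup>2) + (1 + 1 / d) * e n" by blast
  qed
  have low: "V \<le> (1 + d) * y" if d: "d > 0" for d
  proof (rule LIMSEQ_le[OF V_lim])
    show "(\<lambda>n. (1 + d) * y + (1 + 1 / d) * e n) \<longlonglongrightarrow> (1 + d) * y"
      using tendsto_add[OF tendsto_const[of "(1 + d) * y"] tendsto_mult_left[OF e_lim, of "1 + 1 / d"]] by simp
    have "expectation (\<lambda>\<omega>. (m + J n \<omega>)\<^sup>2) \<le> (1 + d) * y + (1 + 1 / d) * e n" for n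
    proof -
      have "expectation (\<lambda>\<omega>. (m + J n \<omega>)\<^sup>2) \<le> expectation (\<lambda>\<omega>. (1 + d) * (X \<omega>)\<^sup>2 + (1 + 1 / d) * (J n \<omega> - (X \<omega> - m))\<^sup>2)"
      proof (rule integral_mono[OF J_int])
        show "integrable M (\<lambda>\<omega>. (1 + d) * (X \<omega>)\<^sup>2 + (1 + 1 / d) * (J n \<omega> - (X \<omega> - m))\<^sup>2)"
          by (intro Bochner_Integration.integrable_add integrable_mult_right X_int R_int)
        show "(m + J n \<omega>)\<^sup>2 \<le> (1 + d) * (X \<omega>)\<^sup>2 + (1 + 1 / d) * (J n \<omega> - (X \<omega> - m))\<^sup>2" for \<omega>
        proof -
          have "X \<omega> + (J n \<omega> - (X \<omega> - m)) = m + J n \<omega>" by simp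
          then show ?thesis using square_add_le[OF d, of "X \<omega>" "J n \<omega> - (X \<omega> - m)"] by (simp only:)
        qed
      qed
      also have "\<dots> = (1 + d) * y + (1 + 1 / d) * expectation (\<lambda>\<omega>. (J n \<omega> - (X \<omega> - m))\<^sup>2)"
        unfolding y_def by (subst Bochner_Integration.integral_add) (auto intro!: integrable_mult_right X_int R_int)
      also have "\<dots> \<le> (1 + d) * y + (1 + 1 / d) * e n"
        using d by (intro add_left_mono mult_left_mono R_le) auto
      finally show ?thesis .
    qed
    then show "\<exists>N. \<forall>n\<ge>N. expectation (\<lambda>\<omega>. (m + J n \<omega>)\<^sup>2) \<le> (1 + d) * y + (1 + 1 / d) * e n" by blast
  qed
  have y0: "y \<ge> 0" unfolding y_def by simp
  have V0: "V \<ge> 0"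
    by (rule LIMSEQ_le_const[OF V_lim]) auto
  have "y = V" using le_of_le_scaled[OF up V0] le_of_le_scaled[OF low y0] by simp
  moreover have "(\<integral>\<^sup>+ \<omega>. ennreal ((X \<omega>)\<^sup>2) \<partial>M) = ennreal y"
    unfolding y_def by (rule nn_integral_eq_integral[OF X_int]) simp
  moreover have "integral {0..t} (\<lambda>u. (kt u)\<^sup>2) = integral {0..t} (\<lambda>u. (k (t - u))\<^sup>2)"
    by (rule integral_spike[of "{t}"]) (auto simp: kt_def)
  ultimately show ?thesis by (simp add: V_def)
qed

end

section \<open>Covariance of Brownian motion\<close>

context prob_space
begin

lemma standard_brownian_increment:
  assumes b: "standard_brownian_motion b" and sr: "0 \<le> s" "s \<le> r"
  shows "integrable M (\<lambda>\<omega>. b r \<omega> - b s \<omega>)" "integrable M (\<lambda>\<omega>. (b r \<omega> - b s \<omega>)\<^sup>2)"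
    "expectation (\<lambda>\<omega>. b r \<omega> - b s \<omega>) = 0" "expectation (\<lambda>\<omega>. (b r \<omega> - b s \<omega>)\<^sup>2) = r - s"
proof -
  let ?X = "\<lambda>\<omega>. b r \<omega> - b s \<omega>"
  have "integrable M ?X \<and> integrable M (\<lambda>\<omega>. (?X \<omega>)\<^sup>2) \<and> expectation ?X = 0 \<and> expectation (\<lambda>\<omega>. (?X \<omega>)\<^sup>2) = r - s"
  \<comment> \<open>A vanishing increment has no normal density, so it is treated apart.\<close>
  proof (cases "s = r")
    case False
    then have pos: "sqrt (r - s) > 0" using sr by simp
    have D: "distributed M lborel ?X (normal_density 0 (sqrt (r - s)))"
      using b sr False unfolding standard_brownian_motion_def by auto
    have "integrable lborel (\<lambda>x. normal_density 0 (sqrt (r - s)) x * (x - 0) ^ 1)"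
      by (rule integrable_normal_moment[OF pos])
    then have "integrable lborel (\<lambda>x. normal_density 0 (sqrt (r - s)) x * x)"
      by (simp only: power_one_right diff_zero)
    then have "integrable M ?X"
      by (rule iffD1[OF distributed_integrable[OF D], rotated 2]) auto
    moreover have "integrable M (\<lambda>\<omega>. (?X \<omega>)\<^sup>2)"
      using distributed_integrable[OF D, of "\<lambda>x. x\<^sup>2"] integrable_normal_moment[OF pos, of 0 2]
      by (simp add: normal_density_nonneg)
    moreover have E: "expectation ?X = 0" by (rule normal_distributed_expectation[OF pos D])
    moreover have "expectation (\<lambda>\<omega>. (?X \<omega>)\<^sup>2) = r - s"
      using normal_distributed_variance[OF pos D] sr unfolding E by simp
    ultimately show ?thesis by blast
  qed simp
  then show "integrable M ?X" "integrable M (\<lambda>\<omega>. (?X \<omega>)\<^sup>2)" "expectation ?X = 0"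
    "expectation (\<lambda>\<omega>. (?X \<omega>)\<^sup>2) = r - s" by blast+
qed

lemma standard_brownian_mean:
  assumes b: "standard_brownian_motion b" and s: "0 \<le> s"
  shows "integrable M (b s)" "expectation (b s) = 0"
proof -
  have m: "b s \<in> borel_measurable M" "b 0 \<in> borel_measurable M"
    using b s unfolding standard_brownian_motion_def by auto
  have ae: "AE \<omega> in M. b s \<omega> - b 0 \<omega> = b s \<omega>"
    using b unfolding standard_brownian_motion_def by (auto elim: AE_mp)
  show "integrable M (b s)"
    by (rule integrable_cong_AE_imp[OF standard_brownian_increment(1)[OF b order_refl s] m(1)])
      (use ae in auto)
  show "expectation (b s) = 0"
    using integral_cong_AE[OF _ m(1) ae] standard_brownian_increment(3)[OF b order_refl s] m by simp
qed

lemma standard_brownian_covariance: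
  assumes b: "standard_brownian_motion b" and sr: "0 \<le> s" "s \<le> r"
  shows "integrable M (\<lambda>\<omega>. b s \<omega> * b r \<omega>)" "expectation (\<lambda>\<omega>. b s \<omega> * b r \<omega>) = s"
proof -
  let ?X = "\<lambda>\<omega>. b s \<omega> - b 0 \<omega>" and ?Y = "\<lambda>\<omega>. b r \<omega> - b s \<omega>"
  have m: "b s \<in> borel_measurable M" "b 0 \<in> borel_measurable M" "b r \<in> borel_measurable M"
    using b sr unfolding standard_brownian_motion_def by auto
  \<comment> \<open>The times \<open>0, s, r\<close> give two consecutive independent increments;
    \<open>b s * b r\<close> is the square of the first plus their product, outside a null set with
    \<open>b 0 \<noteq> 0\<close>.\<close>
  define \<tau> where "\<tau> i = (if i = 0 then 0 else if i = 1 then s else r)" for i :: nat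
  have "\<forall>n (t :: nat \<Rightarrow> real). 0 \<le> t 0 \<and> (\<forall>i<n. t i \<le> t (Suc i)) \<longrightarrow>
        indep_vars (\<lambda>_. borel) (\<lambda>i \<omega>. b (t (Suc i)) \<omega> - b (t i) \<omega>) {..<n}"
    using b unfolding standard_brownian_motion_def by blast
  moreover have "0 \<le> \<tau> 0 \<and> (\<forall>i<2. \<tau> i \<le> \<tau> (Suc i))" using sr by (auto simp: \<tau>_def less_2_cases_iff)
  ultimately have ind: "indep_vars (\<lambda>_. borel) (\<lambda>i \<omega>. b (\<tau> (Suc i)) \<omega> - b (\<tau> i) \<omega>) {..<2}" by blast
  have two: "{..<2} = {0, 1::nat}" by auto
  have int: "integrable M (\<lambda>\<omega>. b (\<tau> (Suc i)) \<omega> - b (\<tau> i) \<omega>)" if "i \<in> {..<2}" for i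
    using that sr by (intro standard_brownian_increment[OF b]) (auto simp: \<tau>_def less_2_cases_iff)
  have XY: "integrable M (\<lambda>\<omega>. ?X \<omega> * ?Y \<omega>)" "expectation (\<lambda>\<omega>. ?X \<omega> * ?Y \<omega>) = 0"
    using indep_vars_integrable[OF _ ind int] indep_vars_lebesgue_integral[OF _ ind int]
      standard_brownian_increment(3)[OF b order_refl sr(1)]
    by (simp_all add: two \<tau>_def)
  have XX: "integrable M (\<lambda>\<omega>. (?X \<omega>)\<^sup>2)" "expectation (\<lambda>\<omega>. (?X \<omega>)\<^sup>2) = s"
    using standard_brownian_increment(2,4)[OF b order_refl sr(1)] by auto
  have ae: "AE \<omega> in M. (?X \<omega>)\<^sup>2 + ?X \<omega> * ?Y \<omega> = b s \<omega> * b r \<omega>"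
  proof -
    have "AE \<omega> in M. b 0 \<omega> = 0" using b unfolding standard_brownian_motion_def by blast
    then show ?thesis by eventually_elim (simp add: power2_eq_square algebra_simps)
  qed
  have int2: "integrable M (\<lambda>\<omega>. (?X \<omega>)\<^sup>2 + ?X \<omega> * ?Y \<omega>)"
    by (rule Bochner_Integration.integrable_add[OF XX(1) XY(1)])
  have mm: "(\<lambda>\<omega>. b s \<omega> * b r \<omega>) \<in> borel_measurable M" using m by measurable
  show "integrable M (\<lambda>\<omega>. b s \<omega> * b r \<omega>)"
    by (rule integrable_cong_AE_imp[OF int2 mm ae])
  have "expectation (\<lambda>\<omega>. b s \<omega> * b r \<omega>) = expectation (\<lambda>\<omega>. (?X \<omega>)\<^sup>2 + ?X \<omega> * ?Y \<omega>)"
    using integral_cong_AE[OF borel_measurable_integrable[OF int2] mm ae] by simp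
  also have "\<dots> = s" using Bochner_Integration.integral_add[OF XX(1) XY(1)] XX XY by simp
  finally show "expectation (\<lambda>\<omega>. b s \<omega> * b r \<omega>) = s" .
qed

lemma vector_brownian_component_covariance:
  fixes w :: "real \<Rightarrow> 'a \<Rightarrow> real ^ 'n"
  assumes w: "vector_brownian_motion w" and sr: "0 \<le> s" "0 \<le> r"
  shows "integrable M (\<lambda>\<omega>. w s \<omega> $ i * w r \<omega> $ j)"
    "expectation (\<lambda>\<omega>. w s \<omega> $ i * w r \<omega> $ j) = (if i = j then min s r else 0)"
proof -
  have b: "standard_brownian_motion (\<lambda>t \<omega>. w t \<omega> $ l)" for l
    using w unfolding vector_brownian_motion_def by blast
  have "integrable M (\<lambda>\<omega>. w s \<omega> $ i * w r \<omega> $ j) \<and>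
    expectation (\<lambda>\<omega>. w s \<omega> $ i * w r \<omega> $ j) = (if i = j then min s r else 0)"
  proof (cases "i = j")
    case True
    show ?thesis
    proof (cases "s \<le> r")
      case True
      then show ?thesis using standard_brownian_covariance[OF b sr(1) True] \<open>i = j\<close> by simp
    next
      case False
      then have "r \<le> s" by simp
      then show ?thesis using standard_brownian_covariance[OF b sr(2) \<open>r \<le> s\<close>] \<open>i = j\<close>
        by (simp add: mult.commute)
    qed
  next
    case False
    have "indep_vars (\<lambda>_. PiM {0..} (\<lambda>_. borel)) (\<lambda>l \<omega>. \<lambda>t\<in>{0..}. w t \<omega> $ l) (UNIV :: 'n set)"
      using w unfolding vector_brownian_motion_def by blast
    \<comment> \<open>Independence is between whole paths, so coordinate \<open>i\<close> may be
      evaluated at \<open>s\<close> and the others at a different time \<open>r\<close>.\<close>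
    then have ind0: "indep_vars (\<lambda>_. borel) (\<lambda>l \<omega>. (\<lambda>f. f (if l = i then s else r)) (\<lambda>t\<in>{0..}. w t \<omega> $ l)) (UNIV :: 'n set)"
      by (rule indep_vars_compose2) (use sr in \<open>auto intro!: measurable_component_singleton\<close>)
    have "indep_vars (\<lambda>_. borel) (\<lambda>l \<omega>. w (if l = i then s else r) \<omega> $ l) (UNIV :: 'n set)"
    proof -
      have "(\<lambda>t\<in>{0..}. w t \<omega> $ l) (if l = i then s else r) = w (if l = i then s else r) \<omega> $ l" for l \<omega>
        using sr by simp
      then show ?thesis using ind0 by (simp only:)
    qed
    then have ind: "indep_vars (\<lambda>_. borel) (\<lambda>l \<omega>. w (if l = i then s else r) \<omega> $ l) {i, j}"
      by (rule indep_vars_subset) simp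
    have int: "integrable M (\<lambda>\<omega>. w (if l = i then s else r) \<omega> $ l)" for l
      using standard_brownian_mean(1)[OF b, of "if l = i then s else r" l] sr by simp
    show ?thesis
      using indep_vars_integrable[OF _ ind int] indep_vars_lebesgue_integral[OF _ ind int] False
        standard_brownian_mean(2)[OF b sr(1), of i] by (simp cong: if_cong)
  qed
  then show "integrable M (\<lambda>\<omega>. w s \<omega> $ i * w r \<omega> $ j)"
    "expectation (\<lambda>\<omega>. w s \<omega> $ i * w r \<omega> $ j) = (if i = j then min s r else 0)" by blast+
qed

lemma vector_brownian_measurable:
  fixes w :: "real \<Rightarrow> 'a \<Rightarrow> real ^ 'n"
  assumes w: "vector_brownian_motion w" and s: "0 \<le> s"
  shows "w s \<in> borel_measurable M"
proof -
  have "(\<lambda>\<omega>. w s \<omega> $ l) \<in> borel_measurable M" for l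
    using w s unfolding vector_brownian_motion_def standard_brownian_motion_def by blast
  then have "\<forall>e\<in>Basis. (\<lambda>\<omega>. w s \<omega> \<bullet> e) \<in> borel_measurable M"
    by (auto simp: Basis_vec_def inner_axis)
  then show ?thesis by (rule borel_measurable_euclidean_space[THEN iffD2])
qed

lemma vector_brownian_AE:
  fixes w :: "real \<Rightarrow> 'a \<Rightarrow> real ^ 'n"
  assumes w: "vector_brownian_motion w"
  shows "AE \<omega> in M. w 0 \<omega> = 0 \<and> continuous_on {0..} (\<lambda>t. w t \<omega>)"
proof -
  have "AE \<omega> in M. w 0 \<omega> $ l = 0 \<and> continuous_on {0..} (\<lambda>t. w t \<omega> $ l)" for l
    using w unfolding vector_brownian_motion_def standard_brownian_motion_def by auto
  then have "AE \<omega> in M. \<forall>l. w 0 \<omega> $ l = 0 \<and> continuous_on {0..} (\<lambda>t. w t \<omega> $ l)"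
    unfolding AE_all_countable by blast
  then show ?thesis
  proof eventually_elim
    case (elim \<omega>)
    have "continuous_on {0..} (\<lambda>t. \<chi> l. w t \<omega> $ l)" using elim by (intro continuous_on_vec_lambda) auto
    then show ?case using elim by (simp add: vec_eq_iff)
  qed
qed

lemma brownian_covariance_projection:
  fixes w :: "real \<Rightarrow> 'a \<Rightarrow> real ^ 'n"
  assumes w: "vector_brownian_motion w" and u: "u \<bullet> u = 1"
  shows "brownian_covariance M (\<lambda>t \<omega>. u \<bullet> w t \<omega>)"
proof
  have b: "standard_brownian_motion (\<lambda>t \<omega>. w t \<omega> $ l)" for l
    using w unfolding vector_brownian_motion_def by blast
  have e1: "u \<bullet> w s \<omega> = (\<Sum>l\<in>UNIV. u $ l * w s \<omega> $ l)" for s \<omega> by (simp add: inner_vec_def)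
  have e2: "(u \<bullet> w s \<omega>) * (u \<bullet> w r \<omega>) = (\<Sum>i\<in>UNIV. \<Sum>j\<in>UNIV. u $ i * u $ j * (w s \<omega> $ i * w r \<omega> $ j))"
    for s r \<omega> unfolding e1 sum_product by (simp add: mult_ac)
  fix s r :: real assume s: "s \<ge> 0"
  show "(\<lambda>\<omega>. u \<bullet> w s \<omega>) \<in> borel_measurable M"
    using vector_brownian_measurable[OF w s] by measurable
  show "integrable M (\<lambda>\<omega>. u \<bullet> w s \<omega>)"
    unfolding e1 by (intro Bochner_Integration.integrable_sum integrable_mult_right standard_brownian_mean(1)[OF b s])
  show "expectation (\<lambda>\<omega>. u \<bullet> w s \<omega>) = 0"
    unfolding e1 using standard_brownian_mean[OF b s] by (simp add: Bochner_Integration.integral_sum)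
  assume r: "r \<ge> 0"
  show "integrable M (\<lambda>\<omega>. (u \<bullet> w s \<omega>) * (u \<bullet> w r \<omega>))"
    unfolding e2
    by (intro Bochner_Integration.integrable_sum integrable_mult_right vector_brownian_component_covariance[OF w s r])
  have "expectation (\<lambda>\<omega>. (u \<bullet> w s \<omega>) * (u \<bullet> w r \<omega>)) = (\<Sum>i\<in>UNIV. \<Sum>j\<in>UNIV. u $ i * u $ j * (if i = j then min s r else 0))"
    unfolding e2 using vector_brownian_component_covariance[OF w s r]
    by (simp add: Bochner_Integration.integral_sum Bochner_Integration.integrable_sum)
  also have "\<dots> = (u \<bullet> u) * min s r"
    by (simp add: inner_vec_def sum_distrib_right if_distrib[of "\<lambda>x. _ * x"] cong: if_cong)
  finally show "expectation (\<lambda>\<omega>. (u \<bullet> w s \<omega>) * (u \<bullet> w r \<omega>)) = min s r" using u by simp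
next
  show "AE \<omega> in M. continuous_on {0..} (\<lambda>t. u \<bullet> w t \<omega>)"
    using vector_brownian_AE[OF w] by eventually_elim (auto intro!: continuous_intros)
qed

end

section \<open>Mean-square stability\<close>

lemma mono_bounded_tendsto_at_top:
  fixes f :: "real \<Rightarrow> real"
  assumes mono: "\<And>x y. 0 \<le> x \<Longrightarrow> x \<le> y \<Longrightarrow> f x \<le> f y" and B: "\<And>x. 0 \<le> x \<Longrightarrow> f x \<le> B"
  obtains L where "(f \<longlongrightarrow> L) at_top"
proof
  have bdd: "bdd_above (f ` {0..})" using B by (intro bdd_aboveI[of _ B]) auto
  show "(f \<longlongrightarrow> Sup (f ` {0..})) at_top"
  proof (rule order_tendstoI)
    fix a assume "a < Sup (f ` {0..})"
    then obtain x where x: "0 \<le> x" "a < f x" by (auto simp: less_cSup_iff[OF _ bdd])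
    then show "\<forall>\<^sub>F y in at_top. a < f y"
      by (intro eventually_mono[OF eventually_ge_at_top[of x]]) (use mono less_le_trans in blast)
  next
    fix a assume a: "Sup (f ` {0..}) < a"
    have "f y \<le> Sup (f ` {0..})" if "0 \<le> y" for y using that by (intro cSup_upper bdd) auto
    then show "\<forall>\<^sub>F y in at_top. f y < a"
      by (intro eventually_mono[OF eventually_ge_at_top[of 0]]) (use a le_less_trans in blast)
  qed
qed

text \<open>After reflection the integrand no longer depends on \<open>t\<close>, so the integral is
  increasing in \<open>t\<close> and bounded by \<open>C\<^sup>2 / (2 * d)\<close>.\<close>

lemma integral_square_tendsto:
  fixes p :: "real \<Rightarrow> real"
  assumes p: "continuous_on {0..} p" and b: "\<And>u. u \<ge> 0 \<Longrightarrow> \<bar>p u\<bar> \<le> C * exp (- d * u)" and d: "d > 0"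
  obtains L where "((\<lambda>t. integral {0..t} (\<lambda>u. (p (t - u))\<^sup>2)) \<longlongrightarrow> L) at_top"
proof -
  have pi: "(\<lambda>s. (p s)\<^sup>2) integrable_on {a..t}" if "a \<ge> 0" for a t
    using that by (intro integrable_continuous_real continuous_intros continuous_on_subset[OF p]) auto
  have refl: "integral {0..t} (\<lambda>u. (p (t - u))\<^sup>2) = integral {0..t} (\<lambda>s. (p s)\<^sup>2)" for t
    using integral_shift_Icc[of "-t" 0 "\<lambda>s. (p s)\<^sup>2" t] Henstock_Kurzweil_Integration.integral_reflect_real[of 0 "-t" "\<lambda>s. (p (s + t))\<^sup>2"]
    by (simp add: add.commute)
  let ?f = "\<lambda>t. integral {0..t} (\<lambda>s. (p s)\<^sup>2)"
  have "?f x \<le> ?f y" if "0 \<le> x" "x \<le> y" for x y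
    using that by (intro integral_subset_le pi) auto
  moreover have "?f t \<le> C\<^sup>2 / (2 * d)" if t: "0 \<le> t" for t
  proof -
    have "((\<lambda>s. - C\<^sup>2 / (2 * d) * exp (- (2 * d) * s)) has_real_derivative C\<^sup>2 * exp (- (2 * d) * s)) (at s within {0..})" for s
      using d by (auto intro!: derivative_eq_intros)
    from integral_eq_of_derivative_Ici[OF this t]
    have I: "((\<lambda>s. C\<^sup>2 * exp (- (2 * d) * s)) has_integral
        (- C\<^sup>2 / (2 * d) * exp (- (2 * d) * t) - (- C\<^sup>2 / (2 * d) * exp (- (2 * d) * 0)))) {0..t}" .
    have "?f t \<le> integral {0..t} (\<lambda>s. C\<^sup>2 * exp (- (2 * d) * s))"
    proof (rule integral_le[OF pi])
      fix s assume "s \<in> {0..t}"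
      then have "\<bar>p s\<bar>\<^sup>2 \<le> (C * exp (- d * s))\<^sup>2" using b by (intro power_mono) auto
      also have "\<dots> = C\<^sup>2 * exp (- (2 * d) * s)"
        by (simp add: power_mult_distrib power2_eq_square[of "exp _"] mult_exp_exp)
      finally show "(p s)\<^sup>2 \<le> C\<^sup>2 * exp (- (2 * d) * s)" by simp
    qed (use I in auto)
    also have "\<dots> = C\<^sup>2 / (2 * d) - C\<^sup>2 / (2 * d) * exp (- (2 * d) * t)"
      using integral_unique[OF I] by simp
    also have "\<dots> \<le> C\<^sup>2 / (2 * d)" using d by simp
    finally show ?thesis .
  qed
  ultimately obtain L where "(?f \<longlongrightarrow> L) at_top"
    by (rule mono_bounded_tendsto_at_top)
  then show ?thesis using that unfolding refl by blast
qed

lemma exp_decay_tendsto_0: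
  fixes d :: real assumes "d > 0" shows "((\<lambda>t. C * exp (- d * (t + a))) \<longlongrightarrow> 0) at_top"
  using assms by real_asymp

lemma history_integral_tendsto_0:
  fixes p h :: "real \<Rightarrow> real"
  assumes p: "\<And>u. \<bar>p u\<bar> \<le> C * exp (- d * u)" "continuous_on {0..} p" and d: "d > 0" and h: "continuous_on {0..1} h"
  shows "((\<lambda>t. integral {0..1} (\<lambda>s. p (t - s) * h s)) \<longlongrightarrow> 0) at_top"
proof -
  obtain H where "\<forall>y\<in>h ` {0..1}. norm y \<le> H"
    using compact_imp_bounded[OF compact_continuous_image[OF h compact_Icc]] unfolding bounded_iff by blast
  then have H: "\<bar>h s\<bar> \<le> H" if "s \<in> {0..1}" for s using that by auto
  have H0: "H \<ge> 0" using H[of 0] by auto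
  have C0: "C \<ge> 0" using p(1)[of 0] by simp
  show ?thesis
  proof (rule tendsto_rabs_zero_cancel, rule tendsto_sandwich[OF _ _ tendsto_const])
    show "((\<lambda>t. (C * H) * exp (- d * (t + -1))) \<longlongrightarrow> 0) at_top" by (rule exp_decay_tendsto_0[OF d])
    show "\<forall>\<^sub>F t in at_top. \<bar>integral {0..1} (\<lambda>s. p (t - s) * h s)\<bar> \<le> (C * H) * exp (- d * (t + -1))"
      using eventually_ge_at_top[of "1::real"]
    proof eventually_elim
      case (elim t)
      have c: "continuous_on {0..1} (\<lambda>s. p (t - s) * h s)"
        using elim by (intro continuous_intros continuous_on_compose2[OF p(2)] h) auto
      have "norm (integral {0..1} (\<lambda>s. p (t - s) * h s)) \<le> integral {0..1} (\<lambda>s::real. (C * H) * exp (- d * (t + -1)))"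
      proof (rule Henstock_Kurzweil_Integration.integral_norm_bound_integral)
        fix s :: real assume s: "s \<in> {0..1}"
        have "\<bar>p (t - s)\<bar> \<le> C * exp (- d * (t - s))" by (rule p)
        also have "\<dots> \<le> C * exp (- d * (t + -1))"
          using s d C0 by (intro mult_left_mono) auto
        finally have "\<bar>p (t - s)\<bar> * \<bar>h s\<bar> \<le> C * exp (- d * (t + -1)) * H"
          using H[OF s] C0 by (intro mult_mono) auto
        then show "norm (p (t - s) * h s) \<le> (C * H) * exp (- d * (t + -1))" by (simp add: abs_mult mult_ac)
      qed (auto intro: integrable_continuous_real[OF c])
      then show ?case by simp
    qed
  qed simp
qed

text \<open>\<open>Omega\<close> is the orthogonal projection onto the complement of
  \<open>ones\<close>, hence invisible to vectors of that complement.\<close>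

lemma Omega_mult_inner:
  fixes u y :: "real ^ 'n" assumes "ones \<bullet> u = 0" shows "u \<bullet> (Omega *v y) = u \<bullet> y"
proof -
  have "(\<chi> i j. ones $ i * ones $ j) *v y = (ones \<bullet> y) *\<^sub>R (ones :: real ^ 'n)"
    by (simp add: vec_eq_iff matrix_vector_mult_def inner_vec_def sum_distrib_left ones_def)
  then have "Omega *v y = y - ((1 / real CARD('n)) * (ones \<bullet> y)) *\<^sub>R ones"
    by (simp add: Omega_def matrix_vector_mult_diff_rdistrib scaleR_matrix_vector_assoc[symmetric])
  then show ?thesis using assms by (simp add: inner_diff_right inner_commute)
qed

lemma Omega_mult_ones_inner:
  fixes y :: "real ^ 'n" shows "ones \<bullet> (Omega *v y) = 0"
proof -
  have "(\<chi> i j. ones $ i * ones $ j) *v y = (ones \<bullet> y) *\<^sub>R (ones :: real ^ 'n)"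
    by (simp add: vec_eq_iff matrix_vector_mult_def inner_vec_def sum_distrib_left ones_def)
  then have "Omega *v y = y - ((1 / real CARD('n)) * (ones \<bullet> y)) *\<^sub>R ones"
    by (simp add: Omega_def matrix_vector_mult_diff_rdistrib scaleR_matrix_vector_assoc[symmetric])
  moreover have "ones \<bullet> (ones :: real ^ 'n) = CARD('n)" by (simp add: ones_def inner_vec_def)
  ultimately show ?thesis by (simp add: inner_diff_right)
qed

lemma integral_inner_right:
  fixes f :: "real \<Rightarrow> 'b::euclidean_space"
  assumes "f integrable_on S" shows "integral S (\<lambda>s. u \<bullet> f s) = u \<bullet> integral S f"
  using integral_linear[OF assms bounded_linear_inner_right[of u]] by (simp add: o_def)

lemma symmetric_inner_mult:
  fixes K :: "real ^ 'n ^ 'n"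
  assumes "transpose K = K" "K *v u = m *\<^sub>R u" shows "u \<bullet> (K *v y) = m * (u \<bullet> y)"
  using dot_lmul_matrix[of u K y] vector_transpose_matrix[of u K] assms by simp

text \<open>The vector equations on a single path, with noise path \<open>b\<close> and neither
  history nor initial velocity prescribed: in this form solutions can be superposed without any
  probability.\<close>

definition path_equations ::
  "real \<Rightarrow> real ^ 'n ^ 'n \<Rightarrow> (real \<Rightarrow> real ^ 'n) \<Rightarrow> (real \<Rightarrow> real ^ 'n) \<Rightarrow> (real \<Rightarrow> real ^ 'n) \<Rightarrow> bool" where
  "path_equations \<eta> K b x v \<longleftrightarrow>
     continuous_on {0..} b \<and> continuous_on {-1..} x \<and> continuous_on {0..} v \<and>
     (\<forall>t\<ge>0. x t = x 0 + integral {0..t} v) \<and>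
     (\<forall>t\<ge>0. v t = v 0 + integral {0..t} (\<lambda>s. - (\<eta> *\<^sub>R v s) - \<eta> *\<^sub>R (K *v x (s - 1))) + Omega *v b t)"

text \<open>Symmetry moves \<open>K\<close> onto the eigenvector \<open>u\<close>. The projected
  noise stays a function \<open>f\<close>, as it is \<open>u \<bullet> w\<close> for
  \<open>u\<close> orthogonal to \<open>ones\<close> and 0 for \<open>u\<close> parallel to
  it.\<close>

lemma path_equations_project:
  fixes K :: "real ^ 'n ^ 'n"
  assumes P: "path_equations \<eta> K b x v" and K: "transpose K = K" "K *v u = m *\<^sub>R u"
    and f: "\<And>t. u \<bullet> (Omega *v b t) = f t" "continuous_on {0..} f"
  shows "delay_solution \<eta> (\<eta> * m) f (\<lambda>t. u \<bullet> x t) (\<lambda>t. u \<bullet> v t)"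
proof -
  have xc: "continuous_on {-1..} x" and vc: "continuous_on {0..} v" using P by (auto simp: path_equations_def)
  have x1: "continuous_on {0..} (\<lambda>s. x (s - 1))"
    by (rule continuous_on_compose2[OF xc]) (auto intro!: continuous_intros)
  show ?thesis unfolding delay_solution_def
  proof (intro conjI allI impI f)
    show "continuous_on {-1..} (\<lambda>t. u \<bullet> x t)" "continuous_on {0..} (\<lambda>t. u \<bullet> v t)"
      by (intro continuous_intros xc vc)+
    fix t :: real assume t: "t \<ge> 0"
    have "v integrable_on {0..t}"
      by (intro integrable_continuous_real continuous_on_subset[OF vc]) auto
    then have "integral {0..t} (\<lambda>s. u \<bullet> v s) = u \<bullet> integral {0..t} v" by (rule integral_inner_right)
    moreover have "x t = x 0 + integral {0..t} v" using P t unfolding path_equations_def by blast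
    ultimately show "u \<bullet> x t = u \<bullet> x 0 + integral {0..t} (\<lambda>s. u \<bullet> v s)"
      using arg_cong[of "x t" _ "\<lambda>y. u \<bullet> y"] by (simp only: inner_add_right)
    let ?F = "\<lambda>s. - (\<eta> *\<^sub>R v s) - \<eta> *\<^sub>R (K *v x (s - 1))"
    have "continuous_on {0..} ?F"
      by (intro continuous_intros vc x1 continuous_on_compose2[OF matrix_vector_mult_linear_continuous_on])
        auto
    then have "?F integrable_on {0..t}"
      by (intro integrable_continuous_real) (rule continuous_on_subset, auto)
    then have "integral {0..t} (\<lambda>s. u \<bullet> ?F s) = u \<bullet> integral {0..t} ?F" by (rule integral_inner_right)
    moreover have "u \<bullet> ?F s = - (\<eta> * (u \<bullet> v s)) - \<eta> * m * (u \<bullet> x (s - 1))" for s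
      by (simp add: inner_diff_right symmetric_inner_mult[OF K])
    moreover have "v t = v 0 + integral {0..t} ?F + Omega *v b t" using P t unfolding path_equations_def by blast
    ultimately show "u \<bullet> v t = u \<bullet> v 0 + integral {0..t} (\<lambda>s. - (\<eta> * (u \<bullet> v s)) - \<eta> * m * (u \<bullet> x (s - 1))) + f t"
      using arg_cong[of "v t" _ "\<lambda>y. u \<bullet> y"] by (simp only: inner_add_right f)
  qed
qed

context prob_space
begin

lemma augmented_filtration_measurable:
  fixes w :: "real \<Rightarrow> 'a \<Rightarrow> real ^ 'n"
  assumes w: "vector_brownian_motion w" and f: "f \<in> borel_measurable (augmented_filtration w t)"
  shows "f \<in> borel_measurable M"
proof (rule measurable_from_subalg[OF _ f])
  let ?G = "{w s -` A \<inter> space M | s A. 0 \<le> s \<and> s \<le> t \<and> A \<in> sets borel} \<union> null_sets M"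
  have G: "?G \<subseteq> sets M"
    using vector_brownian_measurable[OF w] by (auto intro!: measurable_sets)
  then have "?G \<subseteq> Pow (space M)" using sets.space_closed by blast
  then show "subalgebra M (augmented_filtration w t)"
    using G sets.sigma_sets_subset[OF G]
    by (simp add: subalgebra_def augmented_filtration_def space_measure_of sets_measure_of)
qed

lemma network_error_solution_path:
  fixes w :: "real \<Rightarrow> 'a \<Rightarrow> real ^ 'n"
  assumes w: "vector_brownian_motion w" and sol: "network_error_solution w \<eta> K hist v0 x v"
  shows "AE \<omega> in M. path_equations \<eta> K (\<lambda>t. w t \<omega>) (\<lambda>t. x t \<omega>) (\<lambda>t. v t \<omega>) \<and> w 0 \<omega> = 0 \<and>
    (\<forall>s\<in>{-1..0}. x s \<omega> = hist s) \<and> v 0 \<omega> = v0"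
proof -
  note conjunct2[OF sol[unfolded network_error_solution_def]]
  then show ?thesis using vector_brownian_AE[OF w]
    by eventually_elim (auto simp: path_equations_def)
qed

text \<open>The moments are returned as \<open>ennreal\<close> of a real function \<open>S\<close>,
  so that the limit and the finite sum over all modes can be taken in the reals.\<close>

lemma projected_second_moments_converge:
  fixes w :: "real \<Rightarrow> 'a \<Rightarrow> real ^ 'n"
  assumes w: "vector_brownian_motion w" and sol: "network_error_solution w \<eta> K hist v0 x v"
    and adm: "admissible_initial_data hist v0"
    and K: "transpose K = K" "K *v u = m *\<^sub>R u" and u: "u \<bullet> u = 1" "ones \<bullet> u = 0"
    and pos: "\<eta> > 0" "m > 0" and nr: "\<And>z. Re z \<ge> 0 \<Longrightarrow> char_fun \<eta> (\<eta> * m) z \<noteq> 0"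
  obtains S L where "\<And>t. t \<ge> 0 \<Longrightarrow> (\<integral>\<^sup>+ \<omega>. ennreal ((u \<bullet> x t \<omega>)\<^sup>2) \<partial>M) + (\<integral>\<^sup>+ \<omega>. ennreal ((u \<bullet> v t \<omega>)\<^sup>2) \<partial>M) = ennreal (S t)"
    "\<And>t. S t \<ge> 0" "(S \<longlongrightarrow> L) at_top"
proof -
  define c where "c = \<eta> * m"
  have c: "c > 0" using pos by (simp add: c_def)
  obtain g k where "fundamental_solution \<eta> c g k" using fundamental_solution_ex by blast
  then interpret fundamental_solution \<eta> c g k .
  interpret W: brownian_covariance M "\<lambda>t \<omega>. u \<bullet> w t \<omega>" by (rule brownian_covariance_projection[OF w u(1)])
  obtain C d where Cd: "C \<ge> 0" "d > 0" "\<And>t. \<bar>g t\<bar> \<le> C * exp (- d * t)" "\<And>t. \<bar>k t\<bar> \<le> C * exp (- d * t)"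
  proof (rule exponential_decay[OF pos(1) c])
    show "char_fun \<eta> c z \<noteq> 0" if "Re z \<ge> 0" for z using nr[OF that] by (simp add: c_def)
  qed (rule that)
  \<comment> \<open>The history is shifted to \<open>[0, 1]\<close>, so \<open>h 1\<close> is the
    initial position; \<open>mx\<close> and \<open>mv\<close> below are the parts of the
    representation formulas fixed by the initial data.\<close>
  define h where "h s = u \<bullet> hist (s - 1)" for s
  define mx where "mx t = g t * (u \<bullet> v0) + (k t + \<eta> * g t) * h 1 - c * integral {0..1} (\<lambda>s. g (t - s) * h s)" for t
  define mv where "mv t = k t * (u \<bullet> v0) - c * g (t - 1) * h 1 - c * integral {0..1} (\<lambda>s. k (t - s) * h s)" for t
  have gc: "continuous_on {0..} g" by (rule continuous_on_subset[OF g_cont]) simp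
  have hc: "continuous_on {0..1} h"
  proof -
    have "continuous_on {-1..0} hist" using adm by (simp add: admissible_initial_data_def)
    then have "continuous_on {0..1} (\<lambda>s. hist (s - 1))"
      by (rule continuous_on_compose2) (auto intro!: continuous_intros)
    then show ?thesis unfolding h_def[abs_def] by (intro continuous_on_inner continuous_on_const)
  qed
  have rep: "AE \<omega> in M. u \<bullet> x t \<omega> = mx t + (g 0 * (u \<bullet> w t \<omega>) + integral {0..t} (\<lambda>s. k (t - s) * (u \<bullet> w s \<omega>)))
      \<and> u \<bullet> v t \<omega> = mv t + (k 0 * (u \<bullet> w t \<omega>) + integral {0..t} (\<lambda>s. k' (t - s) * (u \<bullet> w s \<omega>)))"
    if t: "t \<ge> 0" for t
    using network_error_solution_path[OF w sol]
  proof eventually_elim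
    case (elim \<omega>)
    then have P: "path_equations \<eta> K (\<lambda>t. w t \<omega>) (\<lambda>t. x t \<omega>) (\<lambda>t. v t \<omega>)" and w0: "w 0 \<omega> = 0"
      and hist: "\<And>s. s \<in> {-1..0} \<Longrightarrow> x s \<omega> = hist s" and v0: "v 0 \<omega> = v0" by auto
    have wc: "continuous_on {0..} (\<lambda>t. w t \<omega>)" using P by (simp add: path_equations_def)
    have D: "delay_solution \<eta> c (\<lambda>t. u \<bullet> w t \<omega>) (\<lambda>t. u \<bullet> x t \<omega>) (\<lambda>t. u \<bullet> v t \<omega>)"
      unfolding c_def
      by (rule path_equations_project[OF P K]) (auto intro!: continuous_intros wc simp: Omega_mult_inner[OF u(2)])
    have I: "integral {0..1} (\<lambda>s. p (t - s) * (u \<bullet> x (s - 1) \<omega>)) = integral {0..1} (\<lambda>s. p (t - s) * h s)" for p :: "real \<Rightarrow> real"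
      by (rule integral_cong) (simp add: h_def hist)
    have h1: "u \<bullet> x 0 \<omega> = h 1" by (simp add: h_def hist)
    have f0: "u \<bullet> w 0 \<omega> = 0" by (simp add: w0)
    show ?case
      using position_representation[OF D f0 t] velocity_representation[OF D f0 t]
      unfolding mx_def mv_def I h1 v0 by simp
  qed
  have xm: "(\<lambda>\<omega>. u \<bullet> x t \<omega>) \<in> borel_measurable M" "(\<lambda>\<omega>. u \<bullet> v t \<omega>) \<in> borel_measurable M" if "t \<ge> 0" for t
  proof -
    have "x t \<in> borel_measurable M" "v t \<in> borel_measurable M"
      using sol that augmented_filtration_measurable[OF w] unfolding network_error_solution_def by blast+
    then show "(\<lambda>\<omega>. u \<bullet> x t \<omega>) \<in> borel_measurable M" "(\<lambda>\<omega>. u \<bullet> v t \<omega>) \<in> borel_measurable M" by measurable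
  qed
  have Ex: "(\<integral>\<^sup>+ \<omega>. ennreal ((u \<bullet> x t \<omega>)\<^sup>2) \<partial>M) = ennreal ((mx t)\<^sup>2 + integral {0..t} (\<lambda>s. (g (t - s))\<^sup>2))"
    if "t \<ge> 0" for t
    by (rule W.wiener_integral_second_moment[OF k_cont g_DERIV that xm(1)[OF that]])
      (use rep[OF that] in auto)
  have Ev: "(\<integral>\<^sup>+ \<omega>. ennreal ((u \<bullet> v t \<omega>)\<^sup>2) \<partial>M) = ennreal ((mv t)\<^sup>2 + integral {0..t} (\<lambda>s. (k (t - s))\<^sup>2))"
    if "t \<ge> 0" for t
    by (rule W.wiener_integral_second_moment[OF k'_cont k_DERIV that xm(2)[OF that]])
      (use rep[OF that] in auto)
  have decay: "((\<lambda>t. p (t + a)) \<longlongrightarrow> 0) at_top" if "\<And>t. \<bar>p t\<bar> \<le> C * exp (- d * t)" for p :: "real \<Rightarrow> real" and a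
    by (rule tendsto_rabs_zero_cancel, rule tendsto_sandwich[OF _ _ tendsto_const exp_decay_tendsto_0[OF Cd(2), of C a]])
      (use that in auto)
  have g0: "(g \<longlongrightarrow> 0) at_top" "((\<lambda>t. g (t - 1)) \<longlongrightarrow> 0) at_top" and k0: "(k \<longlongrightarrow> 0) at_top"
    using decay[OF Cd(3), of 0] decay[OF Cd(3), of "-1"] decay[OF Cd(4), of 0] by simp_all
  have "(mx \<longlongrightarrow> 0 * (u \<bullet> v0) + (0 + \<eta> * 0) * h 1 - c * 0) at_top"
    unfolding mx_def[abs_def] by (intro tendsto_intros g0 k0 history_integral_tendsto_0[OF Cd(3) gc Cd(2) hc])
  then have mx: "(mx \<longlongrightarrow> 0) at_top" by simp
  have "(mv \<longlongrightarrow> 0 * (u \<bullet> v0) - c * 0 * h 1 - c * 0) at_top"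
    unfolding mv_def[abs_def] by (intro tendsto_intros g0 k0 history_integral_tendsto_0[OF Cd(4) k_cont Cd(2) hc])
  then have mv: "(mv \<longlongrightarrow> 0) at_top" by simp
  obtain L1 where L1: "((\<lambda>t. integral {0..t} (\<lambda>s. (g (t - s))\<^sup>2)) \<longlongrightarrow> L1) at_top"
    using integral_square_tendsto[OF gc Cd(3) Cd(2)] by blast
  obtain L2 where L2: "((\<lambda>t. integral {0..t} (\<lambda>s. (k (t - s))\<^sup>2)) \<longlongrightarrow> L2) at_top"
    using integral_square_tendsto[OF k_cont Cd(4) Cd(2)] by blast
  define S where "S t = ((mx t)\<^sup>2 + integral {0..t} (\<lambda>s. (g (t - s))\<^sup>2)) + ((mv t)\<^sup>2 + integral {0..t} (\<lambda>s. (k (t - s))\<^sup>2))" for t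
  have nn: "integral {0..t} (\<lambda>s. (p (t - s))\<^sup>2) \<ge> 0" for p :: "real \<Rightarrow> real" and t
  proof (cases "(\<lambda>s. (p (t - s))\<^sup>2) integrable_on {0..t}")
    case True then show ?thesis by (intro integral_nonneg) auto
  qed (simp add: not_integrable_integral)
  show ?thesis
  proof (rule that[of S])
    show "(\<integral>\<^sup>+ \<omega>. ennreal ((u \<bullet> x t \<omega>)\<^sup>2) \<partial>M) + (\<integral>\<^sup>+ \<omega>. ennreal ((u \<bullet> v t \<omega>)\<^sup>2) \<partial>M) = ennreal (S t)" if "t \<ge> 0" for t
      unfolding Ex[OF that] Ev[OF that] S_def by (intro ennreal_plus[symmetric] add_nonneg_nonneg nn zero_le_power2)
    show "S t \<ge> 0" for t unfolding S_def by (intro add_nonneg_nonneg nn zero_le_power2)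
    show "(S \<longlongrightarrow> (0\<^sup>2 + L1) + (0\<^sup>2 + L2)) at_top"
      unfolding S_def[abs_def] by (intro tendsto_intros mx mv L1 L2)
  qed
qed

lemma mean_square_stable_of_no_roots:
  fixes w :: "real \<Rightarrow> 'a \<Rightarrow> real ^ 'n" and K :: "real ^ 'n ^ 'n" and u :: "'n \<Rightarrow> real ^ 'n"
  assumes w: "vector_brownian_motion w" and K: "transpose K = K"
    and uu: "\<And>i j. u i \<bullet> u j = (if i = j then 1 else 0)" and Ku: "\<And>i. K *v u i = \<mu> i *\<^sub>R u i"
    and expand: "\<And>x. (\<Sum>i\<in>UNIV. (u i \<bullet> x) *\<^sub>R u i) = x"
    and i1: "u i1 = (1 / sqrt CARD('n)) *\<^sub>R ones" "\<mu> i1 = 0"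
    and pos: "\<eta> > 0" "\<And>i. i \<noteq> i1 \<Longrightarrow> \<mu> i > 0"
    and nr: "\<And>i z. i \<noteq> i1 \<Longrightarrow> Re z \<ge> 0 \<Longrightarrow> char_fun \<eta> (\<eta> * \<mu> i) z \<noteq> 0"
  shows "mean_square_stable w \<eta> K"
  unfolding mean_square_stable_def
proof (intro allI impI, elim conjE)
  fix hist :: "real \<Rightarrow> real ^ 'n" and v0 :: "real ^ 'n" and x v :: "real \<Rightarrow> 'a \<Rightarrow> real ^ 'n"
  assume adm: "admissible_initial_data hist v0" and sol: "network_error_solution w \<eta> K hist v0 x v"
  have ou: "ones \<bullet> u i = 0" if "i \<noteq> i1" for i
  proof -
    have "u i1 \<bullet> u i = 0" using uu[of i1 i] that by simp
    then show ?thesis unfolding i1(1) by simp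
  qed
  have parseval: "(norm y)\<^sup>2 = (\<Sum>i\<in>UNIV. (u i \<bullet> y)\<^sup>2)" for y
  proof -
    have "y \<bullet> y = y \<bullet> (\<Sum>i\<in>UNIV. (u i \<bullet> y) *\<^sub>R u i)" unfolding expand ..
    also have "\<dots> = (\<Sum>i\<in>UNIV. (u i \<bullet> y) * (y \<bullet> u i))"
      by (simp only: inner_sum_right inner_scaleR_right)
    also have "\<dots> = (\<Sum>i\<in>UNIV. (u i \<bullet> y)\<^sup>2)"
      by (intro sum.cong refl) (simp add: power2_eq_square inner_commute)
    finally show ?thesis by (simp only: power2_norm_eq_inner)
  qed
  have xm: "x t \<in> borel_measurable M" "v t \<in> borel_measurable M" if "t \<ge> 0" for t
    using sol that augmented_filtration_measurable[OF w] unfolding network_error_solution_def by blast+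
  let ?T = "\<lambda>i t. (\<integral>\<^sup>+ \<omega>. ennreal ((u i \<bullet> x t \<omega>)\<^sup>2) \<partial>M) + (\<integral>\<^sup>+ \<omega>. ennreal ((u i \<bullet> v t \<omega>)\<^sup>2) \<partial>M)"
  have "\<exists>S L. (\<forall>t\<ge>0. ?T i t = ennreal (S t)) \<and> (\<forall>t. S t \<ge> 0) \<and> (S \<longlongrightarrow> L) at_top" for i
  proof (cases "i = i1")
    case False
    have "u i \<bullet> u i = 1" by (simp add: uu)
    then show ?thesis
      by (rule projected_second_moments_converge[OF w sol adm K Ku _ ou[OF False] pos(1) pos(2)[OF False] nr[OF False]])
        blast+
  next
    case True
    \<comment> \<open>Along \<open>ones\<close> there is neither noise nor initial data, and the
      representation formulas double as a uniqueness statement. They also settle the velocity, for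
      which \<open>network_error_solution\<close> does not state orthogonality to
      \<open>ones\<close>.\<close>
    have "?T i t = 0" if t: "t \<ge> 0" for t
    proof -
      have "AE \<omega> in M. u i \<bullet> x t \<omega> = 0 \<and> u i \<bullet> v t \<omega> = 0"
        using network_error_solution_path[OF w sol]
      proof eventually_elim
        case (elim \<omega>)
        then have P: "path_equations \<eta> K (\<lambda>t. w t \<omega>) (\<lambda>t. x t \<omega>) (\<lambda>t. v t \<omega>)"
          and hist: "\<And>s. s \<in> {-1..0} \<Longrightarrow> x s \<omega> = hist s" and v0: "v 0 \<omega> = v0" by auto
        have z: "u i \<bullet> v 0 \<omega> = 0" "\<And>s. s \<in> {-1..0} \<Longrightarrow> u i \<bullet> x s \<omega> = 0"
          using adm hist v0 by (auto simp: True i1 admissible_initial_data_def)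
        have D: "delay_solution \<eta> (\<eta> * \<mu> i) (\<lambda>_. 0) (\<lambda>t. u i \<bullet> x t \<omega>) (\<lambda>t. u i \<bullet> v t \<omega>)"
          by (rule path_equations_project[OF P K Ku]) (auto simp: True i1 Omega_mult_ones_inner)
        obtain g k where "fundamental_solution \<eta> (\<eta> * \<mu> i) g k" using fundamental_solution_ex by blast
        then interpret fundamental_solution \<eta> "\<eta> * \<mu> i" g k .
        show ?case
          using position_representation[OF D refl t] velocity_representation[OF D refl t] z
          by (simp add: True i1)
      qed
      then have ae: "AE \<omega> in M. ennreal ((u i \<bullet> x t \<omega>)\<^sup>2) = 0" "AE \<omega> in M. ennreal ((u i \<bullet> v t \<omega>)\<^sup>2) = 0"
        by auto
      show ?thesis unfolding nn_integral_cong_AE[OF ae(1)] nn_integral_cong_AE[OF ae(2)] by simp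
    qed
    then show ?thesis by (intro exI[of _ "\<lambda>_. 0"] exI[of _ 0]) simp
  qed
  then obtain S L where S: "\<And>i t. t \<ge> 0 \<Longrightarrow> ?T i t = ennreal (S i t)" "\<And>i t. S i t \<ge> 0" "\<And>i. (S i \<longlongrightarrow> L i) at_top"
    by metis
  have eq: "(\<integral>\<^sup>+ \<omega>. ennreal ((norm (x t \<omega>))\<^sup>2 + (norm (v t \<omega>))\<^sup>2) \<partial>M) = ennreal (\<Sum>i\<in>UNIV. S i t)" if t: "t \<ge> 0" for t
  proof -
    note xm[OF t, measurable]
    have "(\<integral>\<^sup>+ \<omega>. ennreal ((norm (x t \<omega>))\<^sup>2 + (norm (v t \<omega>))\<^sup>2) \<partial>M)
        = (\<integral>\<^sup>+ \<omega>. (\<Sum>i\<in>UNIV. ennreal ((u i \<bullet> x t \<omega>)\<^sup>2) + ennreal ((u i \<bullet> v t \<omega>)\<^sup>2)) \<partial>M)"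
      unfolding parseval by (simp add: sum.distrib[symmetric] ennreal_plus[symmetric] sum_ennreal del: ennreal_plus)
    also have "\<dots> = (\<Sum>i\<in>UNIV. \<integral>\<^sup>+ \<omega>. ennreal ((u i \<bullet> x t \<omega>)\<^sup>2) + ennreal ((u i \<bullet> v t \<omega>)\<^sup>2) \<partial>M)"
      by (rule nn_integral_sum) measurable
    also have "\<dots> = (\<Sum>i\<in>UNIV. ?T i t)"
      by (intro sum.cong refl nn_integral_add) measurable
    also have "\<dots> = ennreal (\<Sum>i\<in>UNIV. S i t)" using S t by (simp add: sum_ennreal)
    finally show ?thesis .
  qed
  have "((\<lambda>t. ennreal (\<Sum>i\<in>UNIV. S i t)) \<longlongrightarrow> ennreal (\<Sum>i\<in>UNIV. L i)) at_top"
    by (intro tendsto_ennrealI tendsto_sum S)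
  moreover have "\<forall>\<^sub>F t in at_top. ennreal (\<Sum>i\<in>UNIV. S i t) = (\<integral>\<^sup>+ \<omega>. ennreal ((norm (x t \<omega>))\<^sup>2 + (norm (v t \<omega>))\<^sup>2) \<partial>M)"
    using eventually_ge_at_top[of "0::real"] by eventually_elim (rule eq[symmetric])
  ultimately have "((\<lambda>t. \<integral>\<^sup>+ \<omega>. ennreal ((norm (x t \<omega>))\<^sup>2 + (norm (v t \<omega>))\<^sup>2) \<partial>M) \<longlongrightarrow> ennreal (\<Sum>i\<in>UNIV. L i)) at_top"
    by (rule Lim_transform_eventually)
  then show "\<exists>L::real. ((\<lambda>t. \<integral>\<^sup>+ \<omega>. ennreal ((norm (x t \<omega>))\<^sup>2 + (norm (v t \<omega>))\<^sup>2) \<partial>M) \<longlongrightarrow> ennreal L) at_top" ..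
qed

end

section \<open>Instability\<close>

lemma delay_solution_of_root:
  assumes z: "char_fun \<eta> c z = 0"
  shows "delay_solution \<eta> c (\<lambda>_. 0) (\<lambda>t. Re (exp (z * of_real t))) (\<lambda>t. Re (z * exp (z * of_real t)))"
proof -
  let ?p = "\<lambda>t. Re (exp (z * of_real t))" and ?n = "\<lambda>t. Re (z * exp (z * of_real t))"
  have D: "((\<lambda>t. Re (a * exp (z * of_real t))) has_real_derivative Re (a * (z * exp (z * of_real t)))) (at t within S)"
    for a t S
  proof -
    have "((\<lambda>t. a * exp (z * of_real t)) has_vector_derivative a * (z * exp (z * of_real t))) (at t within S)"
      by (rule has_vector_derivative_real_field[of "\<lambda>y. a * exp (z * y)"]) (auto intro!: derivative_eq_intros)
    then show ?thesis
      unfolding has_real_derivative_iff_has_vector_derivative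
      by (rule bounded_linear.has_vector_derivative[OF bounded_linear_Re])
  qed
  have c: "continuous_on S (\<lambda>t. Re (a * exp (z * of_real t)))" for a S
    by (intro continuous_intros)
  have root: "z * (z * w) = - (of_real \<eta> * (z * w)) - of_real c * (exp (- z) * w)" for w
  proof -
    have "(z\<^sup>2 + of_real \<eta> * z + of_real c * exp (- z)) * w = 0" using z by (simp add: char_fun_def)
    then show ?thesis by algebra
  qed
  have n': "Re (z * (z * exp (z * of_real t))) = - (\<eta> * ?n t) - c * ?p (t - 1)" for t
  proof -
    have "exp (- z) * exp (z * of_real t) = exp (z * of_real (t - 1))"
      unfolding mult_exp_exp by (rule arg_cong[of _ _ exp]) (simp add: algebra_simps)
    then have "z * (z * exp (z * of_real t)) = - (of_real \<eta> * (z * exp (z * of_real t))) - of_real c * exp (z * of_real (t - 1))"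
      using root[of "exp (z * of_real t)"] by simp
    then show ?thesis by simp
  qed
  show ?thesis unfolding delay_solution_def
  proof (intro conjI allI impI)
    show "continuous_on {-1..} ?p" using c[of _ 1] by simp
    show "continuous_on {0..} ?n" by (rule c)
    fix t :: real assume t: "t \<ge> 0"
    have "(?n has_integral (?p t - ?p 0)) {0..t}"
      by (rule integral_eq_of_derivative_Ici[OF _ t]) (use D[of 1] in simp)
    then show "?p t = ?p 0 + integral {0..t} ?n" by (simp only: integral_unique)
    have "((\<lambda>s. - (\<eta> * ?n s) - c * ?p (s - 1)) has_integral (?n t - ?n 0)) {0..t}"
      by (rule integral_eq_of_derivative_Ici[OF _ t]) (use D[of z] in \<open>simp only: n'\<close>)
    then show "?n t = ?n 0 + integral {0..t} (\<lambda>s. - (\<eta> * ?n s) - c * ?p (s - 1)) + 0"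
      by (simp only: integral_unique)
  qed simp
qed

text \<open>Sampling at multiples of the period \<open>2 * pi / \<bar>Im z\<bar>\<close>, where the
  cosine is 1, or at integers when \<open>Im z = 0\<close>.\<close>

lemma exp_unbounded:
  assumes "Re z > 0" shows "\<exists>t\<ge>T. Re (exp (z * of_real t)) > B"
proof -
  define d where "d = (if Im z = 0 then 1 else 2 * pi / \<bar>Im z\<bar>)"
  have d: "d > 0" by (simp add: d_def)
  have cos: "cos (Im z * (real n * d)) = 1" for n
  proof (cases "Im z = 0")
    case False
    then have "Im z * (real n * d) = 2 * pi * real n \<or> Im z * (real n * d) = - (2 * pi * real n)"
      by (cases "Im z > 0") (auto simp: d_def)
    then show ?thesis by (metis cos_2npi cos_minus mult.commute mult.assoc)
  qed simp
  obtain n where n: "real n > max T (\<bar>B\<bar> / Re z) / d" using reals_Archimedean2 by blast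
  define t where "t = real n * d"
  have t: "t > T" "t > \<bar>B\<bar> / Re z" using n d by (auto simp: t_def field_simps)
  have "B \<le> \<bar>B\<bar>" by simp
  also have "\<dots> < Re z * t" using t(2) assms by (simp add: field_simps)
  also have "\<dots> < exp (Re z * t)" using exp_ge_add_one_self[of "Re z * t"] by linarith
  also have "\<dots> = Re (exp (z * of_real t))" using cos[of n] by (simp add: Re_exp t_def)
  finally show ?thesis using t by (intro exI[of _ t]) auto
qed

text \<open>Superposition, used twice: with \<open>f\<close> a noise component, to assemble a
  solution mode by mode, and with \<open>f = 0\<close>, to add an unbounded mode. The noise has to
  match only after applying \<open>Omega\<close>.\<close>

lemma path_equations_mode:
  fixes K :: "real ^ 'n ^ 'n"
  assumes P: "path_equations \<eta> K b x v" and Ku: "K *v u = m *\<^sub>R u"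
    and D: "delay_solution \<eta> (\<eta> * m) f p n" and b': "\<And>t. t \<ge> 0 \<Longrightarrow> Omega *v b' t = Omega *v b t + f t *\<^sub>R u"
    and b'c: "continuous_on {0..} b'"
  shows "path_equations \<eta> K b' (\<lambda>t. x t + p t *\<^sub>R u) (\<lambda>t. v t + n t *\<^sub>R u)"
proof -
  have xc: "continuous_on {-1..} x" and vc: "continuous_on {0..} v"
    using P by (auto simp: path_equations_def)
  have pc: "continuous_on {-1..} p" and nc: "continuous_on {0..} n"
    using D by (auto simp: delay_solution_def)
  have x1: "continuous_on {0..} (\<lambda>s. x (s - 1))" and p1: "continuous_on {0..} (\<lambda>s. p (s - 1))"
    by (rule continuous_on_compose2[OF xc] continuous_on_compose2[OF pc]; auto intro!: continuous_intros)+
  let ?F = "\<lambda>s. - (\<eta> *\<^sub>R v s) - \<eta> *\<^sub>R (K *v x (s - 1))" and ?G = "\<lambda>s. - (\<eta> * n s) - \<eta> * m * p (s - 1)"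
  have Fc: "continuous_on {0..} ?F"
    by (intro continuous_intros vc continuous_on_compose2[OF matrix_vector_mult_linear_continuous_on x1]) auto
  have Gc: "continuous_on {0..} ?G" by (intro continuous_intros nc p1)
  have I: "h integrable_on {0..t}" if "continuous_on {0..} h" for h :: "real \<Rightarrow> 'b::euclidean_space" and t
    by (intro integrable_continuous_real continuous_on_subset[OF that]) auto
  show ?thesis unfolding path_equations_def
  proof (intro conjI allI impI b'c)
    show "continuous_on {-1..} (\<lambda>t. x t + p t *\<^sub>R u)" "continuous_on {0..} (\<lambda>t. v t + n t *\<^sub>R u)"
      by (intro continuous_intros xc pc vc nc)+
    fix t :: real assume t: "t \<ge> 0"
    have xt: "x t = x 0 + integral {0..t} v" and vt: "v t = v 0 + integral {0..t} ?F + Omega *v b t"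
      using P t unfolding path_equations_def by blast+
    have pt: "p t = p 0 + integral {0..t} n" and nt: "n t = n 0 + integral {0..t} ?G + f t"
      using D t unfolding delay_solution_def by blast+
    have "integral {0..t} (\<lambda>s. v s + n s *\<^sub>R u) = integral {0..t} v + integral {0..t} n *\<^sub>R u"
      by (intro integral_unique has_integral_add has_integral_scaleR_left integrable_integral I vc nc)
    then show "x t + p t *\<^sub>R u = x 0 + p 0 *\<^sub>R u + integral {0..t} (\<lambda>s. v s + n s *\<^sub>R u)"
      using arg_cong[OF pt, of "\<lambda>y. y *\<^sub>R u"] xt by (simp add: scaleR_add_left)
    have "(\<lambda>s. - (\<eta> *\<^sub>R (v s + n s *\<^sub>R u)) - \<eta> *\<^sub>R (K *v (x (s - 1) + p (s - 1) *\<^sub>R u)))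
        = (\<lambda>s. ?F s + ?G s *\<^sub>R u)"
      by (intro ext) (simp add: Ku matrix_vector_right_distrib matrix_vector_mult_scaleR algebra_simps)
    moreover have "integral {0..t} (\<lambda>s. ?F s + ?G s *\<^sub>R u) = integral {0..t} ?F + integral {0..t} ?G *\<^sub>R u"
      by (intro integral_unique has_integral_add has_integral_scaleR_left integrable_integral I Fc Gc)
    ultimately show "v t + n t *\<^sub>R u = v 0 + n 0 *\<^sub>R u
        + integral {0..t} (\<lambda>s. - (\<eta> *\<^sub>R (v s + n s *\<^sub>R u)) - \<eta> *\<^sub>R (K *v (x (s - 1) + p (s - 1) *\<^sub>R u))) + Omega *v b' t"
      using arg_cong[OF nt, of "\<lambda>y. y *\<^sub>R u"] vt b'[OF t] by (simp add: scaleR_add_left algebra_simps)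
  qed
qed

text \<open>The integral is a limit of Riemann sums, so it inherits measurability from the values up
  to time \<open>t\<close>; adaptedness of the constructed solution rests on this.\<close>

lemma convolution_measurable:
  fixes f :: "real \<Rightarrow> 'a \<Rightarrow> real"
  assumes q: "continuous_on {0..} q" and t: "t \<ge> 0"
    and m: "\<And>s. s \<in> {0..t} \<Longrightarrow> f s \<in> borel_measurable G" and c: "\<And>\<omega>. continuous_on {0..} (\<lambda>s. f s \<omega>)"
  shows "(\<lambda>\<omega>. integral {0..t} (\<lambda>s. q (t - s) * f s \<omega>)) \<in> borel_measurable G"
proof (rule borel_measurable_LIMSEQ_real)
  fix \<omega>
  have "continuous_on {0..t} (\<lambda>s. q (t - s))"
    by (rule continuous_on_compose2[OF q]) (auto intro!: continuous_intros)
  then have h: "continuous_on {0..t} (\<lambda>s. q (t - s) * f s \<omega>)"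
    by (intro continuous_on_mult continuous_on_subset[OF c]) auto
  obtain B where "\<forall>y\<in>(\<lambda>s. q (t - s) * f s \<omega>) ` {0..t}. norm y \<le> B"
    using compact_imp_bounded[OF compact_continuous_image[OF h compact_Icc]] unfolding bounded_iff by blast
  then have B: "\<bar>q (t - s) * f s \<omega>\<bar> \<le> B" if "s \<in> {0..t}" for s using that by auto
  show "(\<lambda>n. \<Sum>j=1..Suc n. t / Suc n * (q (t - j * (t / Suc n)) * f (j * (t / Suc n)) \<omega>))
      \<longlonglongrightarrow> integral {0..t} (\<lambda>s. q (t - s) * f s \<omega>)"
  proof (rule right_riemann_sums_tendsto[OF t, of "{}", OF _ _ B])
    fix s assume s: "s \<in> {0<..<t} - {}"
    have "continuous_on {0<..<t} (\<lambda>s. q (t - s) * f s \<omega>)" by (rule continuous_on_subset[OF h]) auto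
    then show "isCont (\<lambda>s. q (t - s) * f s \<omega>) s" using s by (simp add: continuous_on_eq_continuous_at)
  qed simp_all
next
  fix n
  have "f (j * (t / Suc n)) \<in> borel_measurable G" if "j \<in> {1..Suc n}" for j
  proof (rule m)
    show "real j * (t / Suc n) \<in> {0..t}"
      using that t mult_left_mono[of "real j" "1 + real n" t] by (auto simp: field_simps)
  qed
  then show "(\<lambda>\<omega>. \<Sum>j=1..Suc n. t / Suc n * (q (t - j * (t / Suc n)) * f (j * (t / Suc n)) \<omega>)) \<in> borel_measurable G"
    by (intro borel_measurable_sum borel_measurable_times borel_measurable_const)
qed

context prob_space
begin

text \<open>The solution is assembled from scalar solutions along the eigenvectors. On a null set the
  noise path is replaced by 0; this null set belongs to the augmented filtration.\<close>

lemma zero_data_solution_ex: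
  fixes w :: "real \<Rightarrow> 'a \<Rightarrow> real ^ 'n" and K :: "real ^ 'n ^ 'n" and u :: "'n \<Rightarrow> real ^ 'n"
  assumes w: "vector_brownian_motion w" and K: "transpose K = K"
    and uu: "\<And>i j. u i \<bullet> u j = (if i = j then 1 else 0)" and Ku: "\<And>i. K *v u i = \<mu> i *\<^sub>R u i"
    and expand: "\<And>x. (\<Sum>i\<in>UNIV. (u i \<bullet> x) *\<^sub>R u i) = x"
    and i1: "u i1 = (1 / sqrt CARD('n)) *\<^sub>R ones"
  obtains x v where "network_error_solution w \<eta> K (\<lambda>_. 0) 0 x v"
proof -
  obtain N where good: "\<And>\<omega>. \<omega> \<in> space M - N \<Longrightarrow> w 0 \<omega> = 0 \<and> continuous_on {0..} (\<lambda>t. w t \<omega>)"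
    and N: "N \<in> null_sets M"
    by (rule AE_E3[OF vector_brownian_AE[OF w]]) (rule that)
  define W where "W t \<omega> = (if \<omega> \<in> space M - N then w t \<omega> else 0)" for t \<omega>
  have Wc: "continuous_on {0..} (\<lambda>t. W t \<omega>)" for \<omega>
  proof (cases "\<omega> \<in> space M - N")
    case True
    then have "(\<lambda>t. W t \<omega>) = (\<lambda>t. w t \<omega>)" by (simp only: W_def if_True)
    then show ?thesis using good[OF True] by (simp only:)
  next
    case False
    then have "(\<lambda>t. W t \<omega>) = (\<lambda>t. 0)" by (simp only: W_def if_False)
    then show ?thesis by (simp only: continuous_on_const)
  qed
  have W0: "W 0 \<omega> = 0" for \<omega> using good[of \<omega>] by (simp add: W_def)
  let ?f = "\<lambda>i \<omega> t. u i \<bullet> W t \<omega>"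
  have fc: "continuous_on {0..} (?f i \<omega>)" for i \<omega> by (intro continuous_intros Wc)
  have "\<exists>p n. delay_solution \<eta> (\<eta> * \<mu> i) (?f i \<omega>) p n \<and> (\<forall>t\<le>0. p t = 0) \<and> n 0 = 0" for i \<omega>
    by (rule delay_solution_ex[OF fc[of i \<omega>], of \<eta> "\<eta> * \<mu> i"]) (auto simp: W0)
  then obtain p n where pn: "\<And>i \<omega>. delay_solution \<eta> (\<eta> * \<mu> i) (?f i \<omega>) (p i \<omega>) (n i \<omega>)"
    and p0: "\<And>i \<omega> t. t \<le> 0 \<Longrightarrow> p i \<omega> t = 0" and n0: "\<And>i \<omega>. n i \<omega> 0 = 0"
    by metis
  define x where "x t \<omega> = (\<Sum>i\<in>UNIV - {i1}. p i \<omega> t *\<^sub>R u i)" for t \<omega>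
  define v where "v t \<omega> = (\<Sum>i\<in>UNIV - {i1}. n i \<omega> t *\<^sub>R u i)" for t \<omega>
  have ou: "ones \<bullet> u i = 0" if "i \<noteq> i1" for i
  proof -
    have "u i1 \<bullet> u i = 0" using uu[of i1 i] that by simp
    then show ?thesis unfolding i1 by simp
  qed
  have Omu: "Omega *v u i = u i" if "i \<noteq> i1" for i
  proof -
    have "(\<chi> i j. ones $ i * ones $ j) *v u i = (ones \<bullet> u i) *\<^sub>R (ones :: real ^ 'n)"
      by (simp add: vec_eq_iff matrix_vector_mult_def inner_vec_def sum_distrib_left ones_def)
    then show ?thesis
      by (simp add: Omega_def matrix_vector_mult_diff_rdistrib scaleR_matrix_vector_assoc[symmetric] ou[OF that])
  qed
  have Om: "Omega *v y = (\<Sum>i\<in>UNIV - {i1}. (u i \<bullet> y) *\<^sub>R u i)" for y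
  proof -
    have "(\<Sum>i\<in>UNIV. (u i \<bullet> (Omega *v y)) *\<^sub>R u i) = (\<Sum>i\<in>UNIV - {i1}. (u i \<bullet> y) *\<^sub>R u i)"
      by (rule sum.mono_neutral_cong_right) (auto simp: i1 Omega_mult_ones_inner Omega_mult_inner[OF ou])
    then show ?thesis unfolding expand .
  qed
  \<comment> \<open>Induction over sets of eigenvectors orthogonal to \<open>ones\<close>, on each
    of which \<open>Omega\<close> acts as the identity.\<close>
  have partial: "path_equations \<eta> K (\<lambda>t. \<Sum>i\<in>A. ?f i \<omega> t *\<^sub>R u i) (\<lambda>t. \<Sum>i\<in>A. p i \<omega> t *\<^sub>R u i) (\<lambda>t. \<Sum>i\<in>A. n i \<omega> t *\<^sub>R u i)"
    if "finite A" "A \<subseteq> UNIV - {i1}" for A \<omega>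
    using that
  proof (induction A)
    case empty
    then show ?case by (simp add: path_equations_def)
  next
    case (insert i A)
    have "path_equations \<eta> K (\<lambda>t. (\<Sum>i\<in>A. ?f i \<omega> t *\<^sub>R u i) + ?f i \<omega> t *\<^sub>R u i)
        (\<lambda>t. (\<Sum>i\<in>A. p i \<omega> t *\<^sub>R u i) + p i \<omega> t *\<^sub>R u i) (\<lambda>t. (\<Sum>i\<in>A. n i \<omega> t *\<^sub>R u i) + n i \<omega> t *\<^sub>R u i)"
    proof (rule path_equations_mode[OF _ Ku pn])
      show "path_equations \<eta> K (\<lambda>t. \<Sum>i\<in>A. ?f i \<omega> t *\<^sub>R u i) (\<lambda>t. \<Sum>i\<in>A. p i \<omega> t *\<^sub>R u i) (\<lambda>t. \<Sum>i\<in>A. n i \<omega> t *\<^sub>R u i)"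
        using insert by blast
      show "Omega *v ((\<Sum>i\<in>A. ?f i \<omega> t *\<^sub>R u i) + ?f i \<omega> t *\<^sub>R u i) = Omega *v (\<Sum>i\<in>A. ?f i \<omega> t *\<^sub>R u i) + ?f i \<omega> t *\<^sub>R u i" for t
        using insert.prems Omu[of i] by (simp add: matrix_vector_right_distrib matrix_vector_mult_scaleR)
      show "continuous_on {0..} (\<lambda>t. (\<Sum>i\<in>A. ?f i \<omega> t *\<^sub>R u i) + ?f i \<omega> t *\<^sub>R u i)"
        by (intro continuous_on_add continuous_on_sum continuous_on_scaleR continuous_on_const fc)
    qed
    then show ?case using insert.hyps by (simp add: add.commute)
  qed
  have path: "path_equations \<eta> K (\<lambda>t. \<Sum>i\<in>UNIV - {i1}. ?f i \<omega> t *\<^sub>R u i) (\<lambda>t. x t \<omega>) (\<lambda>t. v t \<omega>)" for \<omega>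
    unfolding x_def v_def by (rule partial) auto
  \<comment> \<open>The assembled noise is \<open>Omega *v W t \<omega>\<close>, and idempotence of
    the projection gives it the same image as \<open>W t \<omega>\<close>.\<close>
  have OmOm: "Omega *v (\<Sum>i\<in>UNIV - {i1}. ?f i \<omega> t *\<^sub>R u i) = Omega *v W t \<omega>" for t \<omega>
  proof -
    have "Omega *v (Omega *v W t \<omega>) = Omega *v W t \<omega>"
      unfolding Om[of "Omega *v W t \<omega>"] unfolding Om[of "W t \<omega>"]
      by (intro sum.cong refl) (auto simp: Om[of "W t \<omega>", symmetric] Omega_mult_inner[OF ou])
    then show ?thesis unfolding Om[of "W t \<omega>"] .
  qed
  have Wm: "W s \<in> borel_measurable (augmented_filtration w t)" if "0 \<le> s" "s \<le> t" for s t
  proof -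
    let ?G = "{w s -` A \<inter> space M | s A. 0 \<le> s \<and> s \<le> t \<and> A \<in> sets borel} \<union> null_sets M"
    have G: "?G \<subseteq> sets M"
      using vector_brownian_measurable[OF w] by (auto intro!: measurable_sets)
    then have pow: "?G \<subseteq> Pow (space M)" using sets.space_closed by blast
    have sp: "space (augmented_filtration w t) = space M"
      using pow by (simp add: augmented_filtration_def space_measure_of)
    have gen: "a \<in> sets (augmented_filtration w t)" if "a \<in> ?G" for a
      using that pow by (simp add: augmented_filtration_def sets_measure_of sigma_sets.Basic)
    have ws: "w s \<in> borel_measurable (augmented_filtration w t)"
    proof (rule measurableI)
      fix A :: "(real ^ 'n) set" assume "A \<in> sets borel"
      then show "w s -` A \<inter> space (augmented_filtration w t) \<in> sets (augmented_filtration w t)"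
        unfolding sp using that by (intro gen) blast
    qed simp
    have "N \<in> sets (augmented_filtration w t)" using N by (intro gen) blast
    then have "space (augmented_filtration w t) - N \<in> sets (augmented_filtration w t)" by (rule sets.compl_sets)
    then have "(\<lambda>\<omega>. if \<omega> \<in> space M - N then w s \<omega> else 0) \<in> borel_measurable (augmented_filtration w t)"
      unfolding sp[symmetric] by (intro measurable_If_set ws) auto
    then show ?thesis by (simp add: W_def[abs_def])
  qed
  \<comment> \<open>\<open>p\<close> and \<open>n\<close> were chosen separately for each path,
    which says nothing about measurability. The representation formulas exhibit them as convolutions
    of the noise up to time \<open>t\<close>.\<close>
  have pm: "(\<lambda>\<omega>. p i \<omega> t) \<in> borel_measurable (augmented_filtration w t)"
    "(\<lambda>\<omega>. n i \<omega> t) \<in> borel_measurable (augmented_filtration w t)" if t: "t \<ge> 0" for i t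
  proof -
    obtain g k where "fundamental_solution \<eta> (\<eta> * \<mu> i) g k" using fundamental_solution_ex by blast
    then interpret fundamental_solution \<eta> "\<eta> * \<mu> i" g k .
    have f0: "?f i \<omega> 0 = 0" for \<omega> by (simp add: W0)
    have z: "integral {0..1} (\<lambda>s. h s * p i \<omega> (s - 1)) = 0" for h :: "real \<Rightarrow> real" and \<omega>
      by (rule integral_unique, rule has_integral_is_0) (simp add: p0)
    have pe: "p i \<omega> t = g 0 * ?f i \<omega> t + integral {0..t} (\<lambda>s. k (t - s) * ?f i \<omega> s)" for \<omega>
      using position_representation[OF pn f0 t] by (simp add: z p0 n0)
    have ne: "n i \<omega> t = k 0 * ?f i \<omega> t + integral {0..t} (\<lambda>s. k' (t - s) * ?f i \<omega> s)" for \<omega>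
      using velocity_representation[OF pn f0 t] by (simp add: z p0 n0)
    have fm: "(\<lambda>\<omega>. ?f i \<omega> s) \<in> borel_measurable (augmented_filtration w t)" if "s \<in> {0..t}" for s
    proof -
      have [measurable]: "W s \<in> borel_measurable (augmented_filtration w t)" using Wm[of s t] that by simp
      show ?thesis by measurable
    qed
    show "(\<lambda>\<omega>. p i \<omega> t) \<in> borel_measurable (augmented_filtration w t)"
      unfolding pe using t
      by (intro borel_measurable_add borel_measurable_times borel_measurable_const fm
          convolution_measurable[OF k_cont] fc) auto
    show "(\<lambda>\<omega>. n i \<omega> t) \<in> borel_measurable (augmented_filtration w t)"
      unfolding ne using t
      by (intro borel_measurable_add borel_measurable_times borel_measurable_const fm
          convolution_measurable[OF k'_cont] fc) auto
  qed
  have "network_error_solution w \<eta> K (\<lambda>_. 0) 0 x v"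
    unfolding network_error_solution_def
  proof (intro conjI allI impI)
    fix t :: real assume t: "0 \<le> t"
    show "x t \<in> borel_measurable (augmented_filtration w t)" "v t \<in> borel_measurable (augmented_filtration w t)"
      unfolding x_def[abs_def] v_def[abs_def]
      by (intro borel_measurable_sum borel_measurable_scaleR borel_measurable_const pm t)+
  next
    have "AE \<omega> in M. \<omega> \<in> space M - N" using AE_not_in[OF N] by (auto elim: AE_mp)
    then show "AE \<omega> in M. continuous_on {-1..} (\<lambda>t. x t \<omega>) \<and> continuous_on {0..} (\<lambda>t. v t \<omega>) \<and>
        (\<forall>s\<in>{-1..0}. x s \<omega> = 0) \<and> v 0 \<omega> = 0 \<and>
        (\<forall>t\<ge>-1. ones \<bullet> x t \<omega> = 0) \<and>
        (\<forall>t\<ge>0. x t \<omega> = x 0 \<omega> + integral {0..t} (\<lambda>s. v s \<omega>)) \<and>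
        (\<forall>t\<ge>0. v t \<omega> = v 0 \<omega>
           + integral {0..t} (\<lambda>s. - (\<eta> *\<^sub>R v s \<omega>) - \<eta> *\<^sub>R (K *v x (s - 1) \<omega>))
           + Omega *v (w t \<omega> - w 0 \<omega>))"
    proof eventually_elim
      case (elim \<omega>)
      then have Ww: "W t \<omega> = w t \<omega> - w 0 \<omega>" for t using W0[of \<omega>] by (simp add: W_def)
      have "\<forall>s\<in>{-1..0}. x s \<omega> = 0" by (simp add: x_def p0)
      moreover have "v 0 \<omega> = 0" by (simp add: v_def n0)
      moreover have "\<forall>t\<ge>-1. ones \<bullet> x t \<omega> = 0" by (simp add: x_def inner_sum_right ou)
      ultimately show ?case
        using path[of \<omega>, unfolded path_equations_def, unfolded OmOm, unfolded Ww] by (elim conjE, intro conjI) assumption+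
    qed
  qed
  then show ?thesis by (rule that)
qed

lemma network_error_solution_mode:
  fixes w :: "real \<Rightarrow> 'a \<Rightarrow> real ^ 'n"
  assumes w: "vector_brownian_motion w" and sol: "network_error_solution w \<eta> K (\<lambda>_. 0) 0 x v"
    and u: "K *v u = m *\<^sub>R u" "ones \<bullet> u = 0" and D: "delay_solution \<eta> (\<eta> * m) (\<lambda>_. 0) p n"
  shows "network_error_solution w \<eta> K (\<lambda>s. p s *\<^sub>R u) (n 0 *\<^sub>R u)
    (\<lambda>t \<omega>. x t \<omega> + p t *\<^sub>R u) (\<lambda>t \<omega>. v t \<omega> + n t *\<^sub>R u)"
  unfolding network_error_solution_def
proof (intro conjI allI impI)
  fix t :: real assume "0 \<le> t"
  then show "(\<lambda>\<omega>. x t \<omega> + p t *\<^sub>R u) \<in> borel_measurable (augmented_filtration w t)"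
    "(\<lambda>\<omega>. v t \<omega> + n t *\<^sub>R u) \<in> borel_measurable (augmented_filtration w t)"
    using sol unfolding network_error_solution_def by (auto intro!: borel_measurable_add)
next
  have orth: "AE \<omega> in M. \<forall>t\<ge>-1. ones \<bullet> x t \<omega> = 0"
    using conjunct2[OF sol[unfolded network_error_solution_def]] by eventually_elim blast
  show "AE \<omega> in M. continuous_on {-1..} (\<lambda>t. x t \<omega> + p t *\<^sub>R u) \<and> continuous_on {0..} (\<lambda>t. v t \<omega> + n t *\<^sub>R u) \<and>
      (\<forall>s\<in>{-1..0}. x s \<omega> + p s *\<^sub>R u = p s *\<^sub>R u) \<and> v 0 \<omega> + n 0 *\<^sub>R u = n 0 *\<^sub>R u \<and>
      (\<forall>t\<ge>-1. ones \<bullet> (x t \<omega> + p t *\<^sub>R u) = 0) \<and>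
      (\<forall>t\<ge>0. x t \<omega> + p t *\<^sub>R u = x 0 \<omega> + p 0 *\<^sub>R u + integral {0..t} (\<lambda>s. v s \<omega> + n s *\<^sub>R u)) \<and>
      (\<forall>t\<ge>0. v t \<omega> + n t *\<^sub>R u = v 0 \<omega> + n 0 *\<^sub>R u
         + integral {0..t} (\<lambda>s. - (\<eta> *\<^sub>R (v s \<omega> + n s *\<^sub>R u)) - \<eta> *\<^sub>R (K *v (x (s - 1) \<omega> + p (s - 1) *\<^sub>R u)))
         + Omega *v (w t \<omega> - w 0 \<omega>))"
    using network_error_solution_path[OF w sol] orth
  proof eventually_elim
    case (elim \<omega>)
    have P: "path_equations \<eta> K (\<lambda>t. w t \<omega>) (\<lambda>t. x t \<omega>) (\<lambda>t. v t \<omega>)" and w0: "w 0 \<omega> = 0"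
      and x0: "\<forall>s\<in>{-1..0}. x s \<omega> = 0" and v0: "v 0 \<omega> = 0" and ox: "\<forall>t\<ge>-1. ones \<bullet> x t \<omega> = 0"
      using elim by blast+
    have Omw: "Omega *v (w t \<omega> - w 0 \<omega>) = Omega *v w t \<omega>" for t unfolding w0 by simp
    have "path_equations \<eta> K (\<lambda>t. w t \<omega>) (\<lambda>t. x t \<omega> + p t *\<^sub>R u) (\<lambda>t. v t \<omega> + n t *\<^sub>R u)"
    proof (rule path_equations_mode[OF P u(1) D])
      show "continuous_on {0..} (\<lambda>t. w t \<omega>)" using P unfolding path_equations_def by (elim conjE)
    qed simp
    moreover have "\<forall>s\<in>{-1..0}. x s \<omega> + p s *\<^sub>R u = p s *\<^sub>R u" using x0 by simp
    moreover have "v 0 \<omega> + n 0 *\<^sub>R u = n 0 *\<^sub>R u" using v0 by simp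
    moreover have "\<forall>t\<ge>-1. ones \<bullet> (x t \<omega> + p t *\<^sub>R u) = 0" using ox u(2) by (simp add: inner_add_right)
    ultimately show ?case
      unfolding path_equations_def Omw by (elim conjE, intro conjI) assumption+
  qed
qed

text \<open>The difference of two solutions driven by the same noise is deterministic, so that an
  unbounded deterministic solution excludes that both second moments stay bounded.\<close>

lemma mean_square_unstable_of_mode:
  fixes w :: "real \<Rightarrow> 'a \<Rightarrow> real ^ 'n"
  assumes w: "vector_brownian_motion w" and sol: "network_error_solution w \<eta> K (\<lambda>_. 0) 0 x v"
    and u: "K *v u = m *\<^sub>R u" "ones \<bullet> u = 0" "u \<bullet> u = 1" and D: "delay_solution \<eta> (\<eta> * m) (\<lambda>_. 0) p n"
    and unb: "\<And>T B. \<exists>t\<ge>T. p t > B"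
  shows "mean_square_unstable w \<eta> K"
  unfolding mean_square_unstable_def
proof
  assume st: "mean_square_stable w \<eta> K"
  let ?E = "\<lambda>x v t. \<integral>\<^sup>+ \<omega>. ennreal ((norm (x t \<omega>))\<^sup>2 + (norm (v t \<omega> :: real ^ 'n))\<^sup>2) \<partial>M"
  let ?x = "\<lambda>t \<omega>. x t \<omega> + p t *\<^sub>R u" and ?v = "\<lambda>t \<omega>. v t \<omega> + n t *\<^sub>R u"
  have sol': "network_error_solution w \<eta> K (\<lambda>s. p s *\<^sub>R u) (n 0 *\<^sub>R u) ?x ?v"
    by (rule network_error_solution_mode[OF w sol u(1,2) D])
  have pc: "continuous_on {-1..} p" using D by (auto simp: delay_solution_def)
  have adm: "admissible_initial_data (\<lambda>_. 0) (0 :: real ^ 'n)" by (simp add: admissible_initial_data_def)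
  have adm': "admissible_initial_data (\<lambda>s. p s *\<^sub>R u) (n 0 *\<^sub>R u)"
    using u(2) by (auto simp: admissible_initial_data_def intro!: continuous_intros continuous_on_subset[OF pc])
  have bdd: "\<exists>B::real. B \<ge> 0 \<and> (\<forall>\<^sub>F t in at_top. ?E x v t \<le> ennreal B)"
    if ad: "admissible_initial_data hist v0" and so: "network_error_solution w \<eta> K hist v0 x v" for hist v0 x v
  proof -
    obtain L :: real where "(?E x v \<longlongrightarrow> ennreal L) at_top"
      using st ad so unfolding mean_square_stable_def by blast
    then have "\<forall>\<^sub>F t in at_top. ?E x v t < ennreal (max L 0 + 1)"
      by (rule order_tendstoD) (auto simp: ennreal_less_iff ennreal_neg max_def intro: le_less_trans)
    then show ?thesis
      by (intro exI[of _ "max L 0 + 1"] conjI) (auto elim!: eventually_mono)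
  qed
  obtain B1 B2 where B: "B1 \<ge> 0" "B2 \<ge> 0" "\<forall>\<^sub>F t in at_top. ?E x v t \<le> ennreal B1" "\<forall>\<^sub>F t in at_top. ?E ?x ?v t \<le> ennreal B2"
    using bdd[OF adm sol] bdd[OF adm' sol'] by blast
  from eventually_conj[OF B(3,4)] obtain T where T: "\<And>t. t \<ge> T \<Longrightarrow> ?E x v t \<le> ennreal B1 \<and> ?E ?x ?v t \<le> ennreal B2"
    unfolding eventually_at_top_linorder by blast
  \<comment> \<open>The threshold also exceeds 1, so that \<open>p t \<le> (p t)\<^sup>2\<close> and
    no square root is required.\<close>
  obtain t where t: "t \<ge> max T 0" "p t > 2 * B1 + 2 * B2 + 1" using unb by blast
  have [measurable]: "x t \<in> borel_measurable M" "v t \<in> borel_measurable M"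
    using sol t augmented_filtration_measurable[OF w] unfolding network_error_solution_def by auto
  let ?A = "\<lambda>\<omega>. (norm (x t \<omega>))\<^sup>2 + (norm (v t \<omega>))\<^sup>2" and ?C = "\<lambda>\<omega>. (norm (?x t \<omega>))\<^sup>2 + (norm (?v t \<omega>))\<^sup>2"
  have le: "(p t)\<^sup>2 \<le> 2 * ?A \<omega> + 2 * ?C \<omega>" for \<omega>
  proof -
    have nu: "norm u = 1" using u(3) by (simp add: norm_eq_1)
    have "\<bar>p t\<bar> = norm (?x t \<omega> - x t \<omega>)" using nu by simp
    also have "\<dots> \<le> norm (?x t \<omega>) + norm (x t \<omega>)" by (rule norm_triangle_ineq4)
    finally have "\<bar>p t\<bar>\<^sup>2 \<le> (norm (?x t \<omega>) + norm (x t \<omega>))\<^sup>2" by (intro power_mono) auto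
    also have "\<dots> \<le> 2 * (norm (?x t \<omega>))\<^sup>2 + 2 * (norm (x t \<omega>))\<^sup>2"
      using square_add_le[of 1 "norm (?x t \<omega>)" "norm (x t \<omega>)"] by simp
    also have "\<dots> \<le> 2 * ?A \<omega> + 2 * ?C \<omega>"
      by (simp add: distrib_left)
    finally show ?thesis by simp
  qed
  have dbl: "ennreal (2 * a + 2 * c) = 2 * ennreal a + 2 * ennreal c" if "a \<ge> 0" "c \<ge> 0" for a c
    using that by (simp add: ennreal_mult)
  have "ennreal ((p t)\<^sup>2) = (\<integral>\<^sup>+ \<omega>. ennreal ((p t)\<^sup>2) \<partial>M)" by (simp add: emeasure_space_1)
  also have "\<dots> \<le> (\<integral>\<^sup>+ \<omega>. 2 * ennreal (?A \<omega>) + 2 * ennreal (?C \<omega>) \<partial>M)"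
  proof (rule nn_integral_mono)
    fix \<omega>
    have "ennreal ((p t)\<^sup>2) \<le> ennreal (2 * ?A \<omega> + 2 * ?C \<omega>)" using le by (rule ennreal_leI)
    also have "\<dots> = 2 * ennreal (?A \<omega>) + 2 * ennreal (?C \<omega>)"
      by (rule dbl) auto
    finally show "ennreal ((p t)\<^sup>2) \<le> 2 * ennreal (?A \<omega>) + 2 * ennreal (?C \<omega>)" .
  qed
  also have "\<dots> = (\<integral>\<^sup>+ \<omega>. 2 * ennreal (?A \<omega>) \<partial>M) + (\<integral>\<^sup>+ \<omega>. 2 * ennreal (?C \<omega>) \<partial>M)"
    by (rule nn_integral_add) measurable
  also have "\<dots> = 2 * ?E x v t + 2 * ?E ?x ?v t"
    by (intro arg_cong2[of _ _ _ _ "(+)"] nn_integral_cmult) measurable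
  also have "\<dots> \<le> 2 * ennreal B1 + 2 * ennreal B2"
    using T[of t] t by (intro add_mono mult_left_mono) auto
  also have "\<dots> = ennreal (2 * B1 + 2 * B2)"
    using dbl[OF B(1,2)] by simp
  finally have "(p t)\<^sup>2 \<le> 2 * B1 + 2 * B2" using B(1,2) by (subst (asm) ennreal_le_iff) simp_all
  moreover have "p t * 1 \<le> p t * p t" using t B(1,2) by (intro mult_left_mono) auto
  ultimately show False using t B(1,2) by (simp add: power2_eq_square)
qed

end

text \<open>The unbounded mode for \<open>\<eta> = 0\<close>, where 0 is a double root of the
  characteristic function.\<close>

lemma delay_solution_linear: "delay_solution 0 0 (\<lambda>_. 0) (\<lambda>t. t) (\<lambda>_. 1)"
  by (auto simp: delay_solution_def)

theorem proposition2:
  fixes M :: "'a measure"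
    and w :: "real \<Rightarrow> 'a \<Rightarrow> real ^ 'n"
    and K :: "real ^ 'n ^ 'n"
    and \<eta> :: real
    and lam :: "nat \<Rightarrow> real"
  assumes "CARD('n) \<ge> 2"
    and "prob_space M"
    and "prob_space.vector_brownian_motion M w"
    and "transpose K = K"
    and "K *v ones = 0"
    and "eigenvalue_list K lam"
    and "lam 1 = 0"
  shows "(stability_condition CARD('n) \<eta> lam \<longrightarrow> prob_space.mean_square_stable M w \<eta> K)
    \<and> ((\<forall>h>0. \<exists>!\<beta>. \<beta> \<in> {0<..<pi/2} \<and> \<beta> * tan \<beta> = h)
       \<and> (stability_condition CARD('n) \<eta> lam \<longleftrightarrow>
            (\<forall>j\<in>{2..CARD('n)}. (\<eta>, lam j) \<in> stability_region))
       \<and> concave_on {0..} phi \<and> strict_mono_on {0..} phi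
       \<and> phi 0 = 1 \<and> (phi \<longlongrightarrow> phi 0) (at_right 0)
       \<and> (phi \<longlongrightarrow> pi / 2) at_top)
    \<and> ((\<exists>j\<in>{2..CARD('n)}. (\<eta>, lam j) \<notin> closure stability_region) \<longrightarrow>
         prob_space.mean_square_unstable M w \<eta> K)"
proof -
  interpret prob_space M by fact
  note w = assms(3) and K = assms(4) and Kones = assms(5) and ev = assms(6) and lam1 = assms(7)
  obtain u :: "'n \<Rightarrow> real ^ 'n" and \<mu> :: "'n \<Rightarrow> real" and i1 :: 'n where
    uu: "\<And>i j. u i \<bullet> u j = (if i = j then 1 else 0)" and Ku: "\<And>i. K *v u i = \<mu> i *\<^sub>R u i"
    and expand: "\<And>x. (\<Sum>i\<in>UNIV. (u i \<bullet> x) *\<^sub>R u i) = x"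
    and i1: "u i1 = (1 / sqrt CARD('n)) *\<^sub>R ones" "\<mu> i1 = 0"
    by (rule eigenbasis[OF K Kones]) (rule that)
  \<comment> \<open>Transfers conditions on \<open>lam j\<close> with \<open>j \<ge> 2\<close> to
    the modes orthogonal to \<open>ones\<close> and back; equality of the sets of values suffices
    for both directions.\<close>
  have img: "\<mu> ` (UNIV - {i1}) = lam ` {2..CARD('n)}"
    by (rule eigenvalue_list_image[OF uu Ku ev lam1 i1(2)])
  have stable: "mean_square_stable w \<eta> K" if "stability_condition CARD('n) \<eta> lam"
  proof -
    obtain b where b: "0 < b" "b < pi/2" "\<eta> = b * tan b" "\<And>j. j \<in> {2..CARD('n)} \<Longrightarrow> 0 < lam j \<and> lam j < b / sin b"
      using \<open>stability_condition CARD('n) \<eta> lam\<close> unfolding stability_condition_def by auto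
    have \<eta>: "\<eta> > 0" using b by (auto intro!: mult_pos_pos tan_gt_zero)
    have \<mu>: "0 < \<mu> i" "\<mu> i < b / sin b" if "i \<noteq> i1" for i
    proof -
      have "\<mu> i \<in> lam ` {2..CARD('n)}" using img that by blast
      then show "0 < \<mu> i" "\<mu> i < b / sin b" using b(4) by auto
    qed
    show ?thesis
    proof (rule mean_square_stable_of_no_roots[OF w K uu Ku expand i1 \<eta> \<mu>(1)])
      fix i z assume i: "i \<noteq> i1" and z: "Re z \<ge> 0"
      show "char_fun \<eta> (\<eta> * \<mu> i) z \<noteq> 0"
        by (rule char_fun_no_root[OF b(1-3) mult_pos_pos[OF \<eta> \<mu>(1)[OF i]] mult_strict_left_mono[OF \<mu>(2)[OF i] \<eta>] z])
    qed
  qed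
  have unstable: "mean_square_unstable w \<eta> K" if j: "j \<in> {2..CARD('n)}" "(\<eta>, lam j) \<notin> closure stability_region" for j
  proof -
    have "lam j \<in> \<mu> ` (UNIV - {i1})" unfolding img using j(1) by (rule imageI)
    then obtain i where i: "i \<noteq> i1" "\<mu> i = lam j"
    proof (rule imageE)
      fix i assume "lam j = \<mu> i" "i \<in> UNIV - {i1}"
      then show thesis by (intro that[of i]) auto
    qed
    obtain x v where sol: "network_error_solution w \<eta> K (\<lambda>_. 0) 0 x v"
      by (rule zero_data_solution_ex[OF w K uu Ku expand i1(1)]) (rule that)
    have "u i1 \<bullet> u i = 0" using uu[of i1 i] i by simp
    then have ou: "ones \<bullet> u i = 0" unfolding i1(1) by simp
    have ui: "u i \<bullet> u i = 1" by (simp add: uu)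
    show ?thesis
    proof (cases "\<eta> = 0")
      case True
      show ?thesis
      proof (rule mean_square_unstable_of_mode[OF w sol Ku ou ui])
        show "delay_solution \<eta> (\<eta> * \<mu> i) (\<lambda>_. 0) (\<lambda>t. t) (\<lambda>_. 1)"
          using delay_solution_linear True by simp
        show "\<exists>t\<ge>T. t > B" for T B :: real
          by (intro exI[of _ "max T (B + 1)"]) auto
      qed
    next
      case False
      obtain z where z: "Re z > 0" "char_fun \<eta> (\<eta> * \<mu> i) z = 0"
        using ex_unstable_root[OF j(2) False] unfolding i(2) by blast
      show ?thesis
        by (rule mean_square_unstable_of_mode[OF w sol Ku ou ui delay_solution_of_root[OF z(2)] exp_unbounded[OF z(1)]])
    qed
  qed
  show ?thesis
    using stable unstable ex1_mult_tan_eq stability_condition_iff[OF assms(1)] concave_on_phi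
      strict_mono_on_phi phi_0 phi_tendsto_0 phi_tendsto_top
    by blast
qed

end
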